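(* Let $p,n\ge 1$, $d_1\ge\cdots\ge d_p>0$, $D=\mathrm{diag}(d_1,\dots,d_p)$, $C=\mathrm{diag}(c_1,\dots,c_p)$ with $c_i\ge 1$ for all $i$, $\gamma\ge 1$ and $j\in\mathbb{R}$. Suppose $(X',Z')'\in\mathbb{R}^p\times\mathbb{R}^n$ is normal with mean $(\theta',0')'$ and covariance matrix $\sigma^2\,\mathrm{diag}(d_1,\dots,d_p,1,\dots,1)$, with $\theta\in\mathbb{R}^p$, $\sigma>0$ unknown. Let $b\ge 0$, $e>-p/2-n/2-2$ and $-p/2-1<a<n/2+e$, and let $\hat\theta_{\mathrm{GB}}$ be the generalized Bayes estimator of $\theta$ for the hierarchical prior with parameters $(a,b,e,\gamma,C)$ given in the context. If $c_1,\dots,c_p$ are chosen so that $$0\le\frac{p/2+a+1}{n/2+e-a}\le\frac{2}{n+2}\left(\frac{\sum_{i=1}^p d_i^{1-j}/c_i}{\max_{1\le i\le p} d_i^{1-j}/c_i}-2\right),$$ then $\hat\theta_{\mathrm{GB}}$ is minimax under the loss $L_j(\delta,\theta,\sigma^2)=(\delta-\theta)'D^{-j}(\delta-\theta)/\sigma^2$.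
   Context: Prior: with $\eta=\sigma^{-2}$, $\theta\mid\lambda,\eta\sim N_p(0,\eta^{-1}D(\lambda^{-1}C-I))$; $\lambda$ has (possibly improper) density proportional to $\lambda^a(1-\gamma\lambda)^b$ on $[0,1/\gamma]$; $\eta$ has improper density proportional to $\eta^e$ on $(0,\infty)$. Under $L_j$ the generalized Bayes estimator is $E(\eta\theta\mid X,S)/E(\eta\mid X,S)$, where $S=Z'Z$. Explicitly, with $W=X'C^{-1}D^{-1}X/S$, $$\hat\theta_{\mathrm{GB}}=\left(I-\frac{\phi_{\mathrm{GB}}(W)}{W}C^{-1}\right)X,\qquad \phi_{\mathrm{GB}}(w)=\frac{w}{\gamma}\,\frac{\int_0^1 t^{p/2+a+1}(1-t)^b(1+wt/\gamma)^{-p/2-n/2-e-2}\,dt}{\int_0^1 t^{p/2+a}(1-t)^b(1+wt/\gamma)^{-p/2-n/2-e-2}\,dt}.$$ The risk is $R_j(\delta,\theta,\sigma^2)=E[L_j(\delta(X,Z),\theta,\sigma^2)]$. The estimator $X$ is minimax with constant risk, so $\delta$ is minimax if and only if $R_j(\delta,\theta,\sigma^2)\le R_j(X,\theta,\sigma^2)$ for all $\theta$ and $\sigma>0$. *)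

theory Defs
  imports "HOL-Probability.Probability"
begin

text \<open>
  The diagonal matrices \<open>D\<close> and \<open>C\<close> are represented by their diagonals \<open>d\<close>, \<open>c\<close>. The dimensions
  \<open>p\<close> and \<open>n\<close> are \<open>CARD('p)\<close> and \<open>CARD('n)\<close>. The second argument of \<open>diag_normal_density\<close> is the
  diagonal of the covariance matrix (variances, whereas the library's \<open>normal_density\<close> takes a
  standard deviation).
\<close>

definition diag_normal_density :: "real ^ 'k \<Rightarrow> real ^ 'k \<Rightarrow> real ^ 'k \<Rightarrow> real" where
  "diag_normal_density \<mu> v x = (\<Prod>i\<in>UNIV. normal_density (\<mu> $ i) (sqrt (v $ i)) (x $ i))"

text \<open>
  In the model, \<open>s2\<close> stands for \<open>\<sigma>\<^sup>2\<close>, and an estimator is a function of the pair \<open>(X, Z)\<close>.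
\<close>

definition data_density ::
    "real ^ 'p \<Rightarrow> real ^ 'p \<Rightarrow> real \<Rightarrow> (real ^ 'p) \<times> (real ^ 'n) \<Rightarrow> real" where
  "data_density d \<theta> s2 = (\<lambda>(x, z).
     diag_normal_density \<theta> (\<chi> i. s2 * d $ i) x * diag_normal_density 0 (\<chi> k. s2) z)"

definition data_distr ::
    "real ^ 'p \<Rightarrow> real ^ 'p \<Rightarrow> real \<Rightarrow> ((real ^ 'p) \<times> (real ^ 'n)) measure" where
  "data_distr d \<theta> s2 = density lborel (\<lambda>y. ennreal (data_density d \<theta> s2 y))"

definition loss :: "real \<Rightarrow> real ^ 'p \<Rightarrow> real ^ 'p \<Rightarrow> real ^ 'p \<Rightarrow> real \<Rightarrow> real" where
  "loss j d \<delta> \<theta> s2 = (\<Sum>i\<in>UNIV. (d $ i) powr (- j) * (\<delta> $ i - \<theta> $ i)\<^sup>2) / s2"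

text \<open>The risk takes values in \<open>[0, \<infinity>]\<close>, so that estimators of infinite risk are not excluded.\<close>

definition risk ::
    "real \<Rightarrow> real ^ 'p \<Rightarrow> ((real ^ 'p) \<times> (real ^ 'n) \<Rightarrow> real ^ 'p) \<Rightarrow> real ^ 'p \<Rightarrow> real \<Rightarrow> ennreal"
  where
  "risk j d \<delta> \<theta> s2 = (\<integral>\<^sup>+ y. ennreal (loss j d (\<delta> y) \<theta> s2) \<partial>(data_distr d \<theta> s2))"

definition minimax ::
    "real \<Rightarrow> real ^ 'p \<Rightarrow> ((real ^ 'p) \<times> (real ^ 'n) \<Rightarrow> real ^ 'p) \<Rightarrow> bool" where
  "minimax j d \<delta> \<longleftrightarrow>
     \<delta> \<in> borel_measurable borel \<and>
     (\<forall>\<delta>' :: (real ^ 'p) \<times> (real ^ 'n) \<Rightarrow> real ^ 'p. \<delta>' \<in> borel_measurable borel \<longrightarrow>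
        (SUP (\<theta>, s2) \<in> UNIV \<times> {0<..}. risk j d \<delta> \<theta> s2)
          \<le> (SUP (\<theta>, s2) \<in> UNIV \<times> {0<..}. risk j d \<delta>' \<theta> s2))"

text \<open>
  Density, with respect to Lebesgue measure, of the (possibly improper) joint prior of
  \<open>(\<theta>, \<lambda>, \<eta>)\<close>, where \<open>\<eta> = 1 / \<sigma>\<^sup>2\<close>. The null set of endpoints of \<open>[0, 1/\<gamma>]\<close> is left out: there the
  conditional covariance of \<open>\<theta>\<close> may be undefined or singular.
\<close>

definition prior_density ::
    "real \<Rightarrow> real \<Rightarrow> real \<Rightarrow> real \<Rightarrow> real ^ 'p \<Rightarrow> real ^ 'p \<Rightarrow> (real ^ 'p) \<times> real \<times> real \<Rightarrow> real"
  where
  "prior_density a b e \<gamma> c d = (\<lambda>(\<theta>, l, \<eta>).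
     diag_normal_density 0 (\<chi> i. (1 / \<eta>) * (d $ i * (c $ i / l - 1))) \<theta>
       * (indicator {0<..<1 / \<gamma>} l * (l powr a * (1 - \<gamma> * l) powr b))
       * (indicator {0<..} \<eta> * \<eta> powr e))"

definition posterior_kernel ::
    "real \<Rightarrow> real \<Rightarrow> real \<Rightarrow> real \<Rightarrow> real ^ 'p \<Rightarrow> real ^ 'p \<Rightarrow> (real ^ 'p) \<times> (real ^ 'n)
      \<Rightarrow> (real ^ 'p) \<times> real \<times> real \<Rightarrow> real" where
  "posterior_kernel a b e \<gamma> c d y = (\<lambda>(\<theta>, l, \<eta>).
     data_density d \<theta> (1 / \<eta>) y * prior_density a b e \<gamma> c d (\<theta>, l, \<eta>))"

text \<open>
  The estimator \<open>E(\<eta> \<theta> | X, S) / E(\<eta> | X, S)\<close>, with \<open>S = Z'Z\<close>. Both conditional expectations have the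
  normalizing constant of the posterior as denominator; it cancels and is omitted, so that only the
  integrals of \<open>\<eta> \<theta>\<close> and \<open>\<eta>\<close> have to be finite, not the posterior mass. Since \<open>(X, S)\<close> is sufficient,
  conditioning on \<open>(X, Z)\<close> gives the same ratio.
\<close>

definition gen_bayes ::
    "real \<Rightarrow> real \<Rightarrow> real \<Rightarrow> real \<Rightarrow> real ^ 'p \<Rightarrow> real ^ 'p \<Rightarrow> (real ^ 'p) \<times> (real ^ 'n) \<Rightarrow> real ^ 'p"
  where
  "gen_bayes a b e \<gamma> c d y =
     (1 / (\<integral>(\<theta>, l, \<eta>). \<eta> * posterior_kernel a b e \<gamma> c d y (\<theta>, l, \<eta>) \<partial>lborel)) *\<^sub>R
     (\<integral>(\<theta>, l, \<eta>). (\<eta> * posterior_kernel a b e \<gamma> c d y (\<theta>, l, \<eta>)) *\<^sub>R \<theta> \<partial>lborel)"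

end

theory Submission
  imports Defs
begin

text \<open>
  Integrating out \<open>\<theta>\<close> (normal conjugacy) and \<open>\<eta>\<close> (a Gamma integral) shows that the estimator is
  \<open>X\<^sub>i - r(W) X\<^sub>i / c\<^sub>i\<close> with \<open>W = X'(CD)\<^sup>-\<^sup>1X / S\<close> and \<open>\<phi>(w) = w r(w)\<close>. The function \<open>\<phi>\<close> is nondecreasing (monotone
  likelihood ratio) and at most \<open>(p/2 + a + 1) / (n/2 + e - a)\<close>. Stein's identity in the coordinates of
  \<open>X\<close> and of \<open>Z\<close> writes the risk difference to \<open>X\<close> as the expectation of
  \<open>(\<phi>/W) (-2T + 4q + (n + 2) q \<phi>) - 4 q \<phi>' (1 + \<phi>)\<close>, where \<open>T\<close> is the sum of the
  \<open>d\<^sub>i\<^bsup>1-j\<^esup>/c\<^sub>i\<close> and \<open>q\<close> is at most their maximum, so the hypothesis makes the integrand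
  nonpositive. No estimator beats the constant risk of \<open>X\<close>, by comparison with the Bayes risks
  for the priors \<open>N(0, \<tau>D)\<close> as \<open>\<tau> \<rightarrow> \<infinity>\<close>.
\<close>

section \<open>Normal densities\<close>

text \<open>The estimator shrinks by a function of W, which couples X with Z, and the variance is
  unknown. Stein's identity in X treats the cross term of the loss, but the squared term r(W)^2
  Q(X), with Q a weighted quadratic form, yields no factor \<sigma>^2 in this way. Writing Q = q V
  and h(w) = w r(w)^2 turns it into the sum over k of Z_k times q(X) Z_k h(W), and the identity in
  Z_k supplies the missing \<sigma>^2. The divergence gives n h - 2 w h'; splitting off the
  derivative of \<phi> leaves the coefficient n + 2 of the hypothesis. Monotonicity of \<phi> lets
  the derivative terms be dropped.

  The analytic obstacle is that W is unbounded near Z = 0 while n may be 1. Boundedness of \<phi>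
  bounds h, so q(X) Z_k h(W) tends to 0 at Z = 0 and no boundary term arises; the bound A r for |w
  r'| keeps all integrands below a quadratic polynomial in the data.

  The two halves meet at the sum of the d_i^(1-j): it bounds the risk of the estimator from above at
  every parameter, and the supremum of the risk of any estimator from below.\<close>

lemma prod_Basis_vec: "prod F (Basis::(real^'k) set) = (\<Prod>i\<in>UNIV. F (axis i 1))"
proof -
  have "(Basis::(real^'k) set) = range (\<lambda>i. axis i 1)"
    by (auto simp: Basis_vec_def)
  moreover have inj: "inj (\<lambda>i. axis i (1::real) :: real^'k)"
    by (auto simp: inj_on_def axis_eq_axis)
  ultimately show ?thesis
    by (metis (no_types, lifting) prod.reindex_cong)
qed

lemma diag_normal_density_nonneg [simp]: "0 \<le> diag_normal_density \<mu> v x"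
  by (simp add: diag_normal_density_def prod_nonneg)

lemma borel_measurable_vec_nth [measurable]:
  "(\<lambda>x::real^'k. x $ i) \<in> borel_measurable borel"
  by (intro borel_measurable_continuous_onI continuous_intros)

lemma borel_measurable_vec_nth' [measurable (raw)]:
  "f \<in> borel_measurable M \<Longrightarrow> (\<lambda>x. (f x::real^'k) $ i) \<in> borel_measurable M"
  by measurable

lemma borel_measurable_vec_lambda [measurable (raw)]:
  fixes f :: "'a \<Rightarrow> 'k::finite \<Rightarrow> real"
  assumes "\<And>i. (\<lambda>x. f x i) \<in> borel_measurable M"
  shows "(\<lambda>x. (\<chi> i. f x i) :: real^'k) \<in> borel_measurable M"
proof (subst borel_measurable_euclidean_space, rule ballI)
  fix b :: "real^'k" assume "b \<in> Basis"
  then obtain i where "b = axis i 1" by (auto simp: Basis_vec_def)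
  with assms show "(\<lambda>x. (\<chi> i. f x i) \<bullet> b) \<in> borel_measurable M"
    by (simp add: inner_axis)
qed

lemma borel_measurable_diag_normal_density [measurable (raw)]:
  fixes \<mu> v x :: "'a \<Rightarrow> real^'k"
  assumes [measurable]: "\<mu> \<in> borel_measurable M" "v \<in> borel_measurable M" "x \<in> borel_measurable M"
  shows "(\<lambda>y. diag_normal_density (\<mu> y) (v y) (x y)) \<in> borel_measurable M"
  unfolding diag_normal_density_def normal_density_def by measurable

lemma nn_integral_normal_density: "0 < s \<Longrightarrow> (\<integral>\<^sup>+x. ennreal (normal_density m s x) \<partial>lborel) = 1"
  using prob_space.emeasure_space_1[OF prob_space_normal_density[of s m]]
  by (simp add: emeasure_density)

text \<open>\<open>f\<close> joins the factor of coordinate \<open>i\<close>, the integral of the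
  product splits, and each remaining factor has mass 1. With nonnegative integrals, finiteness of
  the value is not an issue.\<close>

lemma nn_integral_diag_normal_marginal:
  fixes \<mu> v :: "real^'k" and f :: "real \<Rightarrow> ennreal"
  assumes [measurable]: "f \<in> borel_measurable borel" and v: "\<And>i. 0 < v $ i"
  shows "(\<integral>\<^sup>+x. f (x $ i) * ennreal (diag_normal_density \<mu> v x) \<partial>lborel)
    = (\<integral>\<^sup>+t. f t * ennreal (normal_density (\<mu> $ i) (sqrt (v $ i)) t) \<partial>lborel)"
proof -
  let ?g = "\<lambda>b t. (if b = axis i 1 then f t else 1)
    * ennreal (normal_density (\<mu> \<bullet> b) (sqrt (v \<bullet> b)) t)"
  have split: "f c * ennreal (\<Prod>k\<in>UNIV. h k) = (\<Prod>k\<in>UNIV. (if k = i then f c else 1) * ennreal (h k))"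
    if "\<And>k. 0 \<le> h k" for c h
    using that by (simp add: prod.distrib prod_ennreal)
  have "(\<integral>\<^sup>+x. f (x $ i) * ennreal (diag_normal_density \<mu> v x) \<partial>lborel)
      = (\<integral>\<^sup>+x. (\<Prod>b\<in>(Basis::(real^'k) set). ?g b (x \<bullet> b)) \<partial>lborel)"
    unfolding diag_normal_density_def prod_Basis_vec
    by (subst split) (auto simp: inner_axis axis_eq_axis intro!: nn_integral_cong prod.cong)
  also have "\<dots> = (\<Prod>b\<in>(Basis::(real^'k) set). \<integral>\<^sup>+t. ?g b t \<partial>lborel)"
    by (rule nn_integral_lborel_prod) auto
  also have "\<dots> = (\<Prod>k\<in>UNIV. if k = i
      then (\<integral>\<^sup>+t. f t * ennreal (normal_density (\<mu> $ i) (sqrt (v $ i)) t) \<partial>lborel) else 1)"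
    unfolding prod_Basis_vec
    by (rule prod.cong) (use v in \<open>auto simp: inner_axis axis_eq_axis nn_integral_normal_density\<close>)
  finally show ?thesis by simp
qed

lemma nn_integral_diag_normal:
  fixes \<mu> v :: "real^'k"
  assumes "\<And>i. 0 < v $ i"
  shows "(\<integral>\<^sup>+x. ennreal (diag_normal_density \<mu> v x) \<partial>lborel) = 1"
  using nn_integral_diag_normal_marginal[of "\<lambda>_. 1" v undefined \<mu>] assms
  by (simp add: nn_integral_normal_density)

text \<open>The marginal law as a measure carries integrals of signed functions, such as the first
  moment, to the line.\<close>

lemma distr_diag_normal:
  fixes \<mu> v :: "real^'k"
  assumes "\<And>i. 0 < v $ i"
  shows "distr (density lborel (\<lambda>x. ennreal (diag_normal_density \<mu> v x))) borel (\<lambda>x. x $ i)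
    = density lborel (\<lambda>t. ennreal (normal_density (\<mu> $ i) (sqrt (v $ i)) t))"
proof (rule measure_eqI)
  fix A :: "real set" assume "A \<in> sets (distr (density lborel
    (\<lambda>x. ennreal (diag_normal_density \<mu> v x))) borel (\<lambda>x. x $ i))"
  then have [measurable]: "A \<in> sets borel" by simp
  have "emeasure (distr (density lborel (\<lambda>x. ennreal (diag_normal_density \<mu> v x))) borel (\<lambda>x. x $ i)) A
      = (\<integral>\<^sup>+x. indicator A (x $ i) * ennreal (diag_normal_density \<mu> v x) \<partial>lborel)"
    by (simp add: emeasure_distr emeasure_density indicator_def vimage_def mult.commute)
  also have "\<dots> = emeasure (density lborel
      (\<lambda>t. ennreal (normal_density (\<mu> $ i) (sqrt (v $ i)) t))) A"
    by (subst nn_integral_diag_normal_marginal[OF _ assms])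
       (auto simp: emeasure_density mult.commute)
  finally show "emeasure (distr (density lborel (\<lambda>x. ennreal (diag_normal_density \<mu> v x)))
    borel (\<lambda>x. x $ i)) A = emeasure (density lborel
      (\<lambda>t. ennreal (normal_density (\<mu> $ i) (sqrt (v $ i)) t))) A" .
qed simp

lemma has_bochner_integral_diag_normal_nth:
  fixes \<mu> v :: "real^'k"
  assumes v: "\<And>i. 0 < v $ i"
  shows "has_bochner_integral lborel (\<lambda>x. diag_normal_density \<mu> v x * x $ i) (\<mu> $ i)"
proof -
  let ?M = "density lborel (\<lambda>x. ennreal (diag_normal_density \<mu> v x))"
  let ?N = "density lborel (\<lambda>t. ennreal (normal_density (\<mu> $ i) (sqrt (v $ i)) t))"
  have "has_bochner_integral lborel (\<lambda>t. normal_density (\<mu> $ i) (sqrt (v $ i)) t *\<^sub>R t) (\<mu> $ i)"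
    unfolding real_scaleR_def by (rule normal_moment_nz_1) (simp add: v)
  then have "has_bochner_integral ?N (\<lambda>t. t) (\<mu> $ i)"
    by (intro has_bochner_integral_density) simp_all
  then have "has_bochner_integral (distr ?M borel (\<lambda>x. x $ i)) (\<lambda>t. t) (\<mu> $ i)"
    by (simp only: distr_diag_normal[OF v])
  then have i: "integrable ?M (\<lambda>x. x $ i)" "integral\<^sup>L ?M (\<lambda>x. x $ i) = \<mu> $ i"
    by (simp_all add: has_bochner_integral_iff integrable_distr_eq integral_distr)
  have [measurable]: "(\<lambda>x. diag_normal_density \<mu> v x) \<in> borel_measurable lborel"
    by simp
  show ?thesis
    using i by (simp add: has_bochner_integral_iff integral_real_density integrable_real_density)
qed

text \<open>Expand \<open>(t - c)^2\<close> as
  \<open>(t - m)^2 + 2 * (m - c) * t + (c^2 - m^2)\<close> and insert the moments. The centre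
  \<open>c\<close> is arbitrary because it later is the true mean, an action, or 0.\<close>

lemma nn_integral_normal_square:
  assumes "0 < s"
  shows "(\<integral>\<^sup>+t. ennreal ((t - c)\<^sup>2) * ennreal (normal_density m s t) \<partial>lborel)
    = ennreal (s\<^sup>2 + (m - c)\<^sup>2)"
proof -
  have 2: "has_bochner_integral lborel (\<lambda>t. normal_density m s t * (t - m)\<^sup>2) (s\<^sup>2)"
    using normal_moment_even[OF assms, of m 1] assms by (simp add: numeral_eq_Suc)
  have 1: "has_bochner_integral lborel (\<lambda>t. normal_density m s t * t) m"
    by (rule normal_moment_nz_1[OF assms])
  have 0: "has_bochner_integral lborel (normal_density m s) 1"
    using assms by (simp add: has_bochner_integral_iff)
  have "has_bochner_integral lborel (\<lambda>t. normal_density m s t * (t - m)\<^sup>2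
     + (2 * (m - c)) * (normal_density m s t * t) + (c\<^sup>2 - m\<^sup>2) * normal_density m s t)
     (s\<^sup>2 + (2 * (m - c)) * m + (c\<^sup>2 - m\<^sup>2) * 1)"
    by (intro has_bochner_integral_add has_bochner_integral_mult_right 0 1 2) 
  also have "(\<lambda>t. normal_density m s t * (t - m)\<^sup>2
     + (2 * (m - c)) * (normal_density m s t * t) + (c\<^sup>2 - m\<^sup>2) * normal_density m s t)
     = (\<lambda>t. (t - c)\<^sup>2 * normal_density m s t)"
    by (auto simp: fun_eq_iff power2_eq_square algebra_simps)
  also have "s\<^sup>2 + (2 * (m - c)) * m + (c\<^sup>2 - m\<^sup>2) * 1 = s\<^sup>2 + (m - c)\<^sup>2"
    by (simp add: power2_eq_square algebra_simps)
  finally have "has_bochner_integral lborel (\<lambda>t. (t - c)\<^sup>2 * normal_density m s t) (s\<^sup>2 + (m - c)\<^sup>2)" .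
  then have "(\<integral>\<^sup>+t. ennreal ((t - c)\<^sup>2 * normal_density m s t) \<partial>lborel) = ennreal (s\<^sup>2 + (m - c)\<^sup>2)"
    by (subst nn_integral_eq_integral) (auto simp: has_bochner_integral_iff)
  then show ?thesis by (simp add: ennreal_mult)
qed

lemma nn_integral_diag_normal_square:
  fixes \<mu> v :: "real^'k"
  assumes "\<And>i. 0 < v $ i"
  shows "(\<integral>\<^sup>+x. ennreal ((x $ i - c)\<^sup>2) * ennreal (diag_normal_density \<mu> v x) \<partial>lborel)
    = ennreal (v $ i + (\<mu> $ i - c)\<^sup>2)"
proof -
  have "0 \<le> v $ i" using assms[of i] by simp
  then show ?thesis
    using assms
    by (subst nn_integral_diag_normal_marginal[where f="\<lambda>t. ennreal ((t - c)\<^sup>2)"])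
       (simp_all add: nn_integral_normal_square)
qed

text \<open>Likelihood times prior is marginal times posterior, by completing the square in
  \<open>\<theta>\<close>. This serves both the hierarchical posterior and the Bayes risks of the
  lower bound.\<close>

lemma normal_density_conjugate:
  assumes u: "0 < u" and v: "0 < v"
  shows "normal_density \<theta> (sqrt v) x * normal_density 0 (sqrt u) \<theta>
    = normal_density 0 (sqrt (u + v)) x
      * normal_density (u / (u + v) * x) (sqrt (u * v / (u + v))) \<theta>"
proof -
  have uv: "0 < u + v" using u v by simp
  have eq: "(x - \<theta>)\<^sup>2 / v + \<theta>\<^sup>2 / u = x\<^sup>2 / (u + v) + (\<theta> - u / (u + v) * x)\<^sup>2 / (u * v / (u + v))"
  proof -
    have e: "\<theta> - u / (u + v) * x = ((u + v) * \<theta> - u * x) / (u + v)"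
      using uv by (simp add: field_simps)
    have "(\<theta> - u / (u + v) * x)\<^sup>2 / (u * v / (u + v)) = ((u + v) * \<theta> - u * x)\<^sup>2 / (u * v * (u + v))"
      unfolding e using u v uv by (simp add: power_divide power2_eq_square divide_simps)
    moreover have "(x - \<theta>)\<^sup>2 / v + \<theta>\<^sup>2 / u - x\<^sup>2 / (u + v)
        = ((u * (u+v)) * (x - \<theta>)\<^sup>2 + (v * (u+v)) * \<theta>\<^sup>2 - (u * v) * x\<^sup>2) / (u * v * (u + v))"
      using u v uv by (simp add: divide_simps) (simp add: algebra_simps)
    moreover have "(u * (u+v)) * (x - \<theta>)\<^sup>2 + (v * (u+v)) * \<theta>\<^sup>2 - (u * v) * x\<^sup>2 = ((u + v) * \<theta> - u * x)\<^sup>2"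
      by (simp add: power2_eq_square algebra_simps)
    ultimately show ?thesis by simp
  qed
  have half: "- A / (2 * B) = - (A / B) / 2" for A B :: real
    by simp
  have neg_half: "- A / 2 + - B / 2 = - C / 2 + - D / 2" if "A + B = C + D" for A B C D :: real
    using that by simp
  have ex: "(- ((x - \<theta>)\<^sup>2) / (2 * v)) + (- (\<theta>\<^sup>2) / (2 * u))
      = (- (x\<^sup>2) / (2 * (u + v))) + (- ((\<theta> - u / (u + v) * x)\<^sup>2) / (2 * (u * v / (u + v))))"
    unfolding half by (rule neg_half[OF eq])
  \<comment> \<open>The normalizing constants agree because the product of the two variances is
    \<open>u * v\<close> on either side.\<close>
  have cs: "sqrt (2 * pi * v) * sqrt (2 * pi * u)
      = sqrt (2 * pi * (u + v)) * sqrt (2 * pi * (u * v / (u + v)))"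
    using u v uv by (simp flip: real_sqrt_mult)
  have nd: "normal_density m (sqrt w) y = exp (- ((y - m)\<^sup>2) / (2 * w)) / sqrt (2 * pi * w)"
    if "0 < w" for m w y
    using that by (simp add: normal_density_def)
  have w: "0 < u * v / (u + v)" using u v uv by simp
  show ?thesis
    unfolding nd[OF u] nd[OF v] nd[OF uv] nd[OF w] times_divide_times_eq exp_add[symmetric] diff_0_right ex cs
    by (rule refl)
qed

lemma diag_normal_density_conjugate:
  assumes u: "\<And>i. 0 < u $ i" and v: "\<And>i. 0 < v $ i"
  shows "diag_normal_density \<theta> v x * diag_normal_density 0 u \<theta>
    = diag_normal_density 0 (\<chi> i. u $ i + v $ i) x
      * diag_normal_density (\<chi> i. u $ i / (u $ i + v $ i) * x $ i)
          (\<chi> i. u $ i * v $ i / (u $ i + v $ i)) \<theta>"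
  unfolding diag_normal_density_def prod.distrib[symmetric]
  using normal_density_conjugate[OF u v] by simp

section \<open>Stein's identity\<close>

lemma integrable_lborel_translate:
  fixes f :: "'e::euclidean_space \<Rightarrow> real"
  assumes "integrable lborel f"
  shows "integrable lborel (\<lambda>y. f (y + c))" "(\<integral>y. f (y + c) \<partial>lborel) = integral\<^sup>L lborel f"
proof -
  have [measurable]: "f \<in> borel_measurable borel" using assms by auto
  have "integrable (distr lborel borel ((+) c)) f"
    using assms by (simp add: lborel_distr_plus)
  then show "integrable lborel (\<lambda>y. f (y + c))"
    by (simp add: integrable_distr_eq add.commute)
  have "integral\<^sup>L (distr lborel borel ((+) c)) f = (\<integral>y. f (y + c) \<partial>lborel)"
    by (simp add: integral_distr add.commute)
  then show "(\<integral>y. f (y + c) \<partial>lborel) = integral\<^sup>L lborel f"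
    by (simp add: lborel_distr_plus)
qed

text \<open>By translation invariance, \<open>0 = \<integral>F(y + b) - F(y) = \<integral>\<integral>\<^sub>0\<^sup>1 G(y + s b) = \<integral>G\<close>; this form
  needs no decay of \<open>F\<close> at infinity.\<close>

lemma integral_directional_derivative_eq_0:
  fixes F G :: "'e::euclidean_space \<Rightarrow> real"
  assumes F: "integrable lborel F" and G: "integrable lborel G"
    and fin: "\<And>y. finite {s. y + s *\<^sub>R b \<in> N}"
    and cont: "\<And>y. y \<in> N \<Longrightarrow> isCont (\<lambda>s. F (y + s *\<^sub>R b)) 0"
    and der: "\<And>y. y \<notin> N \<Longrightarrow> ((\<lambda>s. F (y + s *\<^sub>R b)) has_real_derivative G y) (at 0)"
  shows "integral\<^sup>L lborel G = 0"
proof -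
  have [measurable]: "F \<in> borel_measurable borel" "G \<in> borel_measurable borel"
    using F G by auto
  let ?f = "\<lambda>s y. indicator {0..1} s *\<^sub>R G (y + s *\<^sub>R b)"
  have der_at: "((\<lambda>s. F (y + s *\<^sub>R b)) has_real_derivative G (y + t *\<^sub>R b)) (at t)"
    if "y + t *\<^sub>R b \<notin> N" for y t
  proof -
    have "((\<lambda>s. F ((y + t *\<^sub>R b) + s *\<^sub>R b)) has_real_derivative G (y + t *\<^sub>R b)) (at 0)"
      by (rule der) (rule that)
    then have "((\<lambda>s. (\<lambda>u. F (y + u *\<^sub>R b)) (s + t)) has_real_derivative G (y + t *\<^sub>R b)) (at 0)"
      by (simp add: algebra_simps)
    then show ?thesis
      by (subst (asm) DERIV_shift[symmetric]) simp
  qed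
  have cont_at: "isCont (\<lambda>s. F (y + s *\<^sub>R b)) t" for y t
  proof (cases "y + t *\<^sub>R b \<in> N")
    case True
    from cont[OF this] have "isCont (\<lambda>s. F (y + t *\<^sub>R b + s *\<^sub>R b)) (t - t)"
      by simp
    then have "isCont (\<lambda>u. F (y + t *\<^sub>R b + (u - t) *\<^sub>R b)) t"
      by (intro isCont_o2[where f="\<lambda>u. u - t" and g="\<lambda>s. F (y + t *\<^sub>R b + s *\<^sub>R b)"])
         (auto intro!: continuous_intros)
    then show ?thesis
      by (simp add: algebra_simps)
  qed (use der_at DERIV_isCont in blast)
  \<comment> \<open>By translation invariance all slices with \<open>s\<close> in the unit interval
    have the same L1 norm, that of \<open>G\<close>.\<close>
  have int: "integrable (lborel \<Otimes>\<^sub>M lborel) (case_prod ?f)"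
  proof (rule lborel_pair.Fubini_integrable)
    show "(\<lambda>(s, y). ?f s y) \<in> borel_measurable (lborel \<Otimes>\<^sub>M lborel)"
      by measurable
    have "(\<integral>y. norm (?f s y) \<partial>lborel) = indicator {0..1} s *\<^sub>R (\<integral>y. \<bar>G y\<bar> \<partial>lborel)" for s
      using integrable_lborel_translate(2)[of "\<lambda>y. \<bar>G y\<bar>" "s *\<^sub>R b"] G
      by (simp add: abs_mult)
    then show "integrable lborel (\<lambda>s. \<integral>y. norm (case (s, y) of (s, y) \<Rightarrow> ?f s y) \<partial>lborel)"
      by simp
    show "AE s in lborel. integrable lborel (\<lambda>y. case (s, y) of (s, y) \<Rightarrow> ?f s y)"
      using integrable_lborel_translate(1)[OF G] by simp
  qed
  have "integral\<^sup>L lborel G = (\<integral>s. indicator {0..1::real} s *\<^sub>R integral\<^sup>L lborel G \<partial>lborel)"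
    by (simp add: content_real)
  also have "\<dots> = (\<integral>s. \<integral>y. ?f s y \<partial>lborel \<partial>lborel)"
    using integrable_lborel_translate(2)[OF G] by simp
  also have "\<dots> = (\<integral>y. \<integral>s. ?f s y \<partial>lborel \<partial>lborel)"
    by (rule lborel_pair.Fubini_integral[symmetric, OF int])
  also have "\<dots> = (\<integral>y. F (y + b) - F y \<partial>lborel)"
  proof (rule integral_cong_AE)
    show "AE y in lborel. (\<integral>s. ?f s y \<partial>lborel) = F (y + b) - F y"
      using lborel_pair.AE_integrable_snd[OF int]
    proof eventually_elim
      case (elim y)
      then have si: "set_integrable lborel {0..1} (\<lambda>s. G (y + s *\<^sub>R b))"
        by (simp add: set_integrable_def)
      \<comment> \<open>Along the segment from \<open>y\<close> to \<open>y + b\<close> this version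
        of the fundamental theorem admits the finitely many points of \<open>N\<close>, where only
        continuity is known.\<close>
      have "((\<lambda>s. G (y + s *\<^sub>R b)) has_integral
          F (y + 1 *\<^sub>R b) - F (y + 0 *\<^sub>R b)) {0..1}"
        by (rule fundamental_theorem_of_calculus_strong[OF fin[of y]])
          (use der_at cont_at in \<open>auto simp: has_real_derivative_iff_has_vector_derivative[symmetric]
            intro!: continuous_at_imp_continuous_on\<close>)
      then have "integral {0..1} (\<lambda>s. G (y + s *\<^sub>R b)) = F (y + b) - F y"
        by (simp add: integral_unique)
      then show ?case
        using set_borel_integral_eq_integral(2)[OF si] by (simp add: set_lebesgue_integral_def)
    qed
  qed measurable
  also have "\<dots> = 0"
    using integrable_lborel_translate[OF F, of b] F by simp
  finally show ?thesis .
qed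

text \<open>The product \<open>g f\<close> is differentiated along \<open>b\<close>, where
  \<open>f\<close> has logarithmic derivative \<open>- m y / v\<close>; the integral of the result
  vanishes. Leaving \<open>f\<close> and \<open>N\<close> abstract covers the coordinates of X and
  of Z alike.\<close>

lemma Stein_identity:
  fixes f g g' m :: "'e::euclidean_space \<Rightarrow> real"
  assumes "0 < v"
    and f: "\<And>y. ((\<lambda>s. f (y + s *\<^sub>R b)) has_real_derivative - (m y / v * f y)) (at 0)"
    and fin: "\<And>y. finite {s. y + s *\<^sub>R b \<in> N}"
    and g_cont: "\<And>y. y \<in> N \<Longrightarrow> isCont (\<lambda>s. g (y + s *\<^sub>R b)) 0"
    and g_der: "\<And>y. y \<notin> N \<Longrightarrow> ((\<lambda>s. g (y + s *\<^sub>R b)) has_real_derivative g' y) (at 0)"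
    and int_g: "integrable lborel (\<lambda>y. g y * f y)"
    and int_g': "integrable lborel (\<lambda>y. g' y * f y)"
    and int_mg: "integrable lborel (\<lambda>y. m y * g y * f y)"
  shows "(\<integral>y. m y * g y * f y \<partial>lborel) = v * (\<integral>y. g' y * f y \<partial>lborel)"
proof -
  have "(\<integral>y. g' y * f y - m y * g y * f y / v \<partial>lborel) = 0"
  proof (rule integral_directional_derivative_eq_0[OF int_g _ fin])
    show "integrable lborel (\<lambda>y. g' y * f y - m y * g y * f y / v)"
      using int_g' int_mg by simp
  next
    fix y assume "y \<in> N"
    from g_cont[OF this] DERIV_isCont[OF f] show "isCont (\<lambda>s. g (y + s *\<^sub>R b) * f (y + s *\<^sub>R b)) 0"
      by (rule continuous_mult)
  next
    fix y assume "y \<notin> N"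
    from DERIV_mult[OF g_der[OF this] f]
    show "((\<lambda>s. g (y + s *\<^sub>R b) * f (y + s *\<^sub>R b)) has_real_derivative
        g' y * f y - m y * g y * f y / v) (at 0)"
      by (simp add: algebra_simps)
  qed
  then show ?thesis
    using int_g' int_mg \<open>0 < v\<close> by (simp add: field_simps)
qed

lemma diag_normal_density_directional_derivative:
  fixes \<mu> v x :: "real^'k"
  assumes "0 < v $ i"
  shows "((\<lambda>s. diag_normal_density \<mu> v (x + s *\<^sub>R axis i 1)) has_real_derivative
    - ((x $ i - \<mu> $ i) / v $ i * diag_normal_density \<mu> v x)) (at 0)"
proof -
  have split: "diag_normal_density \<mu> v (x + s *\<^sub>R axis i 1)
      = normal_density (\<mu> $ i) (sqrt (v $ i)) (x $ i + s)
        * (\<Prod>k\<in>UNIV - {i}. normal_density (\<mu> $ k) (sqrt (v $ k)) (x $ k))" for s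
  proof -
    have "diag_normal_density \<mu> v (x + s *\<^sub>R axis i 1)
      = (\<Prod>k\<in>insert i (UNIV - {i}). normal_density (\<mu> $ k) (sqrt (v $ k)) ((x + s *\<^sub>R axis i 1) $ k))"
      by (simp add: diag_normal_density_def insert_absorb)
    also have "\<dots> = normal_density (\<mu> $ i) (sqrt (v $ i)) (x $ i + s)
        * (\<Prod>k\<in>UNIV - {i}. normal_density (\<mu> $ k) (sqrt (v $ k)) (x $ k))"
      by (subst prod.insert) (auto simp: axis_def intro!: arg_cong2[where f="(*)"] prod.cong)
    finally show ?thesis .
  qed
  have "((\<lambda>s. normal_density (\<mu> $ i) (sqrt (v $ i)) (x $ i + s)) has_real_derivative
      - ((x $ i - \<mu> $ i) / v $ i * normal_density (\<mu> $ i) (sqrt (v $ i)) (x $ i))) (at 0)"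
  proof -
    have "((\<lambda>s. K * exp (- (x $ i + s - \<mu> $ i)\<^sup>2 / (2 * v $ i))) has_real_derivative
      - ((x $ i - \<mu> $ i) / v $ i * (K * exp (- (x $ i - \<mu> $ i)\<^sup>2 / (2 * v $ i))))) (at 0)" for K
      using assms by (auto intro!: derivative_eq_intros simp: field_simps)
    from this[of "1 / sqrt (2 * pi * (sqrt (v $ i))\<^sup>2)"] show ?thesis
      unfolding normal_density_def using assms by simp
  qed
  from DERIV_cmult_right[OF this, of "\<Prod>k\<in>UNIV - {i}. normal_density (\<mu> $ k) (sqrt (v $ k)) (x $ k)"]
  show ?thesis
    unfolding split using split[of 0] by (simp add: mult.assoc)
qed

section \<open>The shrinkage function\<close>

text \<open>Difference quotients converge pointwise and, by the mean value inequality on the convex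
  set \<open>U\<close>, are dominated by \<open>g\<close>; dominated convergence does the
  rest.\<close>

lemma has_real_derivative_lebesgue_integral:
  fixes f f' :: "real \<Rightarrow> 'a \<Rightarrow> real"
  assumes U: "open U" "convex U" "x \<in> U"
    and f: "\<And>w. w \<in> U \<Longrightarrow> integrable M (f w)"
    and der: "\<And>w a. w \<in> U \<Longrightarrow> a \<in> space M \<Longrightarrow> ((\<lambda>w. f w a) has_real_derivative f' w a) (at w)"
    and bound: "\<And>w a. w \<in> U \<Longrightarrow> a \<in> space M \<Longrightarrow> \<bar>f' w a\<bar> \<le> g a"
    and g: "integrable M g" and f': "f' x \<in> borel_measurable M"
  shows "((\<lambda>w. \<integral>a. f w a \<partial>M) has_real_derivative (\<integral>a. f' x a \<partial>M)) (at x)"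
proof -
  have "((\<lambda>y. ((\<integral>a. f y a \<partial>M) - (\<integral>a. f x a \<partial>M)) / (y - x)) \<longlongrightarrow> (\<integral>a. f' x a \<partial>M)) (at x within U)"
    unfolding tendsto_at_iff_sequentially o_def
  proof (intro allI impI)
    fix X assume X: "\<forall>i. X i \<in> U - {x}" "X \<longlonglongrightarrow> x"
    have "(\<lambda>i. \<integral>a. (f (X i) a - f x a) / (X i - x) \<partial>M) \<longlonglongrightarrow> (\<integral>a. f' x a \<partial>M)"
    proof (rule integral_dominated_convergence[OF f' _ g])
      show "(\<lambda>a. (f (X i) a - f x a) / (X i - x)) \<in> borel_measurable M" for i
        using f[of "X i"] f[of x] X U by (auto intro!: borel_measurable_divide borel_measurable_diff)
      show "AE a in M. (\<lambda>i. (f (X i) a - f x a) / (X i - x)) \<longlonglongrightarrow> f' x a"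
      proof (rule AE_I2)
        fix a assume a: "a \<in> space M"
        have "((\<lambda>y. (f y a - f x a) / (y - x)) \<longlongrightarrow> f' x a) (at x)"
          using der[OF \<open>x \<in> U\<close> a] by (simp add: has_field_derivative_iff)
        then show "(\<lambda>i. (f (X i) a - f x a) / (X i - x)) \<longlonglongrightarrow> f' x a"
          using X unfolding tendsto_at_iff_sequentially o_def by auto
      qed
      show "AE a in M. norm ((f (X i) a - f x a) / (X i - x)) \<le> g a" for i
      proof (rule AE_I2)
        fix a assume a: "a \<in> space M"
        have "norm (f (X i) a - f x a) \<le> g a * norm (X i - x)"
          by (rule field_differentiable_bound[where S=U and f'="\<lambda>w. f' w a"])
             (use U X der a bound in \<open>auto intro: has_field_derivative_at_within\<close>)
        moreover have "0 < norm (X i - x)" using X by auto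
        ultimately show "norm ((f (X i) a - f x a) / (X i - x)) \<le> g a"
          by (simp add: norm_divide divide_le_eq)
      qed
    qed
    moreover have "(\<integral>a. (f (X i) a - f x a) / (X i - x) \<partial>M)
        = ((\<integral>a. f (X i) a \<partial>M) - (\<integral>a. f x a \<partial>M)) / (X i - x)" for i
      using f[of "X i"] f[of x] X U by simp
    ultimately show "(\<lambda>i. ((\<integral>a. f (X i) a \<partial>M) - (\<integral>a. f x a \<partial>M)) / (X i - x))
        \<longlonglongrightarrow> (\<integral>a. f' x a \<partial>M)"
      by (simp only:)
  qed
  then show ?thesis
    using at_within_open[OF \<open>x \<in> U\<close> \<open>open U\<close>] by (simp add: has_field_derivative_iff)
qed

text \<open>With \<open>\<alpha> = p/2 + a\<close>, \<open>A = p/2 + n/2 + e + 2\<close> and \<open>l = t/\<gamma>\<close>, the function \<open>w r(w)\<close> below is the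
  \<open>\<phi>\<close> of the generalized Bayes estimator.\<close>

locale beta_mixture =
  fixes \<alpha> b A \<gamma> :: real
  assumes \<alpha>: "-1 < \<alpha>" and b: "0 \<le> b" and A: "\<alpha> + 2 < A" and \<gamma>: "1 \<le> \<gamma>"
begin

definition wt :: "real \<Rightarrow> real" where
  "wt l = indicator {0<..<1 / \<gamma>} l * (l powr \<alpha> * (1 - \<gamma> * l) powr b)"

definition J :: "nat \<Rightarrow> real \<Rightarrow> real \<Rightarrow> real" where
  "J k q w = (\<integral>l. wt l * l ^ k * (1 + w * l) powr (- q) \<partial>lborel)"

text \<open>The mean of \<open>l\<close> under the weight
  \<open>wt l * (1 + w * l) powr - A\<close>: the posterior mean of \<lambda>, weighted by
  \<eta>.\<close>

definition r :: "real \<Rightarrow> real" where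
  "r w = J 1 A w / J 0 A w"

text \<open>The quotient rule, given that \<open>J k q\<close> has derivative
  \<open>- q * J (Suc k) (q + 1) w\<close>.\<close>

definition r' :: "real \<Rightarrow> real" where
  "r' w = A * (J 1 A w * J 1 (A + 1) w - J 2 (A + 1) w * J 0 A w) / (J 0 A w)\<^sup>2"

lemma \<gamma>_pos: "0 < \<gamma>" and A_gt_1: "1 < A"
  using \<gamma> A \<alpha> by auto

lemma measurable_wt [measurable]: "wt \<in> borel_measurable borel"
  unfolding wt_def by measurable

text \<open>The admissible \<open>w\<close> extend to the left of 0 so that \<open>r\<close> has a
  two-sided derivative at w = 0, the value of W where X = 0. The bound \<open>l < 1\<close> will
  keep the posterior variances positive.\<close>

lemma supportD:
  assumes "0 < l" "l < 1 / \<gamma>"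
  shows "l < 1" "\<gamma> * l < 1" "-\<gamma>/2 < w \<Longrightarrow> 1/2 < 1 + w * l"
proof -
  show 1: "\<gamma> * l < 1" using assms \<gamma>_pos by (simp add: field_simps)
  have "1 * l \<le> \<gamma> * l" using assms \<gamma> by (intro mult_right_mono) auto
  with 1 show "l < 1" by simp
  assume "-\<gamma>/2 < w"
  then have "-\<gamma>/2 * l < w * l" using assms by (intro mult_strict_right_mono) auto
  with 1 show "1/2 < 1 + w * l" by simp
qed

section \<open>Integrability, positivity and derivatives of the mixture integrals\<close>

lemma wt_nonneg [simp]: "0 \<le> wt l"
  by (simp add: wt_def)

lemma wt_pos: "0 < l \<Longrightarrow> l < 1 / \<gamma> \<Longrightarrow> 0 < wt l"
  using supportD[of l] by (simp add: wt_def)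

lemma wt_eq_0: "\<not> (0 < l \<and> l < 1 / \<gamma>) \<Longrightarrow> wt l = 0"
  by (auto simp: wt_def)

text \<open>As \<open>b\<close> is nonnegative, the factor in \<open>1 - \<gamma> * l\<close> is at
  most 1, and the Beta integrand with parameters \<open>\<alpha> + 1\<close> and 1
  dominates.\<close>

lemma integrable_wt: "integrable lborel wt"
proof (rule Bochner_Integration.integrable_bound)
  show "integrable lborel (\<lambda>t. indicator {0..1} t *\<^sub>R (t powr (\<alpha> + 1 - 1) * (1 - t) powr (1 - 1)))"
    using integrable_Beta[of "\<alpha> + 1" 1] \<alpha> by (simp add: set_integrable_def)
  show "AE l in lborel. norm (wt l)
      \<le> norm (indicator {0..1} l *\<^sub>R (l powr (\<alpha> + 1 - 1) * (1 - l) powr (1 - 1)))"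
  proof (rule AE_I2)
    fix l
    show "norm (wt l) \<le> norm (indicator {0..1} l *\<^sub>R (l powr (\<alpha> + 1 - 1) * (1 - l) powr (1 - 1)))"
    proof (cases "0 < l \<and> l < 1 / \<gamma>")
      case True
      note s = supportD[of l]
      have "(1 - \<gamma> * l) powr b \<le> 1 powr b"
        using True s b \<gamma>_pos by (intro powr_mono2) auto
      then have "l powr \<alpha> * (1 - \<gamma> * l) powr b \<le> l powr \<alpha> * 1"
        by (intro mult_left_mono) auto
      with True s show ?thesis by (simp add: wt_def)
    qed (simp add: wt_eq_0)
  qed
qed simp

lemma kernel_le:
  assumes "-\<gamma>/2 < w" "0 \<le> q"
  shows "wt l * l ^ k * (1 + w * l) powr (- q) \<le> wt l * 2 powr q"
proof (cases "0 < l \<and> l < 1 / \<gamma>")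
  case True
  note s = supportD[of l]
  have "(1 + w * l) powr (- q) \<le> (1/2) powr (- q)"
    using True s assms by (intro powr_mono2') (auto intro: less_imp_le)
  also have "\<dots> = 2 powr q" by (simp add: powr_minus powr_divide)
  finally have "l ^ k * (1 + w * l) powr (- q) \<le> 1 * 2 powr q"
    using True s by (intro mult_mono power_le_one) auto
  then show ?thesis using wt_nonneg[of l] by (simp add: mult.assoc mult_left_mono)
qed (simp add: wt_eq_0)

lemma kernel_nonneg: "0 \<le> wt l * l ^ k * (1 + w * l) powr (- q)"
  by (cases "0 < l \<and> l < 1 / \<gamma>") (auto simp: wt_eq_0)

lemma integrable_kernel:
  assumes "-\<gamma>/2 < w" "0 \<le> q"
  shows "integrable lborel (\<lambda>l. wt l * l ^ k * (1 + w * l) powr (- q))"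
proof (rule Bochner_Integration.integrable_bound)
  show "integrable lborel (\<lambda>l. wt l * 2 powr q)" using integrable_wt by simp
  show "AE l in lborel. norm (wt l * l ^ k * (1 + w * l) powr (- q)) \<le> norm (wt l * 2 powr q)"
    using kernel_le[OF assms] kernel_nonneg by (auto intro!: AE_I2)
qed measurable

lemma J_nonneg: "0 \<le> J k q w"
  unfolding J_def using kernel_nonneg by (rule integral_nonneg_AE[OF AE_I2])

lemma integral_support_pos:
  fixes f :: "real \<Rightarrow> real"
  assumes f: "integrable lborel f" and "\<And>l. 0 \<le> f l" and "\<And>l. 0 < l \<Longrightarrow> l < 1 / \<gamma> \<Longrightarrow> 0 < f l"
  shows "0 < integral\<^sup>L lborel f"
proof -
  have "integral\<^sup>L lborel f \<noteq> 0"
  proof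
    assume "integral\<^sup>L lborel f = 0"
    then have "AE l in lborel. f l = 0"
      using integral_nonneg_eq_0_iff_AE[OF f] assms(2) by simp
    then have "AE l in lborel. l \<notin> {0<..<1 / \<gamma>}"
      by eventually_elim (use assms(3) in force)
    then have "emeasure lborel {0<..<1 / \<gamma>} = 0"
      by (subst (asm) AE_iff_measurable[OF _ refl])
         (auto simp: greaterThanLessThan_def greaterThan_def lessThan_def Int_def)
    then show False using \<gamma>_pos by simp
  qed
  moreover have "0 \<le> integral\<^sup>L lborel f"
    using assms(2) by simp
  ultimately show ?thesis by simp
qed

lemma J_pos:
  assumes "-\<gamma>/2 < w" "0 \<le> q"
  shows "0 < J k q w"
  unfolding J_def
proof (rule integral_support_pos[OF integrable_kernel[OF assms] kernel_nonneg])
  fix l :: real assume l: "0 < l" "l < 1 / \<gamma>"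
  have "0 < 1 + w * l" using supportD(3)[OF l assms(1)] by simp
  then show "0 < wt l * l ^ k * (1 + w * l) powr - q"
    using l wt_pos by simp
qed

lemma J_Suc_le:
  assumes "-\<gamma>/2 < w" "0 \<le> q"
  shows "J (Suc k) q w \<le> J k q w"
  unfolding J_def
proof (rule integral_mono[OF integrable_kernel[OF assms] integrable_kernel[OF assms]])
  fix l
  show "wt l * l ^ Suc k * (1 + w * l) powr - q \<le> wt l * l ^ k * (1 + w * l) powr - q"
  proof (cases "0 < l \<and> l < 1 / \<gamma>")
    case True
    then have "l ^ Suc k \<le> l ^ k" using supportD(1)[of l] by (simp add: mult_left_le_one_le)
    then show ?thesis by (intro mult_right_mono mult_left_mono) auto
  qed (simp add: wt_eq_0)
qed

text \<open>Enlarging \<open>w * l\<close> to \<open>1 + w * l\<close> cancels one power of the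
  kernel. This keeps \<open>w\<close> times a derivative bounded as \<open>w\<close> grows.\<close>

lemma w_J_Suc_le:
  assumes w: "0 \<le> w" and q: "0 \<le> q"
  shows "w * J (Suc k) (q + 1) w \<le> J k q w"
proof -
  have w': "-\<gamma>/2 < w" using w \<gamma>_pos by simp
  have "w * J (Suc k) (q + 1) w = (\<integral>l. w * (wt l * l ^ Suc k * (1 + w * l) powr - (q + 1)) \<partial>lborel)"
    unfolding J_def by simp
  also have "\<dots> \<le> J k q w"
    unfolding J_def
  proof (rule integral_mono)
    have "0 \<le> q + 1" using q by simp
    then show "integrable lborel (\<lambda>l. w * (wt l * l ^ Suc k * (1 + w * l) powr - (q + 1)))"
      by (intro integrable_mult_right integrable_kernel w')
    show "integrable lborel (\<lambda>l. wt l * l ^ k * (1 + w * l) powr - q)"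
      by (rule integrable_kernel[OF w' q])
    fix l
    show "w * (wt l * l ^ Suc k * (1 + w * l) powr - (q + 1)) \<le> wt l * l ^ k * (1 + w * l) powr - q"
    proof (cases "0 < l \<and> l < 1 / \<gamma>")
      case True
      then have p: "0 \<le> w * l" using w by simp
      have e: "(1 + w * l) powr - q = (1 + w * l) powr - (q + 1) * (1 + w * l)"
        using p powr_add[of "1 + w * l" "- (q + 1)" 1] by simp
      have "(wt l * l ^ k * (1 + w * l) powr - (q + 1)) * (w * l)
          \<le> (wt l * l ^ k * (1 + w * l) powr - (q + 1)) * (1 + w * l)"
        using True by (intro mult_left_mono) auto
      then show ?thesis unfolding e by (simp add: mult_ac)
    qed (simp add: wt_eq_0)
  qed
  finally show ?thesis .
qed

lemma J_derivative:
  assumes w: "-\<gamma>/2 < w" and q: "0 \<le> q"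
  shows "(J k q has_real_derivative - q * J (Suc k) (q + 1) w) (at w)"
proof -
  let ?f' = "\<lambda>w l. - q * (wt l * l ^ Suc k * (1 + w * l) powr (- (q + 1)))"
  have "((\<lambda>w. \<integral>l. wt l * l ^ k * (1 + w * l) powr (- q) \<partial>lborel) has_real_derivative
      (\<integral>l. ?f' w l \<partial>lborel)) (at w)"
  \<comment> \<open>On this half-line \<open>1 + w * l\<close> exceeds 1/2 throughout the support,
    so one dominating function serves for all \<open>w\<close>.\<close>
  proof (rule has_real_derivative_lebesgue_integral[where U="{-\<gamma>/2<..}"])
    show "integrable lborel (\<lambda>l. q * (wt l * 2 powr (q + 1)))"
      using integrable_wt by simp
    fix w l :: real assume w: "w \<in> {-\<gamma>/2<..}"
    show "\<bar>?f' w l\<bar> \<le> q * (wt l * 2 powr (q + 1))"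
      using kernel_le[of w "q + 1" l "Suc k"] kernel_nonneg[of l "Suc k" w "q + 1"] w q
      by (simp add: abs_mult mult_left_mono)
    show "((\<lambda>w. wt l * l ^ k * (1 + w * l) powr (- q)) has_real_derivative ?f' w l) (at w)"
    proof (cases "0 < l \<and> l < 1 / \<gamma>")
      case True
      then have "0 < 1 + w * l" using supportD(3)[of l w] w by auto
      then have "((\<lambda>w. (1 + w * l) powr (- q)) has_real_derivative
          (- q) * (1 + w * l) powr (- q - 1) * l) (at w)"
        by (intro DERIV_fun_powr[THEN DERIV_cong]) (auto intro!: derivative_eq_intros)
      from DERIV_cmult[OF this, of "wt l * l ^ k"] show ?thesis
        by (simp add: mult_ac)
    qed (simp add: wt_eq_0)
  qed (use w q integrable_kernel in auto)
  then show ?thesis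
    by (simp add: J_def[abs_def])
qed

lemma r_derivative:
  assumes w: "-\<gamma>/2 < w"
  shows "(r has_real_derivative r' w) (at w)"
proof -
  have "0 < J 0 A w" "0 \<le> A" using J_pos[OF w, of A 0] A_gt_1 by auto
  then have "((\<lambda>w. J 1 A w / J 0 A w) has_real_derivative
      (- A * J (Suc 1) (A + 1) w * J 0 A w - J 1 A w * (- A * J (Suc 0) (A + 1) w))
        / (J 0 A w * J 0 A w)) (at w)"
    by (intro DERIV_divide J_derivative[OF w]) auto
  then show ?thesis
    unfolding r_def[abs_def] r'_def by (simp add: numeral_2_eq_2 algebra_simps)
qed

section \<open>Bounds and monotonicity of the shrinkage function on the half-line\<close>

lemma nonneg_gt: "0 \<le> w \<Longrightarrow> -\<gamma>/2 < w"
  using \<gamma>_pos by simp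

lemma r_nonneg: "0 \<le> r w"
  unfolding r_def using J_nonneg by simp

lemma r_le_1:
  assumes "0 \<le> w"
  shows "r w \<le> 1"
  using J_Suc_le[OF nonneg_gt[OF assms], of A 0] J_pos[OF nonneg_gt[OF assms], of A 0] A_gt_1
  by (simp add: r_def)

text \<open>After multiplication by \<open>w\<close>, both products in the numerator of
  \<open>r'\<close> lie between 0 and \<open>J 1 A w * J 0 A w\<close>, which therefore bounds their
  difference. A bound by \<open>r\<close>, not merely by a constant, is what controls
  \<open>w * h' w\<close> later.\<close>

lemma w_r'_bound:
  assumes w: "0 \<le> w"
  shows "\<bar>w * r' w\<bar> \<le> A * r w"
proof -
  have p: "0 < J 0 A w" using J_pos[OF nonneg_gt[OF w], of A 0] A_gt_1 by simp
  have 1: "w * J 1 (A + 1) w \<le> J 0 A w" and 2: "w * J 2 (A + 1) w \<le> J 1 A w"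
    using w_J_Suc_le[OF w, of A 0] w_J_Suc_le[OF w, of A 1] A_gt_1 by (simp_all add: numeral_2_eq_2)
  have nn: "0 \<le> w * J 1 (A + 1) w" "0 \<le> w * J 2 (A + 1) w" using w J_nonneg by auto
  have a: "J 1 A w * (w * J 1 (A + 1) w) \<le> J 1 A w * J 0 A w"
    using 1 J_nonneg by (intro mult_left_mono)
  have c: "(w * J 2 (A + 1) w) * J 0 A w \<le> J 1 A w * J 0 A w"
    using 2 J_nonneg by (intro mult_right_mono)
  have "0 \<le> J 1 A w * (w * J 1 (A + 1) w)" "0 \<le> (w * J 2 (A + 1) w) * J 0 A w"
    using nn J_nonneg by auto
  with a c have "\<bar>J 1 A w * (w * J 1 (A + 1) w) - (w * J 2 (A + 1) w) * J 0 A w\<bar> \<le> J 1 A w * J 0 A w"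
    by linarith
  then have "A * \<bar>J 1 A w * (w * J 1 (A + 1) w) - (w * J 2 (A + 1) w) * J 0 A w\<bar> / (J 0 A w)\<^sup>2
      \<le> A * (J 1 A w * J 0 A w) / (J 0 A w)\<^sup>2"
    using A_gt_1 by (intro divide_right_mono mult_left_mono) auto
  moreover have "\<bar>w * r' w\<bar> = A * \<bar>J 1 A w * (w * J 1 (A + 1) w) - (w * J 2 (A + 1) w) * J 0 A w\<bar> / (J 0 A w)\<^sup>2"
  proof -
    have "w * r' w = A * (J 1 A w * (w * J 1 (A + 1) w) - (w * J 2 (A + 1) w) * J 0 A w) / (J 0 A w)\<^sup>2"
      by (simp add: r'_def algebra_simps)
    then show ?thesis using A_gt_1 by (simp add: abs_mult)
  qed
  ultimately show ?thesis
    using p by (simp add: r_def power2_eq_square)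
qed

text \<open>Comparing the mean \<open>r w\<close> with a number \<open>m\<close> becomes a question
  about the sign of a centred integral. The following bounds all take this route, each with its own
  \<open>m\<close>.\<close>

lemma integral_diff_kernel:
  assumes w: "0 \<le> w"
  shows "integrable lborel (\<lambda>l. (l - m) * (wt l * (1 + w * l) powr (- A)))"
    and "(\<integral>l. (l - m) * (wt l * (1 + w * l) powr (- A)) \<partial>lborel) = (r w - m) * J 0 A w"
proof -
  have A0: "0 \<le> A" using A_gt_1 by simp
  note i = integrable_kernel[OF nonneg_gt[OF w] A0]
  have e: "(l - m) * (wt l * (1 + w * l) powr (- A))
      = wt l * l ^ 1 * (1 + w * l) powr (- A) - m * (wt l * l ^ 0 * (1 + w * l) powr (- A))" for l
    by (simp add: algebra_simps)
  show "integrable lborel (\<lambda>l. (l - m) * (wt l * (1 + w * l) powr (- A)))"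
    unfolding e by (intro Bochner_Integration.integrable_diff integrable_mult_right i)
  have "(\<integral>l. (l - m) * (wt l * (1 + w * l) powr (- A)) \<partial>lborel) = J 1 A w - m * J 0 A w"
    unfolding e J_def by (subst Bochner_Integration.integral_diff[OF i integrable_mult_right[OF i]]) simp
  moreover have "J 1 A w = r w * J 0 A w"
    using J_pos[OF nonneg_gt[OF w] A0, of 0] by (simp add: r_def)
  ultimately show "(\<integral>l. (l - m) * (wt l * (1 + w * l) powr (- A)) \<partial>lborel) = (r w - m) * J 0 A w"
    by (simp only: left_diff_distrib)
qed


text \<open>The weight \<open>(1 - \<gamma>l)\<^sup>b\<close> decreases, so against it the sign change of \<open>l - m/w\<close> can only lower the
  integral; without it the integrand is, up to a negative factor, the derivative of \<open>F\<close> below.\<close>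

lemma mult_r_le:
  assumes w: "0 \<le> w"
  shows "w * r w \<le> (\<alpha> + 1) / (A - \<alpha> - 2)"
proof -
  define m where "m = (\<alpha> + 1) / (A - \<alpha> - 2)"
  have m: "0 < m" and m_eq: "\<alpha> + 1 = m * (A - \<alpha> - 2)"
    using \<alpha> A by (auto simp: m_def)
  have "w * r w \<le> m"
  proof (cases "w = 0")
    case False
    with w have w0: "0 < w" by simp
    define h where "h l = (1 - \<gamma> * l) powr b" for l
    \<comment> \<open>The value of the decreasing weight \<open>h\<close> at the sign change
      \<open>m / w\<close>, or 0 if the sign change is not inside the support.\<close>
    define c where "c = (if m / w < 1 / \<gamma> then h (m / w) else 0)"
    have c: "0 \<le> c" by (simp add: c_def h_def)
    define k where "k l = l powr \<alpha> * (1 + w * l) powr (- A)" for l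
    \<comment> \<open>Its derivative has the sign of \<open>m - w * l\<close>: the identity
      \<open>\<alpha> + 1 = m * (A - \<alpha> - 2)\<close> puts the critical point exactly at
      \<open>m / w\<close>, which is where the bound \<open>m\<close> comes from.\<close>
    define F where "F l = l powr (\<alpha> + 1) * (1 + w * l) powr (1 - A)" for l
    have sub: "l - m / w \<le> 0" if "w * l \<le> m" for l
      using that w0 by (simp add: field_simps)
    have cross: "(l - m / w) * (wt l * (1 + w * l) powr (- A))
        \<le> c * (indicator {0..1 / \<gamma>} l *\<^sub>R ((l - m / w) * k l))" for l
    proof (cases "0 < l \<and> l < 1 / \<gamma>")
      case True
      have le: "(l - m / w) * h l \<le> (l - m / w) * c"
      proof (cases "l \<le> m / w")
        case True
        have "h (m / w) \<le> h l" if "m / w < 1 / \<gamma>"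
          unfolding h_def
        proof (rule powr_mono2[OF b])
          have "0 < m / w" using m w0 by simp
          from supportD(2)[OF this that] show "0 \<le> 1 - \<gamma> * (m / w)" by simp
          show "1 - \<gamma> * (m / w) \<le> 1 - \<gamma> * l"
            using mult_left_mono[OF True, of \<gamma>] \<gamma>_pos by simp
        qed
        then have "c \<le> h l"
          by (simp add: c_def) (simp add: h_def)
        with True show ?thesis by (intro mult_left_mono_neg) auto
      next
        case False
        then have "m / w < 1 / \<gamma>" using True by simp
        then have "\<gamma> * (m / w) \<le> \<gamma> * l"
          using False \<gamma>_pos by (intro mult_left_mono) auto
        with \<open>m / w < 1 / \<gamma>\<close> have "h l \<le> c"
          unfolding c_def h_def using supportD(2)[of l] True b by (auto intro!: powr_mono2)
        with False show ?thesis by (intro mult_left_mono) auto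
      qed
      have "0 \<le> k l" by (simp add: k_def)
      from mult_right_mono[OF le this] show ?thesis
        using True by (simp add: wt_def h_def k_def mult_ac)
    next
      case False
      show ?thesis
      proof (cases "l = 1 / \<gamma>")
        case True
        \<comment> \<open>At the right endpoint \<open>wt\<close> vanishes but the closed indicator
          does not; the right side is still nonnegative, since \<open>c\<close> is 0 unless
          \<open>m / w\<close> lies below the endpoint.\<close>
        have "0 \<le> c * (l - m / w)"
          using c True by (cases "m / w < 1 / \<gamma>") (auto simp: c_def)
        then have "0 \<le> (c * (l - m / w)) * k l" by (simp add: k_def)
        then show ?thesis using False wt_eq_0[OF False] by (auto simp: indicator_def mult_ac)
      next
        case False': False
        have "indicator {0..1 / \<gamma>} l *\<^sub>R ((l - m / w) * k l) = 0"
          using False False' by (auto simp: indicator_def k_def)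
        then show ?thesis by (simp only: wt_eq_0[OF False])
      qed
    qed
    have F_der: "(F has_real_derivative - (w * (A - \<alpha> - 2) * ((l - m / w) * k l))) (at l)"
      if "0 < l" for l
    proof -
      have p: "0 < 1 + w * l" using that w0 by (simp add: add_pos_pos)
      have "(F has_real_derivative (\<alpha> + 1) * l powr \<alpha> * (1 + w * l) powr (1 - A)
          + l powr (\<alpha> + 1) * ((1 - A) * (1 + w * l) powr (- A) * w)) (at l)"
        unfolding F_def[abs_def] using that p by (auto intro!: derivative_eq_intros)
      moreover have "(1 + w * l) powr (1 - A) = (1 + w * l) * (1 + w * l) powr (- A)"
        using p powr_add[of "1 + w * l" 1 "- A"] by simp
      moreover have "l powr (\<alpha> + 1) = l * l powr \<alpha>"
        using that powr_add[of l 1 \<alpha>] by (simp add: add.commute)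
      moreover have "(\<alpha> + 1) * l powr \<alpha> * ((1 + w * l) * X) + (l * l powr \<alpha>) * ((1 - A) * X * w)
          = - (w * (A - \<alpha> - 2) * ((l - m / w) * (l powr \<alpha> * X)))" for X
      proof -
        have br: "(\<alpha> + 1) * (1 + w * l) + l * ((1 - A) * w) = - ((A - \<alpha> - 2) * (w * l - m))"
          using m_eq by (simp add: algebra_simps)
        have "(\<alpha> + 1) * l powr \<alpha> * ((1 + w * l) * X) + (l * l powr \<alpha>) * ((1 - A) * X * w)
            = ((\<alpha> + 1) * (1 + w * l) + l * ((1 - A) * w)) * (l powr \<alpha> * X)"
          by (simp add: algebra_simps)
        also have "\<dots> = - ((A - \<alpha> - 2) * (w * (l - m / w)) * (l powr \<alpha> * X))"
        proof -
          have "w * (l - m / w) = w * l - m" using w0 by (simp add: right_diff_distrib)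
          then show ?thesis unfolding br by simp
        qed
        finally show ?thesis by (simp only: mult_ac)
      qed
      ultimately show ?thesis by (simp add: k_def)
    qed
    have F_cont: "continuous_on {0..1 / \<gamma>} F"
    proof -
      have "1 + w * l \<noteq> 0" if "0 \<le> l" for l
        using mult_nonneg_nonneg[OF w that] by linarith
      then have "continuous_on {0..1 / \<gamma>} (\<lambda>l. (1 + w * l) powr (1 - A))"
        by (intro continuous_on_powr continuous_intros) auto
      moreover have "continuous_on {0..1 / \<gamma>} (\<lambda>l. l powr (\<alpha> + 1))"
        using \<alpha> by (intro continuous_on_powr' continuous_intros) auto
      ultimately show ?thesis
        unfolding F_def[abs_def] by (intro continuous_on_mult)
    qed
    \<comment> \<open>\<open>F\<close> need not be differentiable at 0, but
      \<open>\<alpha> + 1 > 0\<close> makes it continuous there. As \<open>F\<close> vanishes at 0,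
      only its nonnegative value at \<open>1 / \<gamma>\<close> survives.\<close>
    have HK: "((\<lambda>l. - (w * (A - \<alpha> - 2) * ((l - m / w) * k l))) has_integral F (1 / \<gamma>) - F 0) {0..1 / \<gamma>}"
      by (rule fundamental_theorem_of_calculus_interior)
        (use \<gamma>_pos F_cont F_der in \<open>auto simp: has_real_derivative_iff_has_vector_derivative[symmetric]\<close>)
    have F0: "F 0 = 0" "0 \<le> F (1 / \<gamma>)" by (simp_all add: F_def)
    have D: "0 < w * (A - \<alpha> - 2)" using w0 A by simp
    have HK': "((\<lambda>l. (l - m / w) * k l) has_integral - F (1 / \<gamma>) / (w * (A - \<alpha> - 2))) {0..1 / \<gamma>}"
    proof -
      have "w \<noteq> 0" "A - \<alpha> - 2 \<noteq> 0" using D by auto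
      then show ?thesis
        using has_integral_mult_right[OF HK, of "- 1 / (w * (A - \<alpha> - 2))"] F0 by simp
    qed
    have si: "set_integrable lborel {0..1 / \<gamma>} (\<lambda>l. (l - m / w) * k l)"
      unfolding set_integrable_def
    proof (rule Bochner_Integration.integrable_bound)
      show "integrable lborel (\<lambda>t. (1 + m / w) * (indicator {0..1} t *\<^sub>R (t powr (\<alpha> + 1 - 1) * (1 - t) powr (1 - 1))))"
        using integrable_Beta[of "\<alpha> + 1" 1] \<alpha> by (simp add: set_integrable_def)
      show "AE l in lborel. norm (indicator {0..1 / \<gamma>} l *\<^sub>R ((l - m / w) * k l))
        \<le> norm ((1 + m / w) * (indicator {0..1} l *\<^sub>R (l powr (\<alpha> + 1 - 1) * (1 - l) powr (1 - 1))))"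
        \<comment> \<open>The point 1 is removed because \<open>0 powr 0\<close> is 0, so the Beta
          integrand vanishes at 1, while \<open>k 1\<close> is positive. This matters when
          \<open>\<gamma>\<close> is 1.\<close>
        using AE_lborel_singleton[of 1]
      proof eventually_elim
        case (elim l)
        show ?case
        proof (cases "0 \<le> l \<and> l \<le> 1 / \<gamma>")
          case True
          have "1 / \<gamma> \<le> 1" using \<gamma> by simp
          with True have l1: "l \<le> 1" by linarith
          have mw: "0 < m / w" using m w0 by simp
          have "\<bar>l - m / w\<bar> \<le> 1 + m / w" using l1 True mw by linarith
          moreover have "(1 + w * l) powr (- A) \<le> 1 powr (- A)"
            using True w0 A_gt_1 by (intro powr_mono2') auto
          then have "k l \<le> l powr \<alpha>" by (simp add: k_def mult_left_le)
          ultimately have "\<bar>l - m / w\<bar> * k l \<le> (1 + m / w) * l powr \<alpha>"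
            by (intro mult_mono) (auto simp: k_def)
          moreover have "0 \<le> k l" by (simp add: k_def)
          ultimately show ?thesis using True l1 elim mw by (simp add: abs_mult)
        qed auto
      qed
      show "(\<lambda>l. indicator {0..1 / \<gamma>} l *\<^sub>R ((l - m / w) * k l)) \<in> borel_measurable lborel"
        unfolding k_def by measurable
    qed
    have "(r w - m / w) * J 0 A w = (\<integral>l. (l - m / w) * (wt l * (1 + w * l) powr (- A)) \<partial>lborel)"
      using integral_diff_kernel(2)[OF w] by simp
    also have "\<dots> \<le> (\<integral>l. c * (indicator {0..1 / \<gamma>} l *\<^sub>R ((l - m / w) * k l)) \<partial>lborel)"
      by (rule integral_mono[OF integral_diff_kernel(1)[OF w] integrable_mult_right cross])
        (use si in \<open>simp add: set_integrable_def\<close>)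
    also have "\<dots> = c * (- F (1 / \<gamma>) / (w * (A - \<alpha> - 2)))"
      using set_borel_integral_eq_integral(2)[OF si] integral_unique[OF HK']
      by (simp add: set_lebesgue_integral_def)
    also have "\<dots> \<le> 0"
      using c F0 D by (intro mult_nonneg_nonpos) auto
    finally have "(r w - m / w) * J 0 A w \<le> 0" .
    moreover have "0 < J 0 A w" using J_pos[OF nonneg_gt[OF w], of A 0] A_gt_1 by simp
    ultimately have "r w \<le> m / w" by (simp add: mult_le_0_iff)
    then show ?thesis using w0 by (simp add: field_simps)
  qed (use m in simp)
  then show ?thesis by (simp add: m_def)
qed

text \<open>The mean of \<open>l\<close> lies strictly to the left of the right end of the support.
  Strictness puts \<open>r w1\<close> where the ratio \<open>\<rho>\<close> below has a positive
  denominator.\<close>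

lemma r_less: 
  assumes w: "0 \<le> w"
  shows "r w < 1 / \<gamma>"
proof -
  have "0 < (\<integral>l. - ((l - 1 / \<gamma>) * (wt l * (1 + w * l) powr (- A))) \<partial>lborel)"
  proof (rule integral_support_pos)
    show "integrable lborel (\<lambda>l. - ((l - 1 / \<gamma>) * (wt l * (1 + w * l) powr - A)))"
      using integral_diff_kernel(1)[OF w, of "1 / \<gamma>"] by simp
    fix l
    show "0 \<le> - ((l - 1 / \<gamma>) * (wt l * (1 + w * l) powr - A))"
      by (cases "0 < l \<and> l < 1 / \<gamma>") (auto simp: wt_eq_0 mult_nonpos_nonneg)
    assume l: "0 < l" "l < 1 / \<gamma>"
    then have "0 < 1 + w * l" using w by (simp add: add_pos_nonneg)
    then show "0 < - ((l - 1 / \<gamma>) * (wt l * (1 + w * l) powr - A))"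
      using l wt_pos[OF l] by (simp add: mult_neg_pos)
  qed
  then have "(r w - 1 / \<gamma>) * J 0 A w < 0"
    using integral_diff_kernel(2)[OF w, of "1 / \<gamma>"] by simp
  then show ?thesis
    using J_nonneg[of 0 A w] by (simp add: mult_less_0_iff)
qed

text \<open>After substituting \<open>l/s\<close> for \<open>l\<close> in the integrals at \<open>w2 = s w1\<close>, both sides carry the same
  kernel, and the ratio \<open>\<rho>\<close> of their weights increases.\<close>

lemma mult_r_mono:
  assumes w1: "0 < w1" and w12: "w1 \<le> w2"
  shows "w1 * r w1 \<le> w2 * r w2"
proof -
  define s where "s = w2 / w1"
  have s: "1 \<le> s" and w2: "w2 = s * w1" using w1 w12 by (auto simp: s_def)
  have s0: "0 < s" using s by simp
  \<comment> \<open>With this centre the integral at \<open>w1\<close> is 0, so the pointwise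
    comparison \<open>cross\<close> decides the sign at \<open>w2\<close>.\<close>
  define m where "m = r w1"
  have m: "0 \<le> m" "m < 1 / \<gamma>" using r_nonneg r_less w1 by (auto simp: m_def)
  have mg: "\<gamma> * m < 1" using m \<gamma>_pos by (simp add: field_simps)
  \<comment> \<open>On the support this is \<open>s powr \<alpha> * wt (l / s) / wt l\<close>; the
    powers of \<open>l\<close> cancel.\<close>
  define \<rho> where "\<rho> l = ((1 - \<gamma> * (l / s)) / (1 - \<gamma> * l)) powr b" for l
  have \<rho>_mono: "\<rho> l \<le> \<rho> l'" if l: "0 \<le> l" "l \<le> l'" "\<gamma> * l' < 1" for l l'
  proof -
    have gl: "\<gamma> * l \<le> \<gamma> * l'" using l \<gamma>_pos by simp
    have sl: "\<gamma> * l / s \<le> \<gamma> * l" using l \<gamma>_pos s mult_left_mono[of 1 s "\<gamma> * l"] by (simp add: divide_le_eq)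
    have "(1 - \<gamma> * (l / s)) * (1 - \<gamma> * l') \<le> (1 - \<gamma> * (l' / s)) * (1 - \<gamma> * l)"
    proof -
      have "(1 - \<gamma> * (l' / s)) * (1 - \<gamma> * l) - (1 - \<gamma> * (l / s)) * (1 - \<gamma> * l')
        = \<gamma> * (l' - l) * (1 - 1 / s)"
        using s0 by (simp add: field_simps)
      also have "\<dots> \<ge> 0" using l \<gamma>_pos s by (intro mult_nonneg_nonneg) auto
      finally show ?thesis by simp
    qed
    then have "(1 - \<gamma> * (l / s)) / (1 - \<gamma> * l) \<le> (1 - \<gamma> * (l' / s)) / (1 - \<gamma> * l')"
      using gl l by (simp add: divide_le_eq frac_le pos_le_divide_eq field_simps)
    moreover have "0 \<le> (1 - \<gamma> * (l / s)) / (1 - \<gamma> * l)"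
      using gl sl l by simp
    ultimately show ?thesis
      unfolding \<rho>_def using b by (intro powr_mono2)
  qed
  have cross: "\<rho> m * ((l - m) * (wt l * (1 + w1 * l) powr (- A)))
      \<le> s powr \<alpha> * ((l - m) * (wt (l / s) * (1 + w1 * l) powr (- A)))" for l
  proof (cases "0 < l \<and> l < 1 / \<gamma>")
    case True
    then have gl: "\<gamma> * l < 1" using supportD by simp
    have ls: "0 < l / s" "l / s \<le> l" using True s by (auto simp: divide_le_eq)
    then have ls': "l / s < 1 / \<gamma>" using True by linarith
    have "s powr \<alpha> * wt (l / s) = l powr \<alpha> * (1 - \<gamma> * (l / s)) powr b"
      using ls ls' s0 True by (simp add: wt_def powr_divide)
    also have "\<dots> = \<rho> l * wt l"
    proof -
      have "\<gamma> * (l / s) \<le> \<gamma> * l" using ls \<gamma>_pos by (intro mult_left_mono) auto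
      then have "(1 - \<gamma> * (l / s)) powr b = \<rho> l * (1 - \<gamma> * l) powr b"
        unfolding \<rho>_def using gl by (simp flip: powr_mult)
      then show ?thesis using True by (simp add: wt_def)
    qed
    finally have e: "s powr \<alpha> * wt (l / s) = \<rho> l * wt l" .
    have "\<rho> m * (l - m) \<le> \<rho> l * (l - m)"
    proof (cases "l \<le> m")
      case True
      then have "\<rho> l \<le> \<rho> m" using \<open>0 < l \<and> l < 1 / \<gamma>\<close> mg by (intro \<rho>_mono) auto
      with True show ?thesis by (intro mult_right_mono_neg) auto
    next
      case False
      then have "\<rho> m \<le> \<rho> l" using m gl by (intro \<rho>_mono) auto
      with False show ?thesis by (intro mult_right_mono) auto
    qed
    then have "\<rho> m * (l - m) * (wt l * (1 + w1 * l) powr (- A))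
        \<le> \<rho> l * (l - m) * (wt l * (1 + w1 * l) powr (- A))"
      by (rule mult_right_mono) auto
    also have "\<dots> = (s powr \<alpha> * wt (l / s)) * ((l - m) * (1 + w1 * l) powr (- A))"
      by (simp add: e)
    finally show ?thesis by (simp add: mult_ac)
  next
    case False
    show ?thesis
    proof (cases "l \<le> 0")
      case True
      then have "l / s \<le> 0" using s0 by (simp add: divide_le_0_iff)
      then show ?thesis using wt_eq_0[of l] wt_eq_0[of "l / s"] True by simp
    next
      \<comment> \<open>Here \<open>l \<ge> 1 / \<gamma>\<close>: only the rescaled weight can be
        nonzero, and to the right of \<open>m\<close> it contributes with the favourable
        sign.\<close>
      case False': False
      then have "m < l" using m False by simp
      then show ?thesis using wt_eq_0[OF False] by simp
    qed
  qed
  have eq2: "s * (r w2 - m / s) * J 0 A w2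
      = (1 / s) * (\<integral>l. (l - m) * (wt (l / s) * (1 + w1 * l) powr (- A)) \<partial>lborel)"
    and int2: "integrable lborel (\<lambda>l. (l - m) * (wt (l / s) * (1 + w1 * l) powr (- A)))"
  proof -
    have w20: "0 \<le> w2" using w1 w12 by simp
    have e: "(l / s - m / s) * (wt (l / s) * (1 + w2 * (l / s)) powr (- A))
        = (1 / s) * ((l - m) * (wt (l / s) * (1 + w1 * l) powr (- A)))" for l
      using s0 by (simp add: w2 field_simps)
    have i: "integrable lborel (\<lambda>l. (l - m / s) * (wt l * (1 + w2 * l) powr (- A)))"
      by (rule integral_diff_kernel(1)[OF w20])
    from lborel_integrable_real_affine[OF i, of "1 / s" 0]
    have "integrable lborel (\<lambda>l. (l / s - m / s) * (wt (l / s) * (1 + w2 * (l / s)) powr (- A)))"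
      using s0 by simp
    then have "integrable lborel (\<lambda>l. s * ((1 / s) * ((l - m) * (wt (l / s) * (1 + w1 * l) powr (- A)))))"
      unfolding e by (rule integrable_mult_right)
    moreover have "s * ((1 / s) * X) = X" for X using s0 by simp
    ultimately show "integrable lborel (\<lambda>l. (l - m) * (wt (l / s) * (1 + w1 * l) powr (- A)))"
      by (simp only:)
    have "(r w2 - m / s) * J 0 A w2 = (\<integral>l. (l - m / s) * (wt l * (1 + w2 * l) powr (- A)) \<partial>lborel)"
      using integral_diff_kernel(2)[OF w20] by simp
    also have "\<dots> = (1 / s) * (\<integral>l. (1 / s) * ((l - m) * (wt (l / s) * (1 + w1 * l) powr (- A))) \<partial>lborel)"
      using s0 e by (subst lborel_integral_real_affine[where c="1 / s" and t=0]) simp_all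
    finally show "s * (r w2 - m / s) * J 0 A w2
      = (1 / s) * (\<integral>l. (l - m) * (wt (l / s) * (1 + w1 * l) powr (- A)) \<partial>lborel)"
      using s0 by (simp add: mult.assoc)
  qed
  have "0 = \<rho> m * (\<integral>l. (l - m) * (wt l * (1 + w1 * l) powr (- A)) \<partial>lborel)"
    using integral_diff_kernel(2)[of w1 m] w1 by (simp add: m_def)
  also have "\<dots> = (\<integral>l. \<rho> m * ((l - m) * (wt l * (1 + w1 * l) powr (- A))) \<partial>lborel)"
    by simp
  also have "\<dots> \<le> (\<integral>l. s powr \<alpha> * ((l - m) * (wt (l / s) * (1 + w1 * l) powr (- A))) \<partial>lborel)"
    using w1 by (intro integral_mono cross integrable_mult_right int2 integral_diff_kernel(1)) auto
  also have "\<dots> = s powr \<alpha> * (\<integral>l. (l - m) * (wt (l / s) * (1 + w1 * l) powr (- A)) \<partial>lborel)"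
    by simp
  also have "\<dots> = s powr \<alpha> * (s * (s * (r w2 - m / s) * J 0 A w2))"
    unfolding eq2 using s0 by simp
  finally have "0 \<le> (s powr \<alpha> * s * s) * J 0 A w2 * (r w2 - m / s)"
    by (simp add: mult_ac)
  moreover have "0 < J 0 A w2" using J_pos[OF nonneg_gt, of w2 A 0] A_gt_1 w1 w12 by simp
  moreover have "0 < s powr \<alpha> * s * s" using s0 by simp
  ultimately have "m / s \<le> r w2"
    by (metis diff_ge_0_iff_ge mult_pos_pos zero_le_mult_iff not_less)
  then have "m \<le> s * r w2" using s0 by (simp add: field_simps)
  then have "w1 * m \<le> w1 * (s * r w2)" using w1 by (intro mult_left_mono) auto
  then show ?thesis by (simp add: m_def w2 mult_ac)
qed

lemma mult_r_derivative_nonneg: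
  assumes w: "0 \<le> w"
  shows "0 \<le> r w + w * r' w"
proof (cases "w = 0")
  case False
  with w have w0: "0 < w" by simp
  have "mono_on {0<..} (\<lambda>w. w * r w)"
    using mult_r_mono by (auto simp: mono_on_def)
  moreover have "((\<lambda>w. w * r w) has_real_derivative r w + w * r' w) (at w)"
    using DERIV_mult[OF DERIV_ident r_derivative[OF nonneg_gt[OF w]]] by (simp add: add.commute mult.commute)
  ultimately show ?thesis
    by (rule mono_on_imp_deriv_nonneg) (use w0 in \<open>simp add: interior_open\<close>)
qed (use r_nonneg in simp)

end

section \<open>Lower bound for the maximal risk\<close>

lemma data_density_eq:
  "data_density d \<theta> s2 y = diag_normal_density \<theta> (\<chi> i. s2 * d $ i) (fst y)
    * diag_normal_density 0 (\<chi> k. s2) (snd y)"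
  by (simp add: data_density_def split_beta)

lemma data_density_nonneg [simp]: "0 \<le> data_density d \<theta> s2 y"
  by (simp add: data_density_eq)

lemma borel_measurable_data_density [measurable (raw)]:
  fixes \<theta> :: "'a \<Rightarrow> real^'p" and y :: "'a \<Rightarrow> (real^'p) \<times> (real^'n)"
  assumes [measurable]: "\<theta> \<in> borel_measurable M" "s2 \<in> borel_measurable M"
    "(\<lambda>w. fst (y w)) \<in> borel_measurable M" "(\<lambda>w. snd (y w)) \<in> borel_measurable M"
  shows "(\<lambda>w. data_density d (\<theta> w) (s2 w) (y w)) \<in> borel_measurable M"
  unfolding data_density_eq by measurable

lemma borel_measurable_fst_snd [measurable]:
  "(fst :: 'a::second_countable_topology \<times> 'b::second_countable_topology \<Rightarrow> 'a) \<in> borel_measurable borel"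
  "(snd :: 'a \<times> 'b \<Rightarrow> 'b) \<in> borel_measurable borel"
  by (auto simp: borel_prod[symmetric])

lemma borel_measurable_data_density' [measurable]:
  "data_density d \<theta> s2 \<in> borel_measurable borel"
  unfolding data_density_eq[abs_def]
  by measurable

lemma borel_measurable_loss [measurable (raw)]:
  fixes \<delta> \<theta> :: "'a \<Rightarrow> real^'p"
  assumes [measurable]: "\<delta> \<in> borel_measurable M" "\<theta> \<in> borel_measurable M"
  shows "(\<lambda>w. loss j d (\<delta> w) (\<theta> w) s2) \<in> borel_measurable M"
  unfolding loss_def by measurable

lemma nn_integral_lborel_times:
  fixes f :: "'a::euclidean_space \<Rightarrow> ennreal" and g :: "'b::euclidean_space \<Rightarrow> ennreal"
  assumes [measurable]: "f \<in> borel_measurable borel" "g \<in> borel_measurable borel"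
  shows "(\<integral>\<^sup>+y. f (fst y) * g (snd y) \<partial>lborel) = (\<integral>\<^sup>+x. f x \<partial>lborel) * (\<integral>\<^sup>+z. g z \<partial>lborel)"
proof -
  have "(\<integral>\<^sup>+y. f (fst y) * g (snd y) \<partial>lborel)
      = (\<integral>\<^sup>+x. \<integral>\<^sup>+z. f (fst (x, z)) * g (snd (x, z)) \<partial>lborel \<partial>lborel)"
    unfolding lborel_prod[symmetric]
    by (rule lborel.nn_integral_fst[symmetric]) measurable
  also have "\<dots> = (\<integral>\<^sup>+x. f x \<partial>lborel) * (\<integral>\<^sup>+z. g z \<partial>lborel)"
    by (simp add: nn_integral_cmult nn_integral_multc)
  finally show ?thesis .
qed

lemma nn_integral_data_density_fst:
  fixes d :: "real^'p"
  assumes [measurable]: "f \<in> borel_measurable borel" and "0 < s2"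
  shows "(\<integral>\<^sup>+y. f (fst y) * ennreal (data_density d \<theta> s2 (y :: _ \<times> (real^'n))) \<partial>lborel)
    = (\<integral>\<^sup>+x. f x * ennreal (diag_normal_density \<theta> (\<chi> i. s2 * d $ i) x) \<partial>lborel)"
proof -
  have "(\<integral>\<^sup>+y. f (fst y) * ennreal (data_density d \<theta> s2 (y :: _ \<times> (real^'n))) \<partial>lborel)
    = (\<integral>\<^sup>+y. (f (fst y) * ennreal (diag_normal_density \<theta> (\<chi> i. s2 * d $ i) (fst y)))
        * ennreal (diag_normal_density 0 (\<chi> k. s2) (snd (y :: _ \<times> (real^'n)))) \<partial>lborel)"
    by (simp add: data_density_eq ennreal_mult mult.assoc)
  also have "\<dots> = (\<integral>\<^sup>+x. f x * ennreal (diag_normal_density \<theta> (\<chi> i. s2 * d $ i) x) \<partial>lborel)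
      * (\<integral>\<^sup>+z. ennreal (diag_normal_density 0 (\<chi> k. s2) (z :: real^'n)) \<partial>lborel)"
    by (rule nn_integral_lborel_times) measurable
  finally show ?thesis
    using assms by (simp add: nn_integral_diag_normal)
qed

lemma nn_integral_data_density_snd:
  fixes d :: "real^'p"
  assumes [measurable]: "f \<in> borel_measurable borel" and "0 < s2" and "\<And>i. 0 < d $ i"
  shows "(\<integral>\<^sup>+y. f (snd y) * ennreal (data_density d \<theta> s2 (y :: _ \<times> (real^'n))) \<partial>lborel)
    = (\<integral>\<^sup>+z. f z * ennreal (diag_normal_density 0 (\<chi> k. s2) z) \<partial>lborel)"
proof -
  have "(\<integral>\<^sup>+y. f (snd y) * ennreal (data_density d \<theta> s2 (y :: _ \<times> (real^'n))) \<partial>lborel)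
    = (\<integral>\<^sup>+y. ennreal (diag_normal_density \<theta> (\<chi> i. s2 * d $ i) (fst y))
        * (f (snd y) * ennreal (diag_normal_density 0 (\<chi> k. s2) (snd (y :: _ \<times> (real^'n))))) \<partial>lborel)"
    by (simp add: data_density_eq ennreal_mult mult_ac)
  also have "\<dots> = (\<integral>\<^sup>+x. ennreal (diag_normal_density \<theta> (\<chi> i. s2 * d $ i) x) \<partial>lborel)
      * (\<integral>\<^sup>+z. f z * ennreal (diag_normal_density 0 (\<chi> k. s2) (z :: real^'n)) \<partial>lborel)"
    by (rule nn_integral_lborel_times) measurable
  finally show ?thesis
    using assms by (simp add: nn_integral_diag_normal)
qed

lemma risk_eq:
  fixes d :: "real^'p" and \<delta> :: "(real^'p) \<times> (real^'n) \<Rightarrow> real^'p"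
  assumes [measurable]: "\<delta> \<in> borel_measurable borel"
  shows "risk j d \<delta> \<theta> s2
    = (\<integral>\<^sup>+y. ennreal (loss j d (\<delta> y) \<theta> s2) * ennreal (data_density d \<theta> s2 y) \<partial>lborel)"
  unfolding risk_def data_distr_def
  by (subst nn_integral_density) (auto simp: mult.commute)

text \<open>Posterior expected loss is variance plus squared bias. Dropping the bias gives a bound
  free of the action \<open>a\<close> and of the mean \<open>m\<close>, hence valid for every
  estimator and every observation.\<close>

lemma nn_integral_loss_diag_normal:
  fixes d m v :: "real^'p"
  assumes v: "\<And>i. 0 < v $ i" and s2: "0 < s2"
  shows "ennreal (\<Sum>i\<in>UNIV. d $ i powr (- j) * v $ i / s2)
    \<le> (\<integral>\<^sup>+\<theta>. ennreal (loss j d a \<theta> s2) * ennreal (diag_normal_density m v \<theta>) \<partial>lborel)"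
proof -
  have "ennreal (\<Sum>i\<in>UNIV. d $ i powr (- j) * v $ i / s2)
      \<le> (\<Sum>i\<in>UNIV. ennreal (d $ i powr (- j) / s2) * ennreal (v $ i + (m $ i - a $ i)\<^sup>2))"
  proof -
    have nn: "0 \<le> v $ i" "0 \<le> v $ i + (m $ i - a $ i)\<^sup>2" for i
      using v[of i] by simp_all
    have "(\<Sum>i\<in>UNIV. ennreal (d $ i powr (- j) / s2) * ennreal (v $ i + (m $ i - a $ i)\<^sup>2))
        = (\<Sum>i\<in>UNIV. ennreal (d $ i powr (- j) / s2 * (v $ i + (m $ i - a $ i)\<^sup>2)))"
      by (rule sum.cong[OF refl], rule ennreal_mult[symmetric]) (use nn s2 in auto)
    also have "\<dots> = ennreal (\<Sum>i\<in>UNIV. d $ i powr (- j) / s2 * (v $ i + (m $ i - a $ i)\<^sup>2))"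
      by (rule sum_ennreal) (use nn s2 in auto)
    also have "ennreal (\<Sum>i\<in>UNIV. d $ i powr (- j) * v $ i / s2) \<le> \<dots>"
      using s2 by (intro ennreal_leI sum_mono) (simp add: divide_right_mono mult_left_mono)
    finally show ?thesis .
  qed
  also have "\<dots> = (\<Sum>i\<in>UNIV. ennreal (d $ i powr (- j) / s2)
      * (\<integral>\<^sup>+\<theta>. ennreal ((\<theta> $ i - a $ i)\<^sup>2) * ennreal (diag_normal_density m v \<theta>) \<partial>lborel))"
    using v by (simp add: nn_integral_diag_normal_square)
  also have "\<dots> = (\<integral>\<^sup>+\<theta>. (\<Sum>i\<in>UNIV. ennreal (d $ i powr (- j) / s2)
      * (ennreal ((\<theta> $ i - a $ i)\<^sup>2) * ennreal (diag_normal_density m v \<theta>))) \<partial>lborel)"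
    by (simp add: nn_integral_sum nn_integral_cmult)
  also have "\<dots> = (\<integral>\<^sup>+\<theta>. ennreal (loss j d a \<theta> s2) * ennreal (diag_normal_density m v \<theta>) \<partial>lborel)"
  proof (rule nn_integral_cong)
    fix \<theta> :: "real^'p"
    have "loss j d a \<theta> s2 = (\<Sum>i\<in>UNIV. d $ i powr (- j) / s2 * (\<theta> $ i - a $ i)\<^sup>2)"
      by (simp add: loss_def sum_divide_distrib power2_commute)
    then show "(\<Sum>i\<in>UNIV. ennreal (d $ i powr (- j) / s2)
        * (ennreal ((\<theta> $ i - a $ i)\<^sup>2) * ennreal (diag_normal_density m v \<theta>)))
      = ennreal (loss j d a \<theta> s2) * ennreal (diag_normal_density m v \<theta>)"
      using s2 by (simp add: mult.assoc[symmetric] ennreal_mult''[symmetric] sum_ennreal sum_distrib_right)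
  qed
  finally show ?thesis .
qed

text \<open>The Bayes risk for the prior \<open>N(0, \<tau> D)\<close> at \<open>\<sigma>\<^sup>2 = 1\<close> is \<open>\<tau> / (1 + \<tau>)\<close> times the risk of \<open>X\<close>.\<close>

lemma Bayes_risk_le_SUP_risk:
  fixes d :: "real^'p" and \<delta> :: "(real^'p) \<times> (real^'n) \<Rightarrow> real^'p"
  assumes d: "\<And>i. 0 < d $ i" and [measurable]: "\<delta> \<in> borel_measurable borel" and \<tau>: "0 < \<tau>"
  shows "ennreal (\<tau> / (1 + \<tau>) * (\<Sum>i\<in>UNIV. d $ i powr (1 - j)))
    \<le> (SUP (\<theta>, s2) \<in> UNIV \<times> {0<..}. risk j d \<delta> \<theta> s2)"
    (is "?B \<le> ?S")
proof -
  let ?u = "\<chi> i. \<tau> * d $ i :: real^'p" and ?v = "\<chi> i. 1 * d $ i :: real^'p"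
  let ?V = "\<chi> i. ?u $ i * ?v $ i / (?u $ i + ?v $ i) :: real^'p"
  let ?m = "\<lambda>x. \<chi> i. ?u $ i / (?u $ i + ?v $ i) * x $ i :: real^'p"
  let ?z = "\<lambda>y. diag_normal_density 0 (\<chi> k. 1) (snd y :: real^'n)"
  let ?x = "\<lambda>y. diag_normal_density 0 (\<chi> i. ?u $ i + ?v $ i) (fst y :: real^'p)"
  have u: "0 < ?u $ i" and v: "0 < ?v $ i" for i using d \<tau> by auto
  have V: "0 < ?V $ i" for i using u[of i] v[of i] by simp
  have conj: "data_density d \<theta> 1 y * diag_normal_density 0 ?u \<theta>
      = ?z y * ?x y * diag_normal_density (?m (fst y)) ?V \<theta>" for \<theta> and y :: "(real^'p) \<times> (real^'n)"
    using diag_normal_density_conjugate[of ?u ?v \<theta> "fst y", OF u v] by (simp add: data_density_eq mult_ac)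
  have xz: "(\<integral>\<^sup>+y. ennreal (?x y * ?z y) \<partial>(lborel :: ((real^'p) \<times> (real^'n)) measure)) = 1"
  proof -
    have "(\<integral>\<^sup>+y. ennreal (?x y) * ennreal (?z y) \<partial>(lborel :: ((real^'p) \<times> (real^'n)) measure)) = 1 * 1"
      using u v nn_integral_lborel_times[of
          "\<lambda>x. ennreal (diag_normal_density 0 (\<chi> i. ?u $ i + ?v $ i) (x :: real^'p))"
          "\<lambda>z. ennreal (diag_normal_density 0 (\<chi> k. 1) (z :: real^'n))"]
      by (simp add: nn_integral_diag_normal add_pos_pos)
    then show ?thesis by (simp add: ennreal_mult)
  qed
  \<comment> \<open>Prior and data covariances are both multiples of D, so every posterior variance
    is the same fraction \<open>\<tau> / (1 + \<tau>)\<close> of \<open>d $ i\<close>.\<close>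
  have w: "(\<Sum>i\<in>UNIV. d $ i powr (- j) * ?V $ i / 1) = \<tau> / (1 + \<tau>) * (\<Sum>i\<in>UNIV. d $ i powr (1 - j))"
  proof -
    have "d $ i powr (- j) * ?V $ i / 1 = \<tau> / (1 + \<tau>) * d $ i powr (1 - j)" for i
    proof -
      have "d $ i powr (1 - j) = d $ i * d $ i powr (- j)"
        using d[of i] powr_add[of "d $ i" 1 "- j"] by simp
      moreover have "?V $ i = \<tau> / (1 + \<tau>) * d $ i"
      proof -
        have "\<tau> * d $ i + d $ i = (1 + \<tau>) * d $ i" by (simp add: algebra_simps)
        then show ?thesis using d[of i] \<tau> by simp
      qed
      ultimately show ?thesis by simp
    qed
    then show ?thesis by (simp only: sum_distrib_left)
  qed
  \<comment> \<open>The bound is averaged over the marginal law of the data, a probability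
    density.\<close>
  have "?B = ?B * (\<integral>\<^sup>+y. ennreal (?x y * ?z y) \<partial>(lborel :: ((real^'p) \<times> (real^'n)) measure))"
    by (simp only: xz mult_1_right)
  also have "\<dots> = (\<integral>\<^sup>+y. ?B * ennreal (?x y * ?z y) \<partial>(lborel :: ((real^'p) \<times> (real^'n)) measure))"
    by (rule nn_integral_cmult[symmetric]) measurable
  also have "\<dots> \<le> (\<integral>\<^sup>+y. (\<integral>\<^sup>+\<theta>. ennreal (loss j d (\<delta> y) \<theta> 1)
      * ennreal (diag_normal_density (?m (fst y)) ?V \<theta>) \<partial>lborel) * ennreal (?x y * ?z y) \<partial>lborel)"
    using nn_integral_loss_diag_normal[OF V zero_less_one, of d j]
    unfolding w by (intro nn_integral_mono mult_right_mono) auto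
  \<comment> \<open>Marginal times posterior is turned back into likelihood times prior; exchanging
    the integrals then exhibits the prior average of the risk, which is at most its
    supremum.\<close>
  also have "\<dots> = (\<integral>\<^sup>+y. (\<integral>\<^sup>+\<theta>. ennreal (loss j d (\<delta> y) \<theta> 1)
      * ennreal (data_density d \<theta> 1 y * diag_normal_density 0 ?u \<theta>) \<partial>lborel) \<partial>lborel)"
    unfolding conj
    by (intro nn_integral_cong, subst nn_integral_multc[symmetric])
       (simp_all add: ennreal_mult mult_ac)
  also have "\<dots> = (\<integral>\<^sup>+\<theta>. (\<integral>\<^sup>+y. ennreal (loss j d (\<delta> y) \<theta> 1)
      * ennreal (data_density d \<theta> 1 y * diag_normal_density 0 ?u \<theta>) \<partial>lborel) \<partial>lborel)"
    by (rule lborel_pair.Fubini'[symmetric]) measurable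
  also have "\<dots> = (\<integral>\<^sup>+\<theta>. risk j d \<delta> \<theta> 1 * ennreal (diag_normal_density 0 ?u \<theta>) \<partial>lborel)"
    unfolding risk_eq[OF assms(2)]
    by (intro nn_integral_cong, subst nn_integral_multc[symmetric])
       (simp_all add: ennreal_mult mult_ac)
  also have "\<dots> \<le> (\<integral>\<^sup>+\<theta>. ?S * ennreal (diag_normal_density 0 ?u \<theta>) \<partial>lborel)"
  proof (intro nn_integral_mono mult_right_mono)
    show "risk j d \<delta> \<theta> 1 \<le> ?S" for \<theta>
      by (rule SUP_upper2[of "(\<theta>, 1)"]) auto
  qed simp
  also have "\<dots> = ?S"
    using u by (simp add: nn_integral_cmult nn_integral_diag_normal)
  finally show ?thesis .
qed

lemma constant_risk_le_SUP_risk: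
  fixes d :: "real^'p" and \<delta> :: "(real^'p) \<times> (real^'n) \<Rightarrow> real^'p"
  assumes "\<And>i. 0 < d $ i" and "\<delta> \<in> borel_measurable borel"
  shows "ennreal (\<Sum>i\<in>UNIV. d $ i powr (1 - j))
    \<le> (SUP (\<theta>, s2) \<in> UNIV \<times> {0<..}. risk j d \<delta> \<theta> s2)"
proof (rule LIMSEQ_le_const2)
  let ?T = "\<Sum>i\<in>UNIV. d $ i powr (1 - j)"
  have "(\<lambda>n. (1 - inverse (real (Suc n))) * ?T) \<longlonglongrightarrow> (1 - 0) * ?T"
    by (intro tendsto_intros LIMSEQ_inverse_real_of_nat)
  then show "(\<lambda>n. ennreal ((1 - inverse (real (Suc n))) * ?T)) \<longlonglongrightarrow> ennreal ?T"
    by (intro tendsto_ennrealI) simp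
  \<comment> \<open>These are the Bayes risks for \<open>\<tau> = n\<close>; n = 0 is excluded
    because the prior needs positive variances.\<close>
  have "ennreal ((1 - inverse (real (Suc n))) * ?T) \<le> (SUP (\<theta>, s2) \<in> UNIV \<times> {0<..}. risk j d \<delta> \<theta> s2)"
    if "1 \<le> n" for n
  proof -
    have "1 - inverse (real (Suc n)) = real n / (1 + real n)"
      by (simp add: field_simps)
    then show ?thesis using Bayes_risk_le_SUP_risk[OF assms, of "real n" j] that by simp
  qed
  then show "\<exists>N. \<forall>n\<ge>N. ennreal ((1 - inverse (real (Suc n))) * ?T)
      \<le> (SUP (\<theta>, s2) \<in> UNIV \<times> {0<..}. risk j d \<delta> \<theta> s2)"
    by blast
qed

section \<open>The generalized Bayes estimator\<close>

text \<open>Isolates the dependence on a common precision factor \<open>t\<close>, which is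
  \<open>l * \<eta>\<close> for the marginal of X and \<open>\<eta>\<close> for Z.\<close>

lemma diag_normal_density_scaled:
  fixes v x :: "real^'k"
  assumes v: "\<And>i. 0 < v $ i" and t: "0 < t"
  shows "diag_normal_density 0 (\<chi> i. v $ i / t) x
    = (\<Prod>i\<in>UNIV. 1 / sqrt (2 * pi * v $ i)) * t powr (real CARD('k) / 2)
      * exp (- (t / 2 * (\<Sum>i\<in>UNIV. (x $ i)\<^sup>2 / v $ i)))"
proof -
  have "normal_density 0 (sqrt (v $ i / t)) (x $ i)
      = 1 / sqrt (2 * pi * v $ i) * sqrt t * exp (- (t / 2 * ((x $ i)\<^sup>2 / v $ i)))" for i
    using v[of i] t by (simp add: normal_density_def real_sqrt_divide real_sqrt_mult field_simps)
  then have "diag_normal_density 0 (\<chi> i. v $ i / t) x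
    = (\<Prod>i\<in>UNIV. 1 / sqrt (2 * pi * v $ i) * sqrt t * exp (- (t / 2 * ((x $ i)\<^sup>2 / v $ i))))"
    by (simp add: diag_normal_density_def)
  also have "\<dots> = (\<Prod>i\<in>UNIV. 1 / sqrt (2 * pi * v $ i)) * sqrt t ^ CARD('k)
      * exp (- (t / 2 * (\<Sum>i\<in>UNIV. (x $ i)\<^sup>2 / v $ i)))"
    by (simp only: prod.distrib prod_constant exp_sum[OF finite, symmetric] sum_negf sum_distrib_left)
  also have "sqrt t ^ CARD('k) = t powr (real CARD('k) / 2)"
    using t by (simp add: powr_half_sqrt[symmetric] powr_realpow[symmetric] powr_powr)
  finally show ?thesis .
qed

lemma nn_integral_Gamma_scaled:
  assumes s: "0 < s" and B: "0 < B"
  shows "(\<integral>\<^sup>+t. ennreal (indicator {0<..} t * (t powr (s - 1) * exp (- (B * t)))) \<partial>lborel)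
    = ennreal (Gamma s * B powr (- s))"
proof -
  let ?g = "\<lambda>t::real. ennreal (indicator {0..} t * t powr (s - 1) / exp t)"
  have G: "0 < Gamma s" using s by (rule Gamma_real_pos)
  have "ennreal (indicator {0<..} t * (t powr (s - 1) * exp (- (B * t))))
      = ennreal (B powr (1 - s)) * ?g (0 + B * t)" for t
  proof (cases "0 < t")
    case True
    have "B powr (1 - s) * (B * t) powr (s - 1) = t powr (s - 1)"
      using B True powr_add[of B "1 - s" "s - 1"] by (simp add: powr_mult mult.assoc[symmetric])
    then show ?thesis
      using True B by (simp add: ennreal_mult'[symmetric] exp_minus field_simps)
  next
    case False
    \<comment> \<open>The library integrand uses the closed half-line; at t = 0 both sides are 0
      because 0 to any real power is 0.\<close>
    then show ?thesis using B by (cases "t = 0") (auto simp: indicator_def zero_le_mult_iff)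
  qed
  then have "(\<integral>\<^sup>+t. ennreal (indicator {0<..} t * (t powr (s - 1) * exp (- (B * t)))) \<partial>lborel)
      = ennreal (B powr (1 - s)) * (\<integral>\<^sup>+t. ?g (0 + B * t) \<partial>lborel)"
    by (simp add: nn_integral_cmult)
  also have "(\<integral>\<^sup>+t. ?g (0 + B * t) \<partial>lborel) = ennreal (Gamma s / B)"
  proof -
    have "ennreal (Gamma s) = ennreal B * (\<integral>\<^sup>+t. ?g (0 + B * t) \<partial>lborel)"
      using nn_integral_real_affine[of ?g B 0] B Gamma_conv_nn_integral_real[OF s] by simp
    then have "ennreal (1 / B) * ennreal (Gamma s) = ennreal (1 / B) * ennreal B * (\<integral>\<^sup>+t. ?g (0 + B * t) \<partial>lborel)"
      by (simp add: mult.assoc)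
    then show ?thesis
      using B G by (simp add: ennreal_mult''[symmetric] mult.commute)
  qed
  also have "ennreal (B powr (1 - s)) * ennreal (Gamma s / B) = ennreal (Gamma s * B powr (- s))"
  proof -
    have "B powr (1 - s) = B * B powr (- s)"
      using B powr_add[of B 1 "- s"] by simp
    then show ?thesis using B G by (simp add: ennreal_mult''[symmetric])
  qed
  finally show ?thesis .
qed

text \<open>The dummy parameter \<open>n_type\<close> makes the type \<open>'n\<close> part of the
  locale, so that \<open>A_eq\<close> can refer to its cardinality.\<close>

locale normal_mixture_prior = beta_mixture \<alpha> b A \<gamma>
  for \<alpha> b A \<gamma> :: real and d c :: "real^'p" and a e :: real and n_type :: "'n::finite itself" +
  assumes d_pos: "0 < d $ i" and c_ge_1: "1 \<le> c $ i"
    and \<alpha>_eq: "\<alpha> = real CARD('p) / 2 + a"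
    and A_eq: "A = real CARD('p) / 2 + real CARD('n) / 2 + e + 2"
begin

definition V :: "real^'p \<Rightarrow> real" where
  "V x = (\<Sum>i\<in>UNIV. (x $ i)\<^sup>2 / (d $ i * c $ i))"

definition S :: "real^'n \<Rightarrow> real" where
  "S z = (\<Sum>k\<in>UNIV. (z $ k)\<^sup>2)"

definition W :: "(real^'p) \<times> (real^'n) \<Rightarrow> real" where
  "W y = V (fst y) / S (snd y)"

text \<open>The posterior density of (\<lambda>, \<eta>) times \<eta>, with \<theta> integrated out,
  up to the factor \<open>const\<close>.\<close>

definition kern :: "(real^'p) \<times> (real^'n) \<Rightarrow> real \<times> real \<Rightarrow> real" where
  "kern y = (\<lambda>(l, \<eta>). wt l * (indicator {0<..} \<eta> * (\<eta> powr (A - 1)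
     * exp (- (S (snd y) / 2 * (1 + W y * l) * \<eta>)))))"

text \<open>Given \<lambda> and \<eta>, prior variance d_i (c_i/\<lambda> - 1)/\<eta> and data
  variance d_i/\<eta> add up to d_i c_i/(\<lambda>\<eta>), so the conjugate weight of the
  observation is 1 - \<lambda>/c_i.\<close>

definition post_mean :: "(real^'p) \<times> (real^'n) \<Rightarrow> real \<Rightarrow> real^'p" where
  "post_mean y l = (\<chi> i. (1 - l / c $ i) * fst y $ i)"

definition post_var :: "real \<Rightarrow> real \<Rightarrow> real^'p" where
  "post_var l \<eta> = (\<chi> i. d $ i * (1 - l / c $ i) / \<eta>)"

definition const :: real where
  "const = (\<Prod>i\<in>(UNIV::'p set). 1 / sqrt (2 * pi * (d $ i * c $ i)))
    * (\<Prod>k\<in>(UNIV::'n set). 1 / sqrt (2 * pi))"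

lemma c_pos: "0 < c $ i"
  using c_ge_1[of i] by simp

lemma V_nonneg [simp]: "0 \<le> V x"
  unfolding V_def using d_pos c_pos by (intro sum_nonneg divide_nonneg_nonneg mult_nonneg_nonneg) (auto intro: less_imp_le)

lemma S_nonneg [simp]: "0 \<le> S z"
  unfolding S_def by (intro sum_nonneg) auto

lemma W_nonneg [simp]: "0 \<le> W y"
  by (simp add: W_def)

lemma S_pos: "z \<noteq> 0 \<Longrightarrow> 0 < S z"
  unfolding S_def by (auto simp: vec_eq_iff intro!: sum_pos2)

lemma const_pos: "0 < const"
  unfolding const_def using d_pos c_pos by (intro mult_pos_pos prod_pos) auto

lemma measurable_V [measurable]: "V \<in> borel_measurable borel"
  unfolding V_def by measurable

lemma measurable_S [measurable]: "S \<in> borel_measurable borel"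
  unfolding S_def by measurable

lemma measurable_W [measurable]: "W \<in> borel_measurable borel"
  unfolding W_def by measurable

lemma measurable_kern [measurable]: "kern y \<in> borel_measurable borel"
  unfolding kern_def borel_prod[symmetric] by measurable

lemma kern_nonneg [simp]: "0 \<le> kern y w"
  by (cases w) (simp add: kern_def)

lemma kern_eq_0: "\<not> (0 < l \<and> l < 1 / \<gamma> \<and> 0 < \<eta>) \<Longrightarrow> kern y (l, \<eta>) = 0"
  using wt_eq_0[of l] by (auto simp: kern_def)

lemma support_c:
  assumes "0 < l" "l < 1 / \<gamma>"
  shows "0 < 1 - l / c $ i" "1 - l / c $ i \<le> 1"
proof -
  have "l < c $ i" using supportD(1)[OF assms] c_ge_1[of i] by simp
  then show "0 < 1 - l / c $ i" "1 - l / c $ i \<le> 1" using c_pos[of i] assms by auto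
qed

lemma post_var_pos: "0 < l \<Longrightarrow> l < 1 / \<gamma> \<Longrightarrow> 0 < \<eta> \<Longrightarrow> 0 < post_var l \<eta> $ i"
  using support_c(1)[of l i] d_pos[of i] by (simp add: post_var_def)

text \<open>The prior covariance is designed so that X has marginal variances d_i c_i/(l \<eta>):
  all coordinates enter through V alone, and the exponents of X and Z merge into
  \<open>S * (1 + W * l) * \<eta> / 2\<close>. Merging needs S > 0, since W is a quotient by
  S.\<close>

lemma posterior_kernel_factor:
  assumes S: "0 < S (snd y)"
  shows "\<eta> * posterior_kernel a b e \<gamma> c d y (\<theta>, l, \<eta>)
    = const * kern y (l, \<eta>) * diag_normal_density (post_mean y l) (post_var l \<eta>) \<theta>"
proof (cases "0 < l \<and> l < 1 / \<gamma> \<and> 0 < \<eta>")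
  case False
  then show ?thesis
    using kern_eq_0[OF False] by (auto simp: posterior_kernel_def prior_density_def)
next
  case True
  then have l: "0 < l" "l < 1 / \<gamma>" and \<eta>: "0 < \<eta>" by auto
  let ?u = "\<chi> i. (1 / \<eta>) * (d $ i * (c $ i / l - 1)) :: real^'p"
  let ?v = "\<chi> i. (1 / \<eta>) * d $ i :: real^'p"
  let ?w = "\<chi> i. d $ i * c $ i :: real^'p"
  have uv: "?u $ i + ?v $ i = ?w $ i / (l * \<eta>)" for i
    using l \<eta> by (simp add: field_simps)
  have u: "0 < ?u $ i" and v: "0 < ?v $ i" and w: "0 < ?w $ i" for i
  proof -
    have "l < c $ i" using supportD(1)[OF l] c_ge_1[of i] by simp
    then show "0 < ?u $ i" using l \<eta> d_pos[of i] by simp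
    show "0 < ?v $ i" "0 < ?w $ i" using \<eta> d_pos[of i] c_pos[of i] by auto
  qed
  have q: "?u $ i / (?u $ i + ?v $ i) = 1 - l / c $ i" for i
    unfolding uv using l \<eta> d_pos[of i] c_pos[of i] by (simp add: field_simps)
  have m: "(\<chi> i. ?u $ i / (?u $ i + ?v $ i) * fst y $ i) = post_mean y l"
    unfolding q post_mean_def ..
  have "?u $ i * ?v $ i / (?u $ i + ?v $ i) = post_var l \<eta> $ i" for i
  proof -
    have "?u $ i * ?v $ i / (?u $ i + ?v $ i) = ?u $ i / (?u $ i + ?v $ i) * ?v $ i"
      by simp
    also have "\<dots> = post_var l \<eta> $ i"
      unfolding q by (simp add: post_var_def)
    finally show ?thesis .
  qed
  then have V: "(\<chi> i. ?u $ i * ?v $ i / (?u $ i + ?v $ i)) = post_var l \<eta>"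
    by (simp add: vec_eq_iff)
  have x: "diag_normal_density \<theta> ?v (fst y) * diag_normal_density 0 ?u \<theta>
      = diag_normal_density 0 (\<chi> i. ?w $ i / (l * \<eta>)) (fst y)
        * diag_normal_density (post_mean y l) (post_var l \<eta>) \<theta>"
    using diag_normal_density_conjugate[OF u v, of \<theta> "fst y"] unfolding uv[symmetric] m V .
  have l\<eta>: "0 < l * \<eta>" using l \<eta> by simp
  note X = diag_normal_density_scaled[OF w l\<eta>, of "fst y"]
  have Z: "diag_normal_density 0 (\<chi> k. 1 / \<eta>) (snd y)
      = (\<Prod>k\<in>(UNIV::'n set). 1 / sqrt (2 * pi)) * \<eta> powr (real CARD('n) / 2)
        * exp (- (\<eta> / 2 * S (snd y)))"
    using diag_normal_density_scaled[of "\<chi> k. 1" \<eta> "snd y"] \<eta> by (simp add: S_def)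
  have ex: "exp (- (\<eta> / 2 * S (snd y))) * exp (- (l * \<eta> / 2 * (\<Sum>i\<in>UNIV. (fst y $ i)\<^sup>2 / ?w $ i)))
      = exp (- (S (snd y) / 2 * (1 + W y * l) * \<eta>))"
  proof -
    have "W y * S (snd y) = V (fst y)" using S by (simp add: W_def)
    then have q: "S (snd y) / 2 * (1 + W y * l) * \<eta> = \<eta> / 2 * S (snd y) + l * \<eta> / 2 * V (fst y)"
      by (simp add: field_simps)
    show ?thesis
      unfolding q minus_add_distrib exp_add by (simp add: V_def)
  qed
  \<comment> \<open>Count of powers: \<eta> has 1 from the loss, n/2 from Z, p/2 from the marginal
    of X and e from the prior, in total \<open>A - 1\<close>; l has p/2 from X and a from the
    prior.\<close>
  have pw: "\<eta> * \<eta> powr (real CARD('n) / 2) * (l * \<eta>) powr (real CARD('p) / 2) * l powr a * \<eta> powr e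
      = l powr \<alpha> * \<eta> powr (A - 1)"
  proof -
    have "\<eta> powr (A - 1) = \<eta> powr (1 + real CARD('n) / 2 + real CARD('p) / 2 + e)"
      by (simp add: A_eq add_ac)
    also have "\<dots> = \<eta> * \<eta> powr (real CARD('n) / 2) * \<eta> powr (real CARD('p) / 2) * \<eta> powr e"
      using \<eta> by (simp only: powr_add powr_one)
    finally show ?thesis
      using l \<eta> by (simp add: \<alpha>_eq powr_add powr_mult)
  qed
  have "\<eta> * posterior_kernel a b e \<gamma> c d y (\<theta>, l, \<eta>)
    = \<eta> * (diag_normal_density \<theta> ?v (fst y) * diag_normal_density 0 (\<chi> k. 1 / \<eta>) (snd y)
        * (diag_normal_density 0 ?u \<theta> * (l powr a * (1 - \<gamma> * l) powr b) * \<eta> powr e))"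
    using l \<eta> by (simp add: posterior_kernel_def data_density_eq prior_density_def)
  also have "\<dots> = (diag_normal_density \<theta> ?v (fst y) * diag_normal_density 0 ?u \<theta>)
      * diag_normal_density 0 (\<chi> k. 1 / \<eta>) (snd y)
      * (\<eta> * (l powr a * (1 - \<gamma> * l) powr b) * \<eta> powr e)"
    by (simp only: mult_ac)
  also have "\<dots> = const * ((\<eta> * \<eta> powr (real CARD('n) / 2) * (l * \<eta>) powr (real CARD('p) / 2)
        * l powr a * \<eta> powr e) * (1 - \<gamma> * l) powr b
      * (exp (- (\<eta> / 2 * S (snd y))) * exp (- (l * \<eta> / 2 * (\<Sum>i\<in>UNIV. (fst y $ i)\<^sup>2 / ?w $ i)))))
      * diag_normal_density (post_mean y l) (post_var l \<eta>) \<theta>"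
    unfolding x X Z const_def by (simp add: mult_ac)
  also have "\<dots> = const * kern y (l, \<eta>) * diag_normal_density (post_mean y l) (post_var l \<eta>) \<theta>"
    unfolding pw ex using l \<eta> by (simp add: kern_def wt_def mult_ac)
  finally show ?thesis .
qed

text \<open>For fixed \<open>l\<close> the integral over \<eta> is a Gamma integral of shape
  \<open>A - s\<close>, whose rate supplies the power of \<open>1 + W * l\<close>. The value s = 0
  gives the estimator; s = 1 only serves finiteness of second moments.\<close>

lemma nn_integral_kern:
  assumes S: "0 < S (snd y)" and s: "0 \<le> s" "s < A"
  shows "(\<integral>\<^sup>+w. ennreal (fst w ^ k * snd w powr (- s) * kern y w) \<partial>lborel)
    = ennreal (Gamma (A - s) * (S (snd y) / 2) powr (s - A) * J k (A - s) (W y))"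
proof -
  have W0: "-\<gamma>/2 < W y" by (rule nonneg_gt) simp
  have G: "0 < Gamma (A - s)" using s by (intro Gamma_real_pos) simp
  have "(\<integral>\<^sup>+w. ennreal (fst w ^ k * snd w powr (- s) * kern y w) \<partial>lborel)
      = (\<integral>\<^sup>+l. \<integral>\<^sup>+\<eta>. ennreal (l ^ k * \<eta> powr (- s) * kern y (l, \<eta>)) \<partial>lborel \<partial>lborel)"
    unfolding lborel_prod[symmetric]
    by (subst lborel.nn_integral_fst[symmetric]) (auto simp: lborel_prod)
  also have "\<dots> = (\<integral>\<^sup>+l. ennreal (Gamma (A - s) * (S (snd y) / 2) powr (s - A))
      * ennreal (wt l * l ^ k * (1 + W y * l) powr (- (A - s))) \<partial>lborel)"
  proof (rule nn_integral_cong)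
    fix l
    show "(\<integral>\<^sup>+\<eta>. ennreal (l ^ k * \<eta> powr (- s) * kern y (l, \<eta>)) \<partial>lborel)
      = ennreal (Gamma (A - s) * (S (snd y) / 2) powr (s - A))
        * ennreal (wt l * l ^ k * (1 + W y * l) powr (- (A - s)))"
    proof (cases "0 < l \<and> l < 1 / \<gamma>")
      case True
      then have p: "0 < 1 + W y * l" by (simp add: add_pos_nonneg)
      have "(\<integral>\<^sup>+\<eta>. ennreal (l ^ k * \<eta> powr (- s) * kern y (l, \<eta>)) \<partial>lborel)
        = (\<integral>\<^sup>+\<eta>. ennreal (wt l * l ^ k) * ennreal (indicator {0<..} \<eta> * (\<eta> powr ((A - s) - 1)
            * exp (- (S (snd y) / 2 * (1 + W y * l) * \<eta>)))) \<partial>lborel)"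
      proof (rule nn_integral_cong)
        fix \<eta> :: real
        have eq: "l ^ k * \<eta> powr (- s) * kern y (l, \<eta>) = (wt l * l ^ k) * (indicator {0<..} \<eta>
            * (\<eta> powr ((A - s) - 1) * exp (- (S (snd y) / 2 * (1 + W y * l) * \<eta>))))"
        proof (cases "0 < \<eta>")
          case True
          have "\<eta> powr (A - s - 1) = \<eta> powr (- s) * \<eta> powr (A - 1)"
            by (simp add: powr_add[symmetric] algebra_simps)
          then show ?thesis using True by (simp add: kern_def mult_ac)
        qed (simp add: kern_def)
        show "ennreal (l ^ k * \<eta> powr (- s) * kern y (l, \<eta>)) = ennreal (wt l * l ^ k)
            * ennreal (indicator {0<..} \<eta> * (\<eta> powr ((A - s) - 1)
            * exp (- (S (snd y) / 2 * (1 + W y * l) * \<eta>))))"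
          unfolding eq by (intro ennreal_mult) (use True in auto)
      qed
      also have "\<dots> = ennreal (wt l * l ^ k)
          * ennreal (Gamma (A - s) * (S (snd y) / 2 * (1 + W y * l)) powr (- (A - s)))"
        using S s p by (subst nn_integral_cmult, simp, subst nn_integral_Gamma_scaled) auto
      also have "\<dots> = ennreal ((wt l * l ^ k)
          * (Gamma (A - s) * (S (snd y) / 2 * (1 + W y * l)) powr (- (A - s))))"
        using True G by (intro ennreal_mult[symmetric]) auto
      also have "(wt l * l ^ k) * (Gamma (A - s) * (S (snd y) / 2 * (1 + W y * l)) powr (- (A - s)))
        = (Gamma (A - s) * (S (snd y) / 2) powr (s - A)) * (wt l * l ^ k * (1 + W y * l) powr (- (A - s)))"
        using S p by (subst powr_mult) auto
      also have "ennreal \<dots> = ennreal (Gamma (A - s) * (S (snd y) / 2) powr (s - A))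
          * ennreal (wt l * l ^ k * (1 + W y * l) powr (- (A - s)))"
        using True G by (intro ennreal_mult) auto
      finally show ?thesis .
    next
      case False
      then have "kern y (l, \<eta>) = 0" for \<eta>
        by (intro kern_eq_0) auto
      then show ?thesis using wt_eq_0[OF False] by simp
    qed
  qed
  also have "\<dots> = ennreal (Gamma (A - s) * (S (snd y) / 2) powr (s - A))
      * (\<integral>\<^sup>+l. ennreal (wt l * l ^ k * (1 + W y * l) powr (- (A - s))) \<partial>lborel)"
    by (rule nn_integral_cmult) measurable
  also have "(\<integral>\<^sup>+l. ennreal (wt l * l ^ k * (1 + W y * l) powr (- (A - s))) \<partial>lborel)
      = ennreal (J k (A - s) (W y))"
    unfolding J_def using s
    by (intro nn_integral_eq_integral integrable_kernel[OF W0] AE_I2 kernel_nonneg) simp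
  finally show ?thesis
    using G J_nonneg by (simp add: ennreal_mult)
qed


lemma has_bochner_integral_kern:
  assumes S: "0 < S (snd y)"
  shows "has_bochner_integral lborel (\<lambda>w. fst w ^ k * kern y w)
    (Gamma A * (S (snd y) / 2) powr (- A) * J k A (W y))"
proof (rule has_bochner_integral_nn_integral)
  \<comment> \<open>\<open>x powr (- 0)\<close> is 1 except at x = 0, where it is 0; there
    \<open>kern\<close> vanishes as well.\<close>
  have e: "fst w ^ k * kern y w = fst w ^ k * snd w powr (- 0) * kern y w" for w
    using kern_eq_0[of "fst w" "snd w" y] by (cases "0 < snd w") auto
  show "(\<integral>\<^sup>+w. ennreal (fst w ^ k * kern y w) \<partial>lborel)
      = ennreal (Gamma A * (S (snd y) / 2) powr (- A) * J k A (W y))"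
    unfolding e using nn_integral_kern[OF S, of 0 k] A_gt_1 by simp
  show "0 \<le> Gamma A * (S (snd y) / 2) powr (- A) * J k A (W y)"
    using A_gt_1 Gamma_real_pos[of A] J_nonneg by simp
  show "AE w in lborel. 0 \<le> fst w ^ k * kern y w"
  proof (rule AE_I2)
    fix w :: "real \<times> real"
    show "0 \<le> fst w ^ k * kern y w"
      using kern_eq_0[of "fst w" "snd w" y] by (cases "0 < fst w") auto
  qed
qed measurable

definition joint :: "(real^'p) \<times> (real^'n) \<Rightarrow> (real^'p) \<times> real \<times> real \<Rightarrow> real" where
  "joint y q = kern y (snd q)
     * diag_normal_density (post_mean y (fst (snd q))) (post_var (fst (snd q)) (snd (snd q))) (fst q)"

lemma measurable_joint [measurable]: "joint y \<in> borel_measurable borel"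
  unfolding joint_def post_mean_def post_var_def by measurable

lemma joint_nonneg [simp]: "0 \<le> joint y q"
  by (simp add: joint_def)

lemma nn_integral_joint:
  assumes [measurable]: "f \<in> borel_measurable borel"
  shows "(\<integral>\<^sup>+q. f q * ennreal (joint y q) \<partial>lborel)
    = (\<integral>\<^sup>+w. (\<integral>\<^sup>+\<theta>. f (\<theta>, w) * ennreal (diag_normal_density (post_mean y (fst w))
        (post_var (fst w) (snd w)) \<theta>) \<partial>lborel) * ennreal (kern y w) \<partial>lborel)"
proof -
  have "(\<integral>\<^sup>+q. f q * ennreal (joint y q) \<partial>lborel)
      = (\<integral>\<^sup>+w. \<integral>\<^sup>+\<theta>. f (\<theta>, w) * ennreal (joint y (\<theta>, w)) \<partial>lborel \<partial>lborel)"
    unfolding lborel_prod[symmetric, where 'a="real^'p" and 'b="real \<times> real"]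
    by (subst lborel_pair.nn_integral_snd[symmetric]) (auto simp: lborel_prod)
  also have "\<dots> = (\<integral>\<^sup>+w. \<integral>\<^sup>+\<theta>. (f (\<theta>, w) * ennreal (diag_normal_density (post_mean y (fst w))
        (post_var (fst w) (snd w)) \<theta>)) * ennreal (kern y w) \<partial>lborel \<partial>lborel)"
    by (simp add: joint_def ennreal_mult mult_ac)
  also have "\<dots> = (\<integral>\<^sup>+w. (\<integral>\<^sup>+\<theta>. f (\<theta>, w) * ennreal (diag_normal_density (post_mean y (fst w))
        (post_var (fst w) (snd w)) \<theta>) \<partial>lborel) * ennreal (kern y w) \<partial>lborel)"
    by (intro nn_integral_cong nn_integral_multc) measurable
  finally show ?thesis .
qed

lemma has_bochner_integral_joint:
  assumes S: "0 < S (snd y)"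
  shows "has_bochner_integral lborel (joint y) (Gamma A * (S (snd y) / 2) powr (- A) * J 0 A (W y))"
proof (rule has_bochner_integral_nn_integral)
  have "(\<integral>\<^sup>+q. ennreal (joint y q) \<partial>lborel) = (\<integral>\<^sup>+w. (\<integral>\<^sup>+\<theta>. ennreal (diag_normal_density
      (post_mean y (fst w)) (post_var (fst w) (snd w)) \<theta>) \<partial>lborel) * ennreal (kern y w) \<partial>lborel)"
    using nn_integral_joint[of "\<lambda>_. 1" y] by simp
  also have "\<dots> = (\<integral>\<^sup>+w. ennreal (kern y w) \<partial>lborel)"
  proof (rule nn_integral_cong)
    fix w :: "real \<times> real"
    show "(\<integral>\<^sup>+\<theta>. ennreal (diag_normal_density (post_mean y (fst w)) (post_var (fst w) (snd w)) \<theta>) \<partial>lborel)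
        * ennreal (kern y w) = ennreal (kern y w)"
      using kern_eq_0[of "fst w" "snd w" y] post_var_pos[of "fst w" "snd w"]
      by (cases "0 < fst w \<and> fst w < 1 / \<gamma> \<and> 0 < snd w") (auto simp: nn_integral_diag_normal)
  qed
  also have "\<dots> = ennreal (Gamma A * (S (snd y) / 2) powr (- A) * J 0 A (W y))"
    using has_bochner_integral_kern[OF S, of 0]
    by (subst nn_integral_eq_integral) (auto simp: has_bochner_integral_iff)
  finally show "(\<integral>\<^sup>+q. ennreal (joint y q) \<partial>lborel)
      = ennreal (Gamma A * (S (snd y) / 2) powr (- A) * J 0 A (W y))" .
qed (use A_gt_1 Gamma_real_pos[of A] J_nonneg in auto)

text \<open>A Bochner integral is 0 by convention when the integrand is not integrable, so the
  integral of \<eta>\<theta> must be shown to exist. The conditional second moment of \<theta>_i is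
  at most d_i/\<eta> + X_i^2, and the factor 1/\<eta> costs one unit of \<open>A\<close>, which
  exceeds 1.\<close>

lemma nn_integral_joint_square_finite:
  assumes S: "0 < S (snd y)"
  shows "(\<integral>\<^sup>+q. ennreal ((fst q $ i)\<^sup>2) * ennreal (joint y q) \<partial>lborel) < \<infinity>"
proof -
  let ?x = "fst y"
  have "(\<integral>\<^sup>+q. ennreal ((fst q $ i)\<^sup>2) * ennreal (joint y q) \<partial>lborel)
      = (\<integral>\<^sup>+w. (\<integral>\<^sup>+\<theta>. ennreal ((\<theta> $ i)\<^sup>2) * ennreal (diag_normal_density (post_mean y (fst w))
        (post_var (fst w) (snd w)) \<theta>) \<partial>lborel) * ennreal (kern y w) \<partial>lborel)"
    by (subst nn_integral_joint) auto
  also have "\<dots> \<le> (\<integral>\<^sup>+w. ennreal (d $ i) * ennreal (fst w ^ 0 * snd w powr (- 1) * kern y w)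
      + ennreal ((?x $ i)\<^sup>2) * ennreal (fst w ^ 0 * kern y w) \<partial>lborel)"
  proof (rule nn_integral_mono)
    fix w :: "real \<times> real"
    let ?l = "fst w" and ?\<eta> = "snd w"
    show "(\<integral>\<^sup>+\<theta>. ennreal ((\<theta> $ i)\<^sup>2) * ennreal (diag_normal_density (post_mean y ?l)
        (post_var ?l ?\<eta>) \<theta>) \<partial>lborel) * ennreal (kern y w)
      \<le> ennreal (d $ i) * ennreal (fst w ^ 0 * snd w powr (- 1) * kern y w)
      + ennreal ((?x $ i)\<^sup>2) * ennreal (fst w ^ 0 * kern y w)"
    proof (cases "0 < ?l \<and> ?l < 1 / \<gamma> \<and> 0 < ?\<eta>")
      case True
      have split: "ennreal (p * X + q * Y) = ennreal p * ennreal X + ennreal q * ennreal Y"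
        if "0 \<le> p" "0 \<le> X" "0 \<le> q" "0 \<le> Y" for p X q Y :: real
        using that by (simp add: ennreal_mult)
      have c: "0 < 1 - ?l / c $ i" "1 - ?l / c $ i \<le> 1"
        using support_c True by auto
      have "post_var ?l ?\<eta> $ i \<le> d $ i * ?\<eta> powr (- 1)"
        using c d_pos[of i] True
        by (simp add: post_var_def powr_minus_divide divide_right_mono mult_left_le)
      moreover have "(post_mean y ?l $ i)\<^sup>2 \<le> (?x $ i)\<^sup>2"
        using c by (simp add: post_mean_def power_mult_distrib mult_left_le_one_le power_le_one)
      ultimately have "post_var ?l ?\<eta> $ i + (post_mean y ?l $ i)\<^sup>2 \<le> d $ i * ?\<eta> powr (- 1) + (?x $ i)\<^sup>2"
        by (rule add_mono)
      then have "ennreal ((post_var ?l ?\<eta> $ i + (post_mean y ?l $ i)\<^sup>2) * kern y w)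
          \<le> ennreal ((d $ i * ?\<eta> powr (- 1) + (?x $ i)\<^sup>2) * kern y w)"
        by (intro ennreal_leI mult_right_mono) auto
      also have "\<dots> = ennreal (d $ i * (?\<eta> powr (- 1) * kern y w) + (?x $ i)\<^sup>2 * kern y w)"
        by (simp add: algebra_simps)
      also have "\<dots> = ennreal (d $ i) * ennreal (fst w ^ 0 * snd w powr (- 1) * kern y w)
          + ennreal ((?x $ i)\<^sup>2) * ennreal (fst w ^ 0 * kern y w)"
        using split[of "d $ i" "?\<eta> powr (- 1) * kern y w" "(?x $ i)\<^sup>2" "kern y w"] d_pos[of i]
        by (simp only: power_0 mult_1_left less_imp_le) simp
      finally have le: "ennreal ((post_var ?l ?\<eta> $ i + (post_mean y ?l $ i)\<^sup>2) * kern y w)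
        \<le> ennreal (d $ i) * ennreal (fst w ^ 0 * snd w powr (- 1) * kern y w)
          + ennreal ((?x $ i)\<^sup>2) * ennreal (fst w ^ 0 * kern y w)" .
      have "(\<integral>\<^sup>+\<theta>. ennreal ((\<theta> $ i)\<^sup>2) * ennreal (diag_normal_density (post_mean y ?l)
          (post_var ?l ?\<eta>) \<theta>) \<partial>lborel) = ennreal (post_var ?l ?\<eta> $ i + (post_mean y ?l $ i)\<^sup>2)"
        using nn_integral_diag_normal_square[of "post_var ?l ?\<eta>" i 0] post_var_pos True by simp
      with le show ?thesis
        using post_var_pos[of ?l ?\<eta> i] True by (simp only: ennreal_mult''[OF kern_nonneg, symmetric])
    next
      case False
      then show ?thesis using kern_eq_0[of ?l ?\<eta> y] by simp
    qed
  qed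
  also have "\<dots> = ennreal (d $ i) * (\<integral>\<^sup>+w. ennreal (fst w ^ 0 * snd w powr (- 1) * kern y w) \<partial>lborel)
      + ennreal ((?x $ i)\<^sup>2) * (\<integral>\<^sup>+w. ennreal (fst w ^ 0 * kern y w) \<partial>lborel)"
    by (subst nn_integral_add) (auto simp: nn_integral_cmult)
  also have "\<dots> < \<infinity>"
  proof -
    have "(\<integral>\<^sup>+w. ennreal (fst w ^ 0 * kern y w) \<partial>lborel) < \<infinity>"
      using has_bochner_integral_kern[OF S, of 0]
      by (subst nn_integral_eq_integral) (auto simp: has_bochner_integral_iff)
    then show ?thesis
      using nn_integral_kern[OF S, of 1 0] A_gt_1 by (simp add: ennreal_mult_less_top)
  qed
  finally show ?thesis .
qed

lemma integrable_joint_nth: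
  assumes S: "0 < S (snd y)"
  shows "integrable lborel (\<lambda>q. joint y q * fst q $ i)"
proof (rule Bochner_Integration.integrable_bound)
  have "integrable lborel (\<lambda>q. (fst q $ i)\<^sup>2 * joint y q)"
    using nn_integral_joint_square_finite[OF S, of i]
    by (intro integrableI_nonneg) (auto simp: ennreal_mult)
  moreover have "integrable lborel (joint y)"
    using has_bochner_integral_joint[OF S] by (simp add: has_bochner_integral_iff)
  ultimately show "integrable lborel (\<lambda>q. joint y q + (fst q $ i)\<^sup>2 * joint y q)"
    by simp
  show "AE q in lborel. norm (joint y q * fst q $ i) \<le> norm (joint y q + (fst q $ i)\<^sup>2 * joint y q)"
  proof (rule AE_I2)
    fix q :: "(real^'p) \<times> real \<times> real"
    have "0 \<le> (1 - \<bar>fst q $ i\<bar>)\<^sup>2" by simp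
    then have "\<bar>fst q $ i\<bar> \<le> 1 + (fst q $ i)\<^sup>2"
      unfolding power2_diff by (simp add: power2_eq_square abs_mult)
    then have "joint y q * \<bar>fst q $ i\<bar> \<le> joint y q * (1 + (fst q $ i)\<^sup>2)"
      by (rule mult_left_mono) simp
    then show "norm (joint y q * fst q $ i) \<le> norm (joint y q + (fst q $ i)\<^sup>2 * joint y q)"
      by (simp add: abs_mult algebra_simps)
  qed
qed measurable

lemma integral_joint_nth:
  assumes S: "0 < S (snd y)"
  shows "(\<integral>q. joint y q * fst q $ i \<partial>lborel)
    = Gamma A * (S (snd y) / 2) powr (- A) * (J 0 A (W y) - J 1 A (W y) / c $ i) * fst y $ i"
proof -
  let ?K = "Gamma A * (S (snd y) / 2) powr (- A)"
  have int: "integrable (lborel \<Otimes>\<^sub>M lborel) (\<lambda>(\<theta>, w). joint y (\<theta>, w) * \<theta> $ i)"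
    unfolding lborel_prod using integrable_joint_nth[OF S, of i] by (simp add: split_beta')
  have "(\<integral>q. joint y q * fst q $ i \<partial>lborel)
      = (\<integral>w. \<integral>\<theta>. joint y (\<theta>, w) * \<theta> $ i \<partial>lborel \<partial>lborel)"
    using lborel_pair.integral_snd[OF int] by (simp add: lborel_prod split_beta')
  also have "\<dots> = (\<integral>w. fst y $ i * (fst w ^ 0 * kern y w - fst w ^ 1 * kern y w / c $ i) \<partial>lborel)"
  proof (rule Bochner_Integration.integral_cong[OF refl])
    fix w :: "real \<times> real"
    show "(\<integral>\<theta>. joint y (\<theta>, w) * \<theta> $ i \<partial>lborel)
      = fst y $ i * (fst w ^ 0 * kern y w - fst w ^ 1 * kern y w / c $ i)"
    proof (cases "0 < fst w \<and> fst w < 1 / \<gamma> \<and> 0 < snd w")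
      case True
      have "(\<integral>\<theta>. joint y (\<theta>, w) * \<theta> $ i \<partial>lborel)
        = (\<integral>\<theta>. kern y w * (diag_normal_density (post_mean y (fst w)) (post_var (fst w) (snd w)) \<theta>
            * \<theta> $ i) \<partial>lborel)"
        by (simp add: joint_def mult.assoc)
      also have "\<dots> = kern y w * post_mean y (fst w) $ i"
        using has_bochner_integral_diag_normal_nth[of "post_var (fst w) (snd w)" "post_mean y (fst w)" i]
          post_var_pos True by (simp add: has_bochner_integral_iff)
      finally show ?thesis by (simp add: post_mean_def algebra_simps)
    next
      case False
      then show ?thesis using kern_eq_0[of "fst w" "snd w" y] by (simp add: joint_def)
    qed
  qed
  also have "\<dots> = fst y $ i * (?K * J 0 A (W y) - ?K * J 1 A (W y) / c $ i)"
    using has_bochner_integral_kern[OF S, of 0] has_bochner_integral_kern[OF S, of 1]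
    by (simp add: has_bochner_integral_iff)
  finally show ?thesis by (simp add: algebra_simps)
qed

text \<open>Numerator and denominator share \<open>const\<close>, the Gamma value and the power of
  S; what remains is the ratio of \<open>J 0 A - J 1 A / c\<close> to \<open>J 0 A\<close>. The
  formula is claimed off the null set Z = 0.\<close>

lemma gen_bayes_eq:
  assumes S: "0 < S (snd y)"
  shows "gen_bayes a b e \<gamma> c d y = (\<chi> i. (1 - r (W y) / c $ i) * fst y $ i)"
proof -
  let ?K = "Gamma A * (S (snd y) / 2) powr (- A)"
  have K: "0 < ?K" using S A_gt_1 Gamma_real_pos[of A] by simp
  have J0: "0 < J 0 A (W y)" using J_pos[OF nonneg_gt, of "W y" A 0] A_gt_1 by simp
  have f: "(\<lambda>(\<theta>, l, \<eta>). \<eta> * posterior_kernel a b e \<gamma> c d y (\<theta>, l, \<eta>)) = (\<lambda>q. const * joint y q)"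
    "(\<lambda>(\<theta>, l, \<eta>). (\<eta> * posterior_kernel a b e \<gamma> c d y (\<theta>, l, \<eta>)) *\<^sub>R \<theta>)
      = (\<lambda>q. const *\<^sub>R (joint y q *\<^sub>R fst q))"
    using posterior_kernel_factor[OF S] by (auto simp: fun_eq_iff joint_def)
  have I0: "(\<integral>q. const * joint y q \<partial>lborel) = const * (?K * J 0 A (W y))"
    using has_bochner_integral_joint[OF S] by (simp add: has_bochner_integral_iff)
  have int: "integrable lborel (\<lambda>q. joint y q *\<^sub>R fst q)"
  proof (rule Bochner_Integration.integrable_bound)
    show "integrable lborel (\<lambda>q. \<Sum>i\<in>UNIV. \<bar>joint y q * fst q $ i\<bar>)"
      using integrable_joint_nth[OF S] by (intro Bochner_Integration.integrable_sum integrable_abs)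
    show "AE q in lborel. norm (joint y q *\<^sub>R fst q) \<le> norm (\<Sum>i\<in>UNIV. \<bar>joint y q * fst q $ i\<bar>)"
    proof (rule AE_I2)
      fix q :: "(real^'p) \<times> real \<times> real"
      show "norm (joint y q *\<^sub>R fst q) \<le> norm (\<Sum>i\<in>UNIV. \<bar>joint y q * fst q $ i\<bar>)"
        using norm_le_l1_cart[of "joint y q *\<^sub>R fst q"] by simp
    qed
  qed measurable
  have I1: "(\<integral>q. const *\<^sub>R (joint y q *\<^sub>R fst q) \<partial>lborel) $ i
      = const * (?K * (J 0 A (W y) - J 1 A (W y) / c $ i) * fst y $ i)" for i
    unfolding integral_scaleR_right vector_scaleR_component real_scaleR_def integral_joint_nth[OF S, symmetric]
    using integral_bounded_linear[OF bounded_linear_vec_nth[of i] int] by simp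
  show ?thesis
  proof (rule vec_eq_iff[THEN iffD2, rule_format])
    fix i
    have "gen_bayes a b e \<gamma> c d y $ i
      = (1 / (const * (?K * J 0 A (W y)))) * (const * (?K * (J 0 A (W y) - J 1 A (W y) / c $ i) * fst y $ i))"
      unfolding gen_bayes_def f by (simp only: I0 vector_scaleR_component I1 real_scaleR_def)
    also have "\<dots> = (const * ?K) * ((J 0 A (W y) - J 1 A (W y) / c $ i) * fst y $ i) / ((const * ?K) * J 0 A (W y))"
      by (simp only: times_divide_eq_left mult_1_left mult.assoc)
    also have "\<dots> = (J 0 A (W y) - J 1 A (W y) / c $ i) * fst y $ i / J 0 A (W y)"
      using const_pos K by (intro mult_divide_mult_cancel_left) auto
    also have "\<dots> = (1 - r (W y) / c $ i) * fst y $ i"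
      using J0 by (simp add: r_def field_simps)
    finally show "gen_bayes a b e \<gamma> c d y $ i = (\<chi> i. (1 - r (W y) / c $ i) * fst y $ i) $ i"
      by simp
  qed
qed

text \<open>Minimaxity asks for Borel measurability everywhere. It is read off the defining
  integrals, which also covers Z = 0, where the closed form is not claimed.\<close>

lemma measurable_gen_bayes:
  "(gen_bayes a b e \<gamma> c d :: (real^'p) \<times> (real^'n) \<Rightarrow> real^'p) \<in> borel_measurable borel"
  unfolding gen_bayes_def[abs_def] posterior_kernel_def prior_density_def split_beta'
  by measurable

end

section \<open>Risk of the generalized Bayes estimator\<close>

lemma AE_lborel_snd_nonzero:
  "AE y in (lborel :: ('a::euclidean_space \<times> 'b::euclidean_space) measure). snd y \<noteq> 0"
proof (rule AE_I)
  show "{y \<in> space (lborel :: ('a \<times> 'b) measure). \<not> snd y \<noteq> 0} \<subseteq> {y. snd y = 0}" by auto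
  have eq: "{y :: 'a \<times> 'b. snd y = 0} = UNIV \<times> {0}" by auto
  show m: "{y :: 'a \<times> 'b. snd y = 0} \<in> sets lborel"
    unfolding eq sets_lborel by (intro borel_closed closed_Times) auto
  have "emeasure lborel {y :: 'a \<times> 'b. snd y = 0} = (\<integral>\<^sup>+y. indicator {y :: 'a \<times> 'b. snd y = 0} y \<partial>lborel)"
    using m by simp
  also have "\<dots> = (\<integral>\<^sup>+y. 1 * indicator {0} (snd (y :: 'a \<times> 'b)) \<partial>lborel)"
    by (intro nn_integral_cong) (auto simp: indicator_def)
  also have "\<dots> = (\<integral>\<^sup>+x. 1 \<partial>(lborel :: 'a measure)) * (\<integral>\<^sup>+z. indicator {0} (z :: 'b) \<partial>lborel)"
    by (rule nn_integral_lborel_times) auto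
  finally show "emeasure lborel {y :: 'a \<times> 'b. snd y = 0} = 0"
    by simp
qed

lemma data_density_directional_derivative_fst:
  fixes d :: "real^'p" and y :: "(real^'p) \<times> (real^'n)"
  assumes "0 < d $ i" "0 < s2"
  shows "((\<lambda>s. data_density d \<theta> s2 (y + s *\<^sub>R (axis i 1, 0))) has_real_derivative
    - ((fst y $ i - \<theta> $ i) / (s2 * d $ i) * data_density d \<theta> s2 y)) (at 0)"
proof -
  have "0 < (\<chi> i. s2 * d $ i) $ i" using assms by simp
  from DERIV_cmult_right[OF diag_normal_density_directional_derivative[OF this, of \<theta> "fst y"],
      of "diag_normal_density 0 (\<chi> k. s2) (snd y)"]
  show ?thesis by (simp add: data_density_eq mult.assoc)
qed

lemma data_density_directional_derivative_snd:
  fixes d :: "real^'p" and y :: "(real^'p) \<times> (real^'n)"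
  assumes "0 < s2"
  shows "((\<lambda>s. data_density d \<theta> s2 (y + s *\<^sub>R (0, axis k 1))) has_real_derivative
    - (snd y $ k / s2 * data_density d \<theta> s2 y)) (at 0)"
proof -
  have "0 < (\<chi> k. s2) $ k" using assms by simp
  from DERIV_cmult[OF diag_normal_density_directional_derivative[OF this, of 0 "snd y"],
      of "diag_normal_density \<theta> (\<chi> i. s2 * d $ i) (fst y)"]
  show ?thesis by (simp add: data_density_eq mult_ac)
qed

lemma has_bochner_integral_data_density_square:
  fixes d :: "real^'p"
  assumes d: "\<And>i. 0 < d $ i" and s2: "0 < s2"
  shows "has_bochner_integral lborel
    (\<lambda>y. (fst y $ i - t)\<^sup>2 * data_density d \<theta> s2 (y :: _ \<times> (real^'n))) (s2 * d $ i + (\<theta> $ i - t)\<^sup>2)"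
proof (rule has_bochner_integral_nn_integral)
  have "(\<integral>\<^sup>+y. ennreal ((fst y $ i - t)\<^sup>2) * ennreal (data_density d \<theta> s2 (y :: _ \<times> (real^'n))) \<partial>lborel)
      = ennreal (s2 * d $ i + (\<theta> $ i - t)\<^sup>2)"
    using d s2 nn_integral_diag_normal_square[of "\<chi> i. s2 * d $ i" i t \<theta>]
    by (subst nn_integral_data_density_fst[where f="\<lambda>x. ennreal ((x $ i - t)\<^sup>2)"]) auto
  then show "(\<integral>\<^sup>+y. ennreal ((fst y $ i - t)\<^sup>2 * data_density d \<theta> s2 (y :: _ \<times> (real^'n))) \<partial>lborel)
      = ennreal (s2 * d $ i + (\<theta> $ i - t)\<^sup>2)"
    by (simp add: ennreal_mult)
  show "0 \<le> s2 * d $ i + (\<theta> $ i - t)\<^sup>2" using d[of i] s2 by simp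
qed auto

lemma integrable_data_density:
  fixes d :: "real^'p"
  assumes d: "\<And>i. 0 < d $ i" and s2: "0 < s2"
  shows "integrable lborel (data_density d \<theta> s2 :: _ \<times> (real^'n) \<Rightarrow> real)"
proof (rule integrableI_nonneg)
  have "(\<integral>\<^sup>+y. ennreal (data_density d \<theta> s2 (y :: _ \<times> (real^'n))) \<partial>lborel) = 1"
    using d s2 nn_integral_data_density_fst[of "\<lambda>_. 1" s2 d \<theta>] by (simp add: nn_integral_diag_normal)
  then show "(\<integral>\<^sup>+y. ennreal (data_density d \<theta> s2 (y :: _ \<times> (real^'n))) \<partial>lborel) < \<infinity>"
    by simp
qed auto

lemma integrable_data_density_snd_square:
  fixes d :: "real^'p"
  assumes d: "\<And>i. 0 < d $ i" and s2: "0 < s2"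
  shows "integrable lborel (\<lambda>y. (snd y $ k)\<^sup>2 * data_density d \<theta> s2 (y :: _ \<times> (real^'n)))"
proof (rule integrableI_nonneg)
  have "(\<integral>\<^sup>+y. ennreal ((snd y $ k)\<^sup>2) * ennreal (data_density d \<theta> s2 (y :: _ \<times> (real^'n))) \<partial>lborel)
      = ennreal s2"
    using d s2 nn_integral_diag_normal_square[of "\<chi> k. s2" k 0 0]
    by (subst nn_integral_data_density_snd[where f="\<lambda>x. ennreal ((x $ k)\<^sup>2)"]) auto
  then show "(\<integral>\<^sup>+y. ennreal ((snd y $ k)\<^sup>2 * data_density d \<theta> s2 (y :: _ \<times> (real^'n))) \<partial>lborel) < \<infinity>"
    by (simp add: ennreal_mult)
qed auto

text \<open>Second moments exist, so quadratic growth is integrable; every function fed into Stein's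
  identity is checked against this criterion.\<close>

lemma integrable_mult_data_density:
  fixes d :: "real^'p" and g :: "_ \<times> (real^'n) \<Rightarrow> real"
  assumes d: "\<And>i. 0 < d $ i" and s2: "0 < s2" and [measurable]: "g \<in> borel_measurable borel"
    and g: "\<And>y. \<bar>g y\<bar> \<le> K * (1 + (\<Sum>i\<in>UNIV. (fst y $ i)\<^sup>2) + (\<Sum>k\<in>UNIV. (snd y $ k)\<^sup>2))"
  shows "integrable lborel (\<lambda>y. g y * data_density d \<theta> s2 y)"
proof (rule Bochner_Integration.integrable_bound)
  let ?m = "\<lambda>y :: _ \<times> (real^'n). K * (1 + (\<Sum>i\<in>UNIV. (fst y $ i)\<^sup>2) + (\<Sum>k\<in>UNIV. (snd y $ k)\<^sup>2))"
  let ?f = "data_density d \<theta> s2 :: _ \<times> (real^'n) \<Rightarrow> real"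
  have "integrable lborel (\<lambda>y. (fst y $ i)\<^sup>2 * ?f y)" for i
    using has_bochner_integral_data_density_square[OF d s2, of i 0 \<theta>, where 'n='n]
    by (simp add: has_bochner_integral_iff)
  then have "integrable lborel (\<lambda>y. K * (?f y + (\<Sum>i\<in>UNIV. (fst y $ i)\<^sup>2 * ?f y) + (\<Sum>k\<in>UNIV. (snd y $ k)\<^sup>2 * ?f y)))"
    using integrable_data_density[OF d s2] integrable_data_density_snd_square[OF d s2]
    by (intro integrable_mult_right Bochner_Integration.integrable_add Bochner_Integration.integrable_sum)
  then show "integrable lborel (\<lambda>y. ?m y * ?f y)"
    by (simp add: algebra_simps sum_distrib_left sum_distrib_right)
  show "AE y in lborel. norm (g y * ?f y) \<le> norm (?m y * ?f y)"
  proof (rule AE_I2)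
    fix y
    have "\<bar>g y\<bar> * ?f y \<le> ?m y * ?f y" by (rule mult_right_mono[OF g]) simp
    also have "\<dots> \<le> \<bar>?m y * ?f y\<bar>" by (rule abs_ge_self)
    finally show "norm (g y * ?f y) \<le> norm (?m y * ?f y)" by (simp add: abs_mult)
  qed
qed measurable

lemma (in beta_mixture) measurable_r [measurable]: "r \<in> borel_measurable borel" "r' \<in> borel_measurable borel"
proof -
  have [measurable]: "J k q \<in> borel_measurable borel" for k q
    unfolding J_def[abs_def] by measurable
  show "r \<in> borel_measurable borel" "r' \<in> borel_measurable borel"
    unfolding r_def[abs_def] r'_def[abs_def] by measurable
qed

context normal_mixture_prior
begin

section \<open>Stein's identity for the shrinkage terms\<close>

definition phi_max :: real where
  "phi_max = (\<alpha> + 1) / (A - \<alpha> - 2)"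

text \<open>Chosen so that S h(W) = V r(W)^2: the squared shrinkage becomes a quadratic form in Z.
  In terms of \<phi> it is \<phi>(w)^2/w for w > 0.\<close>

definition h :: "real \<Rightarrow> real" where
  "h w = w * (r w)\<^sup>2"

definition h' :: "real \<Rightarrow> real" where
  "h' w = (r w)\<^sup>2 + 2 * w * r w * r' w"

lemma phi_max_nonneg: "0 \<le> phi_max"
  unfolding phi_max_def using \<alpha> A by simp

text \<open>\<open>h\<close> is the product of \<open>w * r w\<close>, at most
  \<open>phi_max\<close>, and \<open>r w\<close>, at most 1; for the last bound,
  \<open>w * h' w = h w + 2 * (w * r w) * (w * r' w)\<close>.\<close>

lemma h_bounds:
  assumes "0 \<le> w"
  shows "0 \<le> h w" "h w \<le> phi_max" "\<bar>w * h' w\<bar> \<le> (1 + 2 * A) * phi_max"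
proof -
  show h0: "0 \<le> h w" using assms by (simp add: h_def)
  have "h w = (w * r w) * r w" by (simp add: h_def power2_eq_square)
  also have "\<dots> \<le> phi_max * 1"
    using mult_r_le[OF assms] r_le_1[OF assms] r_nonneg phi_max_nonneg unfolding phi_max_def
    by (intro mult_mono) auto
  finally show hm: "h w \<le> phi_max" by simp
  have "w * h' w = h w + 2 * (w * r w) * (w * r' w)"
    by (simp add: h_def h'_def power2_eq_square algebra_simps)
  also have "\<bar>\<dots>\<bar> \<le> h w + 2 * (w * r w) * \<bar>w * r' w\<bar>"
    using h0 assms r_nonneg[of w] by (intro abs_triangle_ineq[THEN order_trans] add_mono) (auto simp: abs_mult)
  also have "\<dots> \<le> h w + 2 * (w * r w) * (A * r w)"
    using w_r'_bound[OF assms] assms r_nonneg[of w] by (intro add_left_mono mult_left_mono) auto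
  also have "\<dots> = (1 + 2 * A) * h w" by (simp add: h_def power2_eq_square algebra_simps)
  also have "\<dots> \<le> (1 + 2 * A) * phi_max" using hm A_gt_1 by (intro mult_left_mono) auto
  finally show "\<bar>w * h' w\<bar> \<le> (1 + 2 * A) * phi_max" .
qed

lemma h_derivative: "0 \<le> w \<Longrightarrow> (h has_real_derivative h' w) (at w)"
  unfolding h_def[abs_def] h'_def
  by (rule derivative_eq_intros r_derivative[OF nonneg_gt] refl | assumption)+ (simp add: power2_eq_square)

lemma measurable_h [measurable]: "h \<in> borel_measurable borel" "h' \<in> borel_measurable borel"
  unfolding h_def[abs_def] h'_def[abs_def] by measurable

text \<open>The function differentiated is \<open>r (W y) * fst y $ i\<close>. The exceptional set
  is empty even at Z = 0: moving X keeps S fixed, and for S = 0 division by zero makes W constantly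
  0, in agreement with the stated derivative.\<close>

lemma Stein_fst:
  assumes s2: "0 < s2"
  shows "integrable lborel (\<lambda>y. (fst y $ i - \<theta> $ i) * (r (W y) * fst y $ i) * data_density d \<theta> s2 y)"
    and "integrable lborel (\<lambda>y. (r (W y) + 2 * r' (W y) * ((fst y $ i)\<^sup>2 / (d $ i * c $ i * S (snd y))))
      * data_density d \<theta> s2 y)"
    and "(\<integral>y. (fst y $ i - \<theta> $ i) * (r (W y) * fst y $ i) * data_density d \<theta> s2 y \<partial>lborel)
      = (s2 * d $ i) * (\<integral>y. (r (W y) + 2 * r' (W y) * ((fst y $ i)\<^sup>2 / (d $ i * c $ i * S (snd y))))
        * data_density d \<theta> s2 y \<partial>lborel)"
proof -
  let ?g = "\<lambda>y. r (W y) * fst y $ i"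
  let ?g' = "\<lambda>y. r (W y) + 2 * r' (W y) * ((fst y $ i)\<^sup>2 / (d $ i * c $ i * S (snd y)))"
  have dc: "0 < d $ i * c $ i" using d_pos c_pos by simp
  have x2: "(fst y $ i)\<^sup>2 \<le> (\<Sum>i\<in>UNIV. (fst y $ i)\<^sup>2) + (\<Sum>k\<in>UNIV. (snd y $ k)\<^sup>2)"
    for y :: "(real^'p) \<times> (real^'n)"
    using member_le_sum[of i UNIV "\<lambda>i. (fst y $ i)\<^sup>2"] sum_nonneg[of UNIV "\<lambda>k. (snd y $ k)\<^sup>2"] by simp
  have x1: "\<bar>fst y $ i\<bar> \<le> 1 + (fst y $ i)\<^sup>2" for y :: "(real^'p) \<times> (real^'n)"
  proof -
    have "0 \<le> (1 - \<bar>fst y $ i\<bar>)\<^sup>2" by simp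
    then show ?thesis
      unfolding power2_diff by (simp add: power2_eq_square abs_mult)
  qed
  have gx: "\<bar>?g y\<bar> \<le> \<bar>fst y $ i\<bar>" for y
    using r_nonneg r_le_1 by (simp add: abs_mult mult_left_le_one_le)
  have int_g: "integrable lborel (\<lambda>y. ?g y * data_density d \<theta> s2 y)"
  proof (rule integrable_mult_data_density[OF d_pos s2])
    fix y :: "(real^'p) \<times> (real^'n)"
    have "\<bar>?g y\<bar> \<le> 1 + (fst y $ i)\<^sup>2"
      using gx[of y] x1[of y] by (rule order_trans)
    then show "\<bar>?g y\<bar> \<le> 1 * (1 + (\<Sum>i\<in>UNIV. (fst y $ i)\<^sup>2) + (\<Sum>k\<in>UNIV. (snd y $ k)\<^sup>2))"
      using x2[of y] by simp
  qed measurable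
  show int_mg: "integrable lborel (\<lambda>y. (fst y $ i - \<theta> $ i) * ?g y * data_density d \<theta> s2 y)"
  proof (rule integrable_mult_data_density[OF d_pos s2])
    fix y :: "(real^'p) \<times> (real^'n)"
    have "\<bar>(fst y $ i - \<theta> $ i) * ?g y\<bar> \<le> (\<bar>fst y $ i\<bar> + \<bar>\<theta> $ i\<bar>) * \<bar>fst y $ i\<bar>"
      unfolding abs_mult using gx[of y] by (intro mult_mono abs_triangle_ineq4) (auto simp: abs_mult)
    also have "\<dots> = (fst y $ i)\<^sup>2 + \<bar>\<theta> $ i\<bar> * \<bar>fst y $ i\<bar>"
      by (simp add: power2_eq_square algebra_simps)
    also have "\<dots> \<le> (1 + (fst y $ i)\<^sup>2) + \<bar>\<theta> $ i\<bar> * (1 + (fst y $ i)\<^sup>2)"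
      using x1[of y] by (intro add_mono mult_left_mono) auto
    also have "\<dots> = (1 + \<bar>\<theta> $ i\<bar>) * (1 + (fst y $ i)\<^sup>2)" by (simp add: algebra_simps)
    also have "\<dots> \<le> (1 + \<bar>\<theta> $ i\<bar>) * (1 + (\<Sum>i\<in>UNIV. (fst y $ i)\<^sup>2) + (\<Sum>k\<in>UNIV. (snd y $ k)\<^sup>2))"
      using x2[of y] by (intro mult_left_mono) auto
    finally show "\<bar>(fst y $ i - \<theta> $ i) * ?g y\<bar>
      \<le> (1 + \<bar>\<theta> $ i\<bar>) * (1 + (\<Sum>i\<in>UNIV. (fst y $ i)\<^sup>2) + (\<Sum>k\<in>UNIV. (snd y $ k)\<^sup>2))" .
  qed measurable
  show int_g': "integrable lborel (\<lambda>y. ?g' y * data_density d \<theta> s2 y)"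
  proof (rule integrable_mult_data_density[OF d_pos s2])
    fix y :: "(real^'p) \<times> (real^'n)"
    \<comment> \<open>One term of V is at most V, so the quotient by S is absorbed into W and the
      bound on \<open>W * r' W\<close> applies.\<close>
    have "(fst y $ i)\<^sup>2 / (d $ i * c $ i) \<le> V (fst y)"
      unfolding V_def using d_pos c_pos by (intro member_le_sum) (simp_all add: less_imp_le)
    then have "(fst y $ i)\<^sup>2 / (d $ i * c $ i) / S (snd y) \<le> W y"
      unfolding W_def by (intro divide_right_mono) auto
    then have "\<bar>r' (W y)\<bar> * ((fst y $ i)\<^sup>2 / (d $ i * c $ i * S (snd y))) \<le> \<bar>r' (W y)\<bar> * W y"
      by (intro mult_left_mono) auto
    also have "\<dots> = \<bar>W y * r' (W y)\<bar>" by (simp add: abs_mult)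
    also have "\<dots> \<le> A * 1"
      using w_r'_bound[OF W_nonneg, of y] r_le_1[OF W_nonneg, of y] A_gt_1
      by (meson less_imp_le less_trans mult_left_mono order_trans zero_less_one)
    finally have "\<bar>r' (W y)\<bar> * ((fst y $ i)\<^sup>2 / (d $ i * c $ i * S (snd y))) \<le> A" by simp
    moreover have "\<bar>?g' y\<bar> \<le> \<bar>r (W y)\<bar> + \<bar>2 * r' (W y) * ((fst y $ i)\<^sup>2 / (d $ i * c $ i * S (snd y)))\<bar>"
      by (rule abs_triangle_ineq)
    moreover have "\<bar>2 * r' (W y) * ((fst y $ i)\<^sup>2 / (d $ i * c $ i * S (snd y)))\<bar>
      = 2 * (\<bar>r' (W y)\<bar> * ((fst y $ i)\<^sup>2 / (d $ i * c $ i * S (snd y))))"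
      using d_pos[of i] c_pos[of i] by (simp add: abs_mult)
    moreover have "\<bar>r (W y)\<bar> \<le> 1" using r_nonneg r_le_1 by simp
    moreover have "X \<le> (1 + 2 * A) * 1" if "p \<le> A" "X \<le> R + Q" "Q = 2 * p" "R \<le> 1" for p X R Q
      using that by simp
    ultimately have "\<bar>?g' y\<bar> \<le> (1 + 2 * A) * 1" by metis
    also have "\<dots> \<le> (1 + 2 * A) * (1 + (\<Sum>i\<in>UNIV. (fst y $ i)\<^sup>2) + (\<Sum>k\<in>UNIV. (snd y $ k)\<^sup>2))"
      using A_gt_1 by (intro mult_left_mono) (auto intro!: add_nonneg_nonneg sum_nonneg)
    finally show "\<bar>?g' y\<bar> \<le> (1 + 2 * A) * (1 + (\<Sum>i\<in>UNIV. (fst y $ i)\<^sup>2) + (\<Sum>k\<in>UNIV. (snd y $ k)\<^sup>2))" .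
  qed measurable
  show "(\<integral>y. (fst y $ i - \<theta> $ i) * ?g y * data_density d \<theta> s2 y \<partial>lborel)
      = (s2 * d $ i) * (\<integral>y. ?g' y * data_density d \<theta> s2 y \<partial>lborel)"
  proof (rule Stein_identity[where b="(axis i 1, 0)" and N="{}"])
    show "0 < s2 * d $ i" using s2 d_pos by simp
    fix y :: "(real^'p) \<times> (real^'n)"
    show "((\<lambda>s. data_density d \<theta> s2 (y + s *\<^sub>R (axis i 1, 0))) has_real_derivative
      - ((fst y $ i - \<theta> $ i) / (s2 * d $ i) * data_density d \<theta> s2 y)) (at 0)"
      by (rule data_density_directional_derivative_fst[OF d_pos s2])
    have Vs: "V (fst y + s *\<^sub>R axis i 1) = V (fst y) + (2 * fst y $ i * s + s\<^sup>2) / (d $ i * c $ i)" for s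
    proof -
      have "((fst y + s *\<^sub>R axis i 1) $ k)\<^sup>2 / (d $ k * c $ k) = (fst y $ k)\<^sup>2 / (d $ k * c $ k)
        + (if k = i then (2 * fst y $ i * s + s\<^sup>2) / (d $ i * c $ i) else 0)" for k
        by (simp add: axis_def power2_sum add_divide_distrib)
      then show ?thesis unfolding V_def by (simp add: sum.distrib)
    qed
    have "((\<lambda>s. W (y + s *\<^sub>R (axis i 1, 0))) has_real_derivative
        2 * fst y $ i / (d $ i * c $ i * S (snd y))) (at 0)"
    proof -
      have "((\<lambda>s. V (fst y) + (2 * fst y $ i * s + s\<^sup>2) / (d $ i * c $ i)) has_real_derivative
          2 * fst y $ i / (d $ i * c $ i)) (at 0)"
        using d_pos[of i] c_pos[of i] by (auto intro!: derivative_eq_intros)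
      from DERIV_cdivide[OF this, of "S (snd y)"] show ?thesis
        by (simp add: W_def Vs)
    qed
    from DERIV_chain2[where g="\<lambda>s. W (y + s *\<^sub>R (axis i 1, 0))" and x=0, OF _ this, of r "r' (W y)"]
    have "((\<lambda>s. r (W (y + s *\<^sub>R (axis i 1, 0)))) has_real_derivative
        r' (W y) * (2 * fst y $ i / (d $ i * c $ i * S (snd y)))) (at 0)"
      using r_derivative[OF nonneg_gt[OF W_nonneg], of y] by (simp flip: zero_prod_def)
    note rd = this
    have xd: "((\<lambda>s. fst (y + s *\<^sub>R (axis i 1, 0 :: real^'n)) $ i) has_real_derivative 1) (at 0)"
      by (auto intro!: derivative_eq_intros)
    have "((\<lambda>s. ?g (y + s *\<^sub>R (axis i 1, 0))) has_real_derivative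
        r' (W y) * (2 * fst y $ i / (d $ i * c $ i * S (snd y))) * fst y $ i + 1 * r (W y)) (at 0)"
      using DERIV_mult[OF rd xd] by (simp flip: zero_prod_def)
    then show "((\<lambda>s. ?g (y + s *\<^sub>R (axis i 1, 0))) has_real_derivative ?g' y) (at 0)"
      by (simp add: power2_eq_square algebra_simps)
  qed (use int_g int_g' int_mg in auto)
qed

text \<open>Summed over \<open>k\<close>, this is the identity for \<open>E(S h)\<close> with \<open>S\<close> a multiple of a chi-square variable.
  The set \<open>Z = 0\<close>, where \<open>W\<close> is junk, is exceptional; it meets a coordinate line in at most a point.\<close>

lemma Stein_snd:
  assumes s2: "0 < s2" and [measurable]: "q \<in> borel_measurable borel"
    and q: "\<And>x. 0 \<le> q x" "\<And>x. q x \<le> M"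
  shows "integrable lborel (\<lambda>y. snd y $ k * (q (fst y) * snd y $ k * h (W y)) * data_density d \<theta> s2 y)"
    and "integrable lborel (\<lambda>y. q (fst y) * (h (W y) - 2 * (W y * h' (W y)) * ((snd y $ k)\<^sup>2 / S (snd y)))
      * data_density d \<theta> s2 y)"
    and "(\<integral>y. snd y $ k * (q (fst y) * snd y $ k * h (W y)) * data_density d \<theta> s2 y \<partial>lborel)
      = s2 * (\<integral>y. q (fst y) * (h (W y) - 2 * (W y * h' (W y)) * ((snd y $ k)\<^sup>2 / S (snd y)))
        * data_density d \<theta> s2 y \<partial>lborel)"
proof -
  let ?g = "\<lambda>y. q (fst y) * snd y $ k * h (W y)"
  \<comment> \<open>Along coordinate k of Z, W has derivative -2 W Z_k/S; with the factor Z_k of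
    \<open>?g\<close> this gives the ratio Z_k^2/S, and these ratios sum to 1 where S > 0.
    \<open>q\<close> depends on X only and is constant along the line.\<close>
  let ?g' = "\<lambda>y. q (fst y) * (h (W y) - 2 * (W y * h' (W y)) * ((snd y $ k)\<^sup>2 / S (snd y)))"
  have M: "0 \<le> M" using q[of 0] by simp
  have z2: "(snd y $ k)\<^sup>2 \<le> (\<Sum>i\<in>UNIV. (fst y $ i)\<^sup>2) + (\<Sum>k\<in>UNIV. (snd y $ k)\<^sup>2)"
    for y :: "(real^'p) \<times> (real^'n)"
    using member_le_sum[of k UNIV "\<lambda>k. (snd y $ k)\<^sup>2"] sum_nonneg[of UNIV "\<lambda>i. (fst y $ i)\<^sup>2"] by simp
  have z1: "\<bar>snd y $ k\<bar> \<le> 1 + (snd y $ k)\<^sup>2" for y :: "(real^'p) \<times> (real^'n)"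
  proof -
    have "0 \<le> (1 - \<bar>snd y $ k\<bar>)\<^sup>2" by simp
    then show ?thesis
      unfolding power2_diff by (simp add: power2_eq_square abs_mult)
  qed
  have qh: "q (fst y) * h (W y) \<le> M * phi_max" "0 \<le> q (fst y) * h (W y)" for y
    using q h_bounds[OF W_nonneg, of y] M by (auto intro!: mult_mono)
  have gz: "\<bar>?g y\<bar> \<le> M * phi_max * \<bar>snd y $ k\<bar>" for y
  proof -
    have "\<bar>?g y\<bar> = (q (fst y) * h (W y)) * \<bar>snd y $ k\<bar>"
      using q h_bounds[OF W_nonneg, of y] by (simp add: abs_mult)
    then show ?thesis using qh[of y] by (simp add: mult_right_mono)
  qed
  have int_g: "integrable lborel (\<lambda>y. ?g y * data_density d \<theta> s2 y)"
  proof (rule integrable_mult_data_density[OF d_pos s2])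
    fix y :: "(real^'p) \<times> (real^'n)"
    have "M * phi_max * \<bar>snd y $ k\<bar> \<le> M * phi_max * (1 + (\<Sum>i\<in>UNIV. (fst y $ i)\<^sup>2) + (\<Sum>k\<in>UNIV. (snd y $ k)\<^sup>2))"
      using z1[of y] z2[of y] M phi_max_nonneg by (intro mult_left_mono) auto
    with gz[of y] show "\<bar>?g y\<bar> \<le> M * phi_max * (1 + (\<Sum>i\<in>UNIV. (fst y $ i)\<^sup>2) + (\<Sum>k\<in>UNIV. (snd y $ k)\<^sup>2))"
      by linarith
  qed measurable
  show int_mg: "integrable lborel (\<lambda>y. snd y $ k * ?g y * data_density d \<theta> s2 y)"
  proof (rule integrable_mult_data_density[OF d_pos s2])
    fix y :: "(real^'p) \<times> (real^'n)"
    have "\<bar>snd y $ k * ?g y\<bar> \<le> \<bar>snd y $ k\<bar> * (M * phi_max * \<bar>snd y $ k\<bar>)"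
      unfolding abs_mult[of "snd y $ k"] by (rule mult_left_mono[OF gz]) simp
    also have "\<dots> = M * phi_max * (snd y $ k)\<^sup>2"
      by (simp add: power2_eq_square)
    also have "\<dots> \<le> M * phi_max * (1 + (\<Sum>i\<in>UNIV. (fst y $ i)\<^sup>2) + (\<Sum>k\<in>UNIV. (snd y $ k)\<^sup>2))"
      using z2[of y] M phi_max_nonneg by (intro mult_left_mono) auto
    finally show "\<bar>snd y $ k * ?g y\<bar>
      \<le> M * phi_max * (1 + (\<Sum>i\<in>UNIV. (fst y $ i)\<^sup>2) + (\<Sum>k\<in>UNIV. (snd y $ k)\<^sup>2))" .
  qed measurable
  show int_g': "integrable lborel (\<lambda>y. ?g' y * data_density d \<theta> s2 y)"
  proof (rule integrable_mult_data_density[OF d_pos s2])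
    fix y :: "(real^'p) \<times> (real^'n)"
    have zS: "0 \<le> (snd y $ k)\<^sup>2 / S (snd y)" "(snd y $ k)\<^sup>2 / S (snd y) \<le> 1"
    proof -
      have "(snd y $ k)\<^sup>2 \<le> S (snd y)"
        using member_le_sum[of k UNIV "\<lambda>k. (snd y $ k)\<^sup>2"] by (simp add: S_def)
      then show "(snd y $ k)\<^sup>2 / S (snd y) \<le> 1"
        using S_nonneg[of "snd y"] by (cases "S (snd y) = 0") (simp_all add: divide_le_eq_1 less_le)
    qed simp
    have "\<bar>2 * (W y * h' (W y)) * ((snd y $ k)\<^sup>2 / S (snd y))\<bar> = 2 * \<bar>W y * h' (W y)\<bar> * ((snd y $ k)\<^sup>2 / S (snd y))"
      using zS by (simp add: abs_mult)
    also have "\<dots> \<le> 2 * ((1 + 2 * A) * phi_max) * 1"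
      using h_bounds(3)[OF W_nonneg, of y] zS A_gt_1 phi_max_nonneg by (intro mult_mono) auto
    finally have "\<bar>h (W y) - 2 * (W y * h' (W y)) * ((snd y $ k)\<^sup>2 / S (snd y))\<bar>
        \<le> phi_max + 2 * ((1 + 2 * A) * phi_max)"
      using h_bounds(1,2)[OF W_nonneg, of y] by linarith
    then have "\<bar>?g' y\<bar> \<le> M * (phi_max + 2 * ((1 + 2 * A) * phi_max))"
      unfolding abs_mult using q M by (intro mult_mono) auto
    also have "\<dots> \<le> M * (phi_max + 2 * ((1 + 2 * A) * phi_max)) * (1 + (\<Sum>i\<in>UNIV. (fst y $ i)\<^sup>2) + (\<Sum>k\<in>UNIV. (snd y $ k)\<^sup>2))"
    proof -
      have "0 \<le> M * (phi_max + 2 * ((1 + 2 * A) * phi_max))"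
        using M phi_max_nonneg A_gt_1 by simp
      from mult_left_mono[OF _ this, of 1 "1 + (\<Sum>i\<in>UNIV. (fst y $ i)\<^sup>2) + (\<Sum>k\<in>UNIV. (snd y $ k)\<^sup>2)"]
      show ?thesis by (simp add: add_nonneg_nonneg sum_nonneg)
    qed
    finally show "\<bar>?g' y\<bar> \<le> M * (phi_max + 2 * ((1 + 2 * A) * phi_max))
      * (1 + (\<Sum>i\<in>UNIV. (fst y $ i)\<^sup>2) + (\<Sum>k\<in>UNIV. (snd y $ k)\<^sup>2))" .
  qed measurable
  show "(\<integral>y. snd y $ k * ?g y * data_density d \<theta> s2 y \<partial>lborel)
      = s2 * (\<integral>y. ?g' y * data_density d \<theta> s2 y \<partial>lborel)"
  proof (rule Stein_identity[where b="(0, axis k 1)" and N="{y. snd y = 0}"])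
    fix y :: "(real^'p) \<times> (real^'n)"
    show "((\<lambda>s. data_density d \<theta> s2 (y + s *\<^sub>R (0, axis k 1))) has_real_derivative
      - (snd y $ k / s2 * data_density d \<theta> s2 y)) (at 0)"
      by (rule data_density_directional_derivative_snd[OF s2])
    have "{s. y + s *\<^sub>R (0, axis k 1) \<in> {y. snd y = 0}} \<subseteq> {- snd y $ k}"
    proof clarsimp
      fix s assume "snd y + s *\<^sub>R axis k 1 = 0"
      then have "(snd y + s *\<^sub>R axis k 1) $ k = 0" by simp
      then show "s = - snd y $ k" by simp
    qed
    then show "finite {s. y + s *\<^sub>R (0, axis k 1) \<in> {y. snd y = 0}}"
      by (rule finite_subset) simp
  next
    fix y :: "(real^'p) \<times> (real^'n)" assume "y \<in> {y. snd y = 0}"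
    then have y: "snd y = 0" by simp
    \<comment> \<open>From Z = 0 the line has Z_k = s, and \<open>h\<close> is bounded although W
      blows up, so \<open>?g\<close> is of order |s|.\<close>
    have "((\<lambda>s. ?g (y + s *\<^sub>R (0, axis k 1))) \<longlongrightarrow> 0) (at 0)"
    proof (rule Lim_null_comparison[of _ "\<lambda>s. M * phi_max * \<bar>s\<bar>"])
      show "\<forall>\<^sub>F s in at 0. norm (?g (y + s *\<^sub>R (0, axis k 1))) \<le> M * phi_max * \<bar>s\<bar>"
      proof (rule always_eventually, rule allI)
        fix s
        show "norm (?g (y + s *\<^sub>R (0, axis k 1))) \<le> M * phi_max * \<bar>s\<bar>"
          using gz[of "y + s *\<^sub>R (0, axis k 1)"] y by simp
      qed
      show "((\<lambda>s. M * phi_max * \<bar>s\<bar>) \<longlongrightarrow> 0) (at (0::real))"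
        by (auto intro!: tendsto_eq_intros)
    qed
    then show "isCont (\<lambda>s. ?g (y + s *\<^sub>R (0, axis k 1))) 0"
      using y by (simp add: isCont_def)
  next
    fix y :: "(real^'p) \<times> (real^'n)" assume "y \<notin> {y. snd y = 0}"
    then have S: "0 < S (snd y)" using S_pos by simp
    have Ss: "S (snd y + s *\<^sub>R axis k 1) = S (snd y) + (2 * snd y $ k * s + s\<^sup>2)" for s
    proof -
      have "((snd y + s *\<^sub>R axis k 1) $ l)\<^sup>2 = (snd y $ l)\<^sup>2
        + (if l = k then 2 * snd y $ k * s + s\<^sup>2 else 0)" for l
        by (simp add: axis_def power2_sum)
      then show ?thesis unfolding S_def by (simp add: sum.distrib)
    qed
    have "((\<lambda>s. W (y + s *\<^sub>R (0, axis k 1))) has_real_derivative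
        - (W y * (2 * snd y $ k) / S (snd y))) (at 0)"
      unfolding W_def using S
      by (simp add: Ss) (auto intro!: derivative_eq_intros simp: field_simps power2_eq_square)
    from DERIV_chain2[where g="\<lambda>s. W (y + s *\<^sub>R (0, axis k 1))" and x=0, OF _ this, of h "h' (W y)"]
    have "((\<lambda>s. h (W (y + s *\<^sub>R (0, axis k 1)))) has_real_derivative
        h' (W y) * - (W y * (2 * snd y $ k) / S (snd y))) (at 0)"
      using h_derivative[OF W_nonneg, of y] by (simp flip: zero_prod_def)
    note hd = this
    have zd: "((\<lambda>s. q (fst y) * snd (y + s *\<^sub>R (0 :: real^'p, axis k 1)) $ k) has_real_derivative q (fst y)) (at 0)"
      by (auto intro!: derivative_eq_intros)
    have "((\<lambda>s. q (fst y) * snd (y + s *\<^sub>R (0 :: real^'p, axis k 1)) $ k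
        * h (W (y + s *\<^sub>R (0, axis k 1)))) has_real_derivative
        q (fst y) * h (W y) + h' (W y) * - (W y * (2 * snd y $ k) / S (snd y)) * (q (fst y) * snd y $ k)) (at 0)"
      using DERIV_mult[OF zd hd] by (simp flip: zero_prod_def)
    then show "((\<lambda>s. ?g (y + s *\<^sub>R (0, axis k 1))) has_real_derivative ?g' y) (at 0)"
      by (simp add: power2_eq_square algebra_simps)
  qed (use s2 int_g int_g' int_mg in auto)
qed

text \<open>With \<phi>(w) = w r(w), regroup so that the derivative occurs only in -4 q \<phi>'(1 +
  \<phi>), which is nonpositive. The rest is \<open>r w\<close> times an expression nondecreasing in
  \<open>q\<close> and in \<phi>, so both may be replaced by their upper bounds.\<close>

lemma risk_integrand_nonpos:
  assumes w: "0 \<le> w" and q: "0 \<le> q" "q \<le> M" and cond: "(N + 2) * phi_max * M \<le> 2 * T - 4 * M" and N: "0 \<le> N"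
  shows "- 2 * (T * r w + 2 * r' w * (q * w)) + q * (N * h w - 2 * (w * h' w)) \<le> 0"
proof -
  have \<phi>': "0 \<le> r w + w * r' w" by (rule mult_r_derivative_nonneg[OF w])
  have "- 2 * (T * r w + 2 * r' w * (q * w)) + q * (N * h w - 2 * (w * h' w))
      = r w * (- 2 * T + 4 * q + (N + 2) * (w * r w) * q)
        - 4 * q * (r w + w * r' w) * (1 + w * r w)"
    by (simp add: h_def h'_def power2_eq_square algebra_simps)
  also have "\<dots> \<le> r w * (- 2 * T + 4 * q + (N + 2) * (w * r w) * q)"
    using \<phi>' q w r_nonneg[of w] by simp
  also have "\<dots> \<le> r w * (- 2 * T + 4 * M + (N + 2) * phi_max * M)"
  proof (rule mult_left_mono)
    have "(w * r w) * q \<le> phi_max * M"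
      using q w r_nonneg[of w] mult_r_le[OF w] phi_max_nonneg by (intro mult_mono) (simp_all add: phi_max_def)
    then have "(N + 2) * ((w * r w) * q) \<le> (N + 2) * (phi_max * M)"
      using N by (intro mult_left_mono) auto
    with q show "- 2 * T + 4 * q + (N + 2) * (w * r w) * q \<le> - 2 * T + 4 * M + (N + 2) * phi_max * M"
      by (simp add: mult.assoc)
  qed (rule r_nonneg)
  also have "\<dots> \<le> 0"
    using cond r_nonneg[of w] by (intro mult_nonneg_nonpos) auto
  finally show ?thesis .
qed

text \<open>Expanding the square gives the loss of X, a cross term and a squared term. The Stein
  identities turn the last two into s2 times one integral with nonpositive integrand.\<close>

lemma risk_gen_bayes_le:
  assumes s2: "0 < s2" and M: "\<And>i. d $ i powr (1 - j) / c $ i \<le> M"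
    and cond: "(real CARD('n) + 2) * phi_max * M \<le> 2 * (\<Sum>i\<in>UNIV. d $ i powr (1 - j) / c $ i) - 4 * M"
  shows "risk j d (gen_bayes a b e \<gamma> c d :: (real^'p) \<times> (real^'n) \<Rightarrow> real^'p) \<theta> s2
    \<le> ennreal (\<Sum>i\<in>UNIV. d $ i powr (1 - j))"
proof -
  define \<omega> where "\<omega> i = d $ i powr (1 - j) / c $ i" for i
  define Q where "Q x = (\<Sum>i\<in>UNIV. \<omega> i * ((x $ i)\<^sup>2 / (d $ i * c $ i)))" for x :: "real^'p"
  \<comment> \<open>A weighted average of the \<open>\<omega> i\<close>, hence at most
    \<open>M\<close>. For V = 0 division by zero gives 0, which agrees with Q = 0.\<close>
  define q where "q x = Q x / V x" for x
  define f where "f = (data_density d \<theta> s2 :: (real^'p) \<times> (real^'n) \<Rightarrow> real)"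
  let ?T = "\<Sum>i\<in>UNIV. d $ i powr (1 - j)"
  have dj: "d $ i powr (1 - j) = d $ i * d $ i powr (- j)" for i
    using d_pos[of i] powr_add[of "d $ i" 1 "- j"] by simp
  have \<omega>: "0 \<le> \<omega> i" "\<omega> i \<le> M" for i
    using M[of i] c_pos[of i] by (auto simp: \<omega>_def)
  have term_nonneg: "0 \<le> (x $ i)\<^sup>2 / (d $ i * c $ i)" for x :: "real^'p" and i
    using d_pos[of i] c_pos[of i] by simp
  have Q: "0 \<le> Q x" "Q x \<le> M * V x" for x
  proof -
    show "0 \<le> Q x" unfolding Q_def using \<omega> term_nonneg by (intro sum_nonneg mult_nonneg_nonneg)
    show "Q x \<le> M * V x"
      unfolding Q_def V_def sum_distrib_left using \<omega> term_nonneg by (intro sum_mono mult_right_mono)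
  qed
  have M0: "0 \<le> M" using \<omega> order_trans by blast
  have q: "0 \<le> q x" "q x \<le> M" and qV: "q x * V x = Q x" for x
  proof -
    show "0 \<le> q x" using Q by (simp add: q_def)
    have "V x = 0 \<or> 0 < V x" using V_nonneg[of x] by linarith
    then show "q x \<le> M" "q x * V x = Q x"
      using Q[of x] M0 by (auto simp: q_def divide_le_eq)
  qed
  have [measurable]: "q \<in> borel_measurable borel"
    unfolding q_def[abs_def] Q_def by measurable
  let ?E1 = "\<lambda>i y. (fst y $ i - \<theta> $ i) * (r (W y) * fst y $ i)"
  let ?R1 = "\<lambda>i y. r (W y) + 2 * r' (W y) * ((fst y $ i)\<^sup>2 / (d $ i * c $ i * S (snd y)))"
  let ?E2 = "\<lambda>k y. snd y $ k * (q (fst y) * snd y $ k * h (W y))"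
  let ?R2 = "\<lambda>k y. q (fst y) * (h (W y) - 2 * (W y * h' (W y)) * ((snd y $ k)\<^sup>2 / S (snd y)))"
  note St1 = Stein_fst[OF s2, of _ \<theta>, folded f_def]
  note St2 = Stein_snd[OF s2 \<open>q \<in> borel_measurable borel\<close> q, of _ \<theta>, folded f_def]
  have sq: "integrable lborel (\<lambda>y. (fst y $ i - \<theta> $ i)\<^sup>2 * f y)"
      "(\<integral>y. (fst y $ i - \<theta> $ i)\<^sup>2 * f y \<partial>lborel) = s2 * d $ i" for i
    using has_bochner_integral_data_density_square[OF d_pos s2, of i "\<theta> $ i" \<theta>, where 'n='n]
    by (simp_all add: has_bochner_integral_iff f_def)
  \<comment> \<open>s2 times loss times density, arranged so that each summand of the last two sums
    is a left side of a Stein identity. The agreement holds where Z is nonzero, hence almost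
    everywhere.\<close>
  define L where "L y = (\<Sum>i\<in>UNIV. d $ i powr (- j) * ((fst y $ i - \<theta> $ i)\<^sup>2 * f y))
    - 2 * (\<Sum>i\<in>UNIV. d $ i powr (- j) / c $ i * (?E1 i y * f y)) + (\<Sum>k\<in>UNIV. ?E2 k y * f y)" for y
  have L_eq: "s2 * loss j d (gen_bayes a b e \<gamma> c d y) \<theta> s2 * f y = L y" if "snd y \<noteq> 0" for y
  proof -
    have S: "0 < S (snd y)" using S_pos[OF that] .
    have "s2 * loss j d (gen_bayes a b e \<gamma> c d y) \<theta> s2
        = (\<Sum>i\<in>UNIV. d $ i powr (- j) * ((1 - r (W y) / c $ i) * fst y $ i - \<theta> $ i)\<^sup>2)"
      using s2 by (simp add: loss_def gen_bayes_eq[OF S])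
    also have "\<dots> = (\<Sum>i\<in>UNIV. d $ i powr (- j) * (fst y $ i - \<theta> $ i)\<^sup>2
        - 2 * (d $ i powr (- j) / c $ i * ?E1 i y)
        + (r (W y))\<^sup>2 * (\<omega> i * ((fst y $ i)\<^sup>2 / (d $ i * c $ i))))"
    proof (rule sum.cong[OF refl])
      fix i
      have dd: "\<omega> i * ((fst y $ i)\<^sup>2 / (d $ i * c $ i)) = d $ i powr (- j) * (fst y $ i / c $ i)\<^sup>2"
        using d_pos[of i] by (simp add: \<omega>_def dj power2_eq_square)
      have e: "(1 - r (W y) / c $ i) * fst y $ i - \<theta> $ i = (fst y $ i - \<theta> $ i) - r (W y) * (fst y $ i / c $ i)"
        by (simp add: algebra_simps)
      show "d $ i powr (- j) * ((1 - r (W y) / c $ i) * fst y $ i - \<theta> $ i)\<^sup>2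
        = d $ i powr (- j) * (fst y $ i - \<theta> $ i)\<^sup>2 - 2 * (d $ i powr (- j) / c $ i * ?E1 i y)
        + (r (W y))\<^sup>2 * (\<omega> i * ((fst y $ i)\<^sup>2 / (d $ i * c $ i)))"
        unfolding dd e power2_diff power_mult_distrib
        by (simp add: algebra_simps add_divide_distrib diff_divide_distrib)
    qed
    also have "\<dots> = (\<Sum>i\<in>UNIV. d $ i powr (- j) * (fst y $ i - \<theta> $ i)\<^sup>2)
        - 2 * (\<Sum>i\<in>UNIV. d $ i powr (- j) / c $ i * ?E1 i y) + (r (W y))\<^sup>2 * Q (fst y)"
      by (simp add: sum.distrib sum_subtractf sum_distrib_left Q_def)
    \<comment> \<open>The passage from X to Z: r^2 Q = q V r^2 = q S h(W), and S is the sum of the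
      squares of the Z_k.\<close>
    also have "(r (W y))\<^sup>2 * Q (fst y) = (\<Sum>k\<in>UNIV. ?E2 k y)"
    proof -
      have "(\<Sum>k\<in>UNIV. ?E2 k y) = q (fst y) * (S (snd y) * h (W y))"
        by (simp add: S_def sum_distrib_left sum_distrib_right power2_eq_square mult_ac)
      also have "S (snd y) * h (W y) = V (fst y) * (r (W y))\<^sup>2"
        using S by (simp add: h_def W_def)
      finally show ?thesis by (simp add: qV[symmetric] mult_ac)
    qed
    finally show ?thesis
      by (simp add: L_def distrib_right left_diff_distrib sum_distrib_right mult.assoc)
  qed
  have int_L: "integrable lborel L"
    unfolding L_def[abs_def]
    by (intro Bochner_Integration.integrable_add Bochner_Integration.integrable_diff
      Bochner_Integration.integrable_sum integrable_mult_right sq St1(1) St2(1))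
  \<comment> \<open>The right sides of the Stein identities, with the common factor s2 removed; in
    the X part the variance s2 d_i has turned d_i^(-j)/c_i into s2 times
    \<open>\<omega> i\<close>.\<close>
  let ?R = "\<lambda>y. (- 2 * (\<Sum>i\<in>UNIV. \<omega> i * ?R1 i y) + (\<Sum>k\<in>UNIV. ?R2 k y)) * f y"
  have R_split: "?R y = - 2 * (\<Sum>i\<in>UNIV. \<omega> i * (?R1 i y * f y)) + (\<Sum>k\<in>UNIV. ?R2 k y * f y)" for y
    by (simp only: distrib_right sum_distrib_right mult.assoc)
  have R_le: "?R y \<le> 0" for y
  proof -
    have 1: "(\<Sum>i\<in>UNIV. \<omega> i * ?R1 i y) = (\<Sum>i\<in>UNIV. \<omega> i) * r (W y) + 2 * r' (W y) * (q (fst y) * W y)"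
    proof -
      have "(\<Sum>i\<in>UNIV. \<omega> i * ?R1 i y) = (\<Sum>i\<in>UNIV. \<omega> i) * r (W y) + 2 * r' (W y) * (Q (fst y) / S (snd y))"
        by (simp add: Q_def sum_divide_distrib sum_distrib_left sum_distrib_right sum.distrib[symmetric] algebra_simps)
      then show ?thesis by (simp add: qV[symmetric] W_def)
    qed
    have 2: "(\<Sum>k\<in>UNIV. ?R2 k y) = q (fst y) * (real CARD('n) * h (W y) - 2 * (W y * h' (W y)))"
    proof -
      have "(\<Sum>k\<in>UNIV. ?R2 k y)
          = q (fst y) * (real CARD('n) * h (W y) - 2 * (W y * h' (W y)) * (S (snd y) / S (snd y)))"
        by (simp add: S_def sum_distrib_left[symmetric] sum_subtractf sum_divide_distrib[symmetric])
      \<comment> \<open>The quotient S/S is 1 unless S = 0, and then W is 0 and removes the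
        term.\<close>
      then show ?thesis by (cases "S (snd y) = 0") (simp_all add: W_def)
    qed
    have "- 2 * (\<Sum>i\<in>UNIV. \<omega> i * ?R1 i y) + (\<Sum>k\<in>UNIV. ?R2 k y) \<le> 0"
      unfolding 1 2 using cond by (intro risk_integrand_nonpos[where M=M] q W_nonneg) (auto simp: \<omega>_def)
    then show ?thesis by (intro mult_nonpos_nonneg) (auto simp: f_def)
  qed
  have "integral\<^sup>L lborel L = (\<Sum>i\<in>UNIV. d $ i powr (- j) * (s2 * d $ i))
      - 2 * (\<Sum>i\<in>UNIV. d $ i powr (- j) / c $ i * (\<integral>y. ?E1 i y * f y \<partial>lborel))
      + (\<Sum>k\<in>UNIV. \<integral>y. ?E2 k y * f y \<partial>lborel)"
    unfolding L_def[abs_def]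
    by (subst Bochner_Integration.integral_add Bochner_Integration.integral_diff
        Bochner_Integration.integral_sum integral_mult_right_zero sq(2);
      (intro Bochner_Integration.integrable_add Bochner_Integration.integrable_diff
      Bochner_Integration.integrable_sum integrable_mult_right sq St1(1) St2(1))?)+ simp?
  also have "\<dots> = s2 * (?T + (\<integral>y. ?R y \<partial>lborel))"
  proof -
    have R: "(\<integral>y. ?R y \<partial>lborel) = - 2 * (\<Sum>i\<in>UNIV. \<omega> i * (\<integral>y. ?R1 i y * f y \<partial>lborel))
        + (\<Sum>k\<in>UNIV. \<integral>y. ?R2 k y * f y \<partial>lborel)"
      unfolding R_split using St1(2) St2(2) by simp
    have E0: "(\<Sum>i\<in>UNIV. d $ i powr (- j) * (s2 * d $ i)) = s2 * ?T"
      by (simp add: dj sum_distrib_left mult_ac)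
    have E1: "(\<Sum>i\<in>UNIV. d $ i powr (- j) / c $ i * (\<integral>y. ?E1 i y * f y \<partial>lborel))
        = s2 * (\<Sum>i\<in>UNIV. \<omega> i * (\<integral>y. ?R1 i y * f y \<partial>lborel))"
      unfolding St1(3) \<omega>_def dj sum_distrib_left by (intro sum.cong refl) simp
    have E2: "(\<Sum>k\<in>UNIV. \<integral>y. ?E2 k y * f y \<partial>lborel) = s2 * (\<Sum>k\<in>UNIV. \<integral>y. ?R2 k y * f y \<partial>lborel)"
      unfolding St2(3) sum_distrib_left ..
    have "s2 * t - 2 * (s2 * u) + s2 * v = s2 * (t + (- 2 * u + v))" for t u v
      by (simp add: algebra_simps)
    then show ?thesis unfolding R E0 E1 E2 .
  qed
  also have "\<dots> \<le> s2 * ?T"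
  proof -
    have "0 \<le> (\<integral>y. - ?R y \<partial>lborel)"
      using R_le by (intro Bochner_Integration.integral_nonneg) simp
    then have "(\<integral>y. ?R y \<partial>lborel) \<le> 0" by simp
    then show ?thesis using s2 by (intro mult_left_mono) auto
  qed
  finally have L_le: "integral\<^sup>L lborel L \<le> s2 * ?T" .
  have AE_L: "AE y in lborel. loss j d (gen_bayes a b e \<gamma> c d y) \<theta> s2 * f y = L y / s2"
    using AE_lborel_snd_nonzero
  proof eventually_elim
    case (elim y)
    from L_eq[OF this] s2 show ?case by (simp add: field_simps)
  qed
  have loss_nonneg: "0 \<le> loss j d \<delta> \<theta> s2" for \<delta>
    unfolding loss_def using s2 by (intro divide_nonneg_nonneg sum_nonneg) auto
  have "risk j d (gen_bayes a b e \<gamma> c d :: (real^'p) \<times> (real^'n) \<Rightarrow> real^'p) \<theta> s2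
      = (\<integral>\<^sup>+y. ennreal (L y / s2) \<partial>lborel)"
    unfolding risk_eq[OF measurable_gen_bayes] f_def[symmetric]
  proof (rule nn_integral_cong_AE)
    show "AE y in lborel. ennreal (loss j d (gen_bayes a b e \<gamma> c d y) \<theta> s2) * ennreal (f y) = ennreal (L y / s2)"
      using AE_L
    proof eventually_elim
      case (elim y)
      then show ?case
        using loss_nonneg by (simp add: ennreal_mult[symmetric] f_def)
    qed
  qed
  \<comment> \<open>The loss is nonnegative, so \<open>L\<close> is nonnegative almost everywhere
    and the extended risk equals the Bochner integral just bounded; in particular the risk is
    finite.\<close>
  also have "\<dots> = ennreal (\<integral>y. L y / s2 \<partial>lborel)"
  proof (rule nn_integral_eq_integral)
    show "AE y in lborel. 0 \<le> L y / s2"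
      using AE_L
    proof eventually_elim
      case (elim y)
      then show ?case using loss_nonneg by (simp add: f_def flip: elim)
    qed
  qed (use int_L in simp)
  also have "\<dots> \<le> ennreal ?T"
    using L_le s2 by (intro ennreal_leI) (simp add: divide_le_eq mult.commute)
  finally show ?thesis .
qed

end

theorem theorem2p3:
  fixes d c :: "real ^ 'p::{finite, linorder}"
    and a b e \<gamma> j :: real
  assumes d_decreasing: "\<And>i k. i \<le> k \<Longrightarrow> d $ k \<le> d $ i"
    and d_pos: "\<And>i. 0 < d $ i"
    and c_ge_1: "\<And>i. 1 \<le> c $ i"
    and \<gamma>_ge_1: "1 \<le> \<gamma>"
    and b_nonneg: "0 \<le> b"
    and e_lower: "- real CARD('p) / 2 - real CARD('n) / 2 - 2 < e"
    and a_lower: "- real CARD('p) / 2 - 1 < a"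
    and a_upper: "a < real CARD('n) / 2 + e"
    and cond_nonneg: "0 \<le> (real CARD('p) / 2 + a + 1) / (real CARD('n) / 2 + e - a)"
    and cond_le: "(real CARD('p) / 2 + a + 1) / (real CARD('n) / 2 + e - a)
        \<le> 2 / (real CARD('n) + 2) *
            ((\<Sum>i\<in>UNIV. (d $ i) powr (1 - j) / c $ i)
               / (MAX i\<in>UNIV. (d $ i) powr (1 - j) / c $ i) - 2)"
  shows "minimax j d
           (gen_bayes a b e \<gamma> c d :: (real ^ 'p::{finite, linorder}) \<times> (real ^ 'n::finite)
             \<Rightarrow> real ^ 'p::{finite, linorder})"
proof -
  define M where "M = (MAX i\<in>UNIV. (d $ i) powr (1 - j) / c $ i)"
  let ?T = "\<Sum>i\<in>UNIV. (d $ i) powr (1 - j) / c $ i"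
  \<comment> \<open>The locale condition \<open>\<alpha> + 2 < A\<close> reads a < n/2 + e
    here.\<close>
  interpret normal_mixture_prior "real CARD('p) / 2 + a" b
      "real CARD('p) / 2 + real CARD('n) / 2 + e + 2" \<gamma> d c a e "TYPE('n)"
    by unfold_locales (use assms in auto)
  have M: "d $ i powr (1 - j) / c $ i \<le> M" for i
    unfolding M_def by (intro Max_ge) auto
  have "0 < d $ i powr (1 - j) / c $ i" for i
    using d_pos[of i] c_pos[of i] by simp
  with M have M0: "0 < M" by (meson less_le_trans)
  have m: "phi_max \<le> 2 / (real CARD('n) + 2) * (?T / M - 2)"
    using cond_le unfolding phi_max_def M_def by (simp add: algebra_simps)
  \<comment> \<open>Multiplying the hypothesis by n + 2 and by the positive maximum \<open>M\<close>
    clears both denominators.\<close>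
  have "(real CARD('n) + 2) * phi_max * M \<le> (real CARD('n) + 2) * (2 / (real CARD('n) + 2) * (?T / M - 2)) * M"
    using m M0 by (intro mult_right_mono mult_left_mono) auto
  also have "\<dots> = 2 * ?T - 4 * M"
  proof -
    have "x * (2 / x * (t / M - 2)) * M = 2 * t - 4 * M" if "0 < x" for x t
      using that M0 by (simp add: field_simps)
    from this[of "real CARD('n) + 2" ?T] show ?thesis by linarith
  qed
  finally have cond: "(real CARD('n) + 2) * phi_max * M \<le> 2 * ?T - 4 * M" .
  have le: "(SUP (\<theta>, s2) \<in> UNIV \<times> {0<..}. risk j d
      (gen_bayes a b e \<gamma> c d :: (real ^ 'p::{finite, linorder}) \<times> (real ^ 'n)
        \<Rightarrow> real ^ 'p::{finite, linorder}) \<theta> s2)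
      \<le> ennreal (\<Sum>i\<in>UNIV. d $ i powr (1 - j))"
    using risk_gen_bayes_le[OF _ M cond] by (intro SUP_least) auto
  show ?thesis
    unfolding minimax_def
    using measurable_gen_bayes order_trans[OF le constant_risk_le_SUP_risk[OF d_pos]] by blast
qed

end
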